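(* Let $n\ge1$. If the target manifold of the wave map $\phi:\mathbf{R}^{n+1}\to\mathcal M$ is the sphere $\mathcal M=S^{m-1}$, $m\ge2$, then there exist coordinates on the target for which the solution operator to the wave map equation $$\Box\phi^k+\Gamma^k_{\alpha\beta}(\phi)\,\partial_\mu\phi^\alpha\partial^\mu\phi^\beta=0,\qquad(\phi,\phi_t)|_{t=0}=(f,g),$$ is not twice differentiable on the data space $H^{n/2}(\mathbf{R}^n)$.
   Context: $\mathbf{R}^{n+1}$ is Minkowski space with flat metric $\mathrm{diag}(1,\dots,1,-1)$ and coordinates $(x,t)$, $\Box=\Delta_x-\partial_t^2$, and indices $\mu$ are raised with this metric and summed; $\Gamma^k_{\alpha\beta}$ are the Christoffel symbols of the target. "Coordinates" on the target is used in a broad sense, allowing extrinsic coordinates such as those of the ambient space $\mathbf{R}^m\supset S^{m-1}$, in which the equation reads $\Box\phi+\phi\,\partial_\mu\phi^t\partial^\mu\phi=0$ with $f(x)\in S^{m-1}$, $f(x)^tg(x)=0$ (elements of $\mathbf{R}^m$ being column vectors and $\phi^t$ the transpose). "Data space $H^{n/2}$" means initial position in $H^{n/2}(\mathbf{R}^n)$ and initial velocity in $H^{n/2-1}(\mathbf{R}^n)$ (for sphere-valued positions, understood up to constants). The solution operator is the map taking the Cauchy data to the solution $\phi(\cdot,t)$ at a later time $t$ (e.g. $t=1$), and differentiability is as a map from the data space into $H^{n/2}(\mathbf{R}^n)$ (relative to the given coordinates). *)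

theory Defs
  imports "HOL-Analysis.Analysis" "HOL-Library.Function_Algebras"
begin

section \<open>Pointwise vector space structure on functions\<close>

instantiation "fun" :: (type, real_vector) real_vector
begin

definition scaleR_fun :: "real \<Rightarrow> ('a \<Rightarrow> 'b) \<Rightarrow> 'a \<Rightarrow> 'b"
  where "scaleR_fun r f = (\<lambda>x. r *\<^sub>R f x)"

instance
  by standard (auto simp: scaleR_fun_def fun_eq_iff scaleR_add_right scaleR_add_left)

end


section \<open>Differentiability between normed spaces given by a carrier and a norm\<close>

type_synonym 'v normed_space = "'v set \<times> ('v \<Rightarrow> real)"

text \<open>The space \<open>L(X, Y)\<close> of bounded linear maps with its operator norm. Maps are normalised to
  vanish off the carrier of \<open>X\<close>, so that they are determined by their values on the carrier.\<close>

definition bounded_linear_maps ::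
    "'v::real_vector normed_space \<Rightarrow> 'w::real_vector normed_space \<Rightarrow> ('v \<Rightarrow> 'w) normed_space"
  where "bounded_linear_maps X Y =
    ({L. (\<forall>x. x \<notin> fst X \<longrightarrow> L x = 0) \<and>
         (\<forall>x\<in>fst X. L x \<in> fst Y) \<and>
         (\<forall>x\<in>fst X. \<forall>y\<in>fst X. L (x + y) = L x + L y) \<and>
         (\<forall>r. \<forall>x\<in>fst X. L (r *\<^sub>R x) = r *\<^sub>R L x) \<and>
         (\<exists>K. \<forall>x\<in>fst X. snd Y (L x) \<le> K * snd X x)},
     \<lambda>L. Inf {K. 0 \<le> K \<and> (\<forall>x\<in>fst X. snd Y (L x) \<le> K * snd X x)})"

text \<open>Frechet derivative at \<open>p\<close> relative to a set \<open>D\<close>. The set \<open>D\<close> need not lie in \<open>X\<close>; only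
  differences of its points have to (it will be a subset of a translate of \<open>X\<close>).\<close>

definition frechet_deriv_within ::
    "'v::real_vector normed_space \<Rightarrow> 'w::real_vector normed_space \<Rightarrow>
     ('v \<Rightarrow> 'w) \<Rightarrow> ('v \<Rightarrow> 'w) \<Rightarrow> 'v \<Rightarrow> 'v set \<Rightarrow> bool"
  where "frechet_deriv_within X Y F L p D \<longleftrightarrow>
    L \<in> fst (bounded_linear_maps X Y) \<and>
    (\<forall>q\<in>D. q - p \<in> fst X \<and> F q - F p \<in> fst Y) \<and>
    (\<forall>e>0. \<exists>d>0. \<forall>q\<in>D. snd X (q - p) < d \<longrightarrow>
        snd Y (F q - F p - L (q - p)) \<le> e * snd X (q - p))"

text \<open>As \<open>D\<close> may be a curved subset, such derivatives are determined only in directions tangent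
  to \<open>D\<close>; twice differentiable means that first and second derivatives can be chosen.\<close>

definition twice_differentiable_within ::
    "'v::real_vector normed_space \<Rightarrow> 'w::real_vector normed_space \<Rightarrow> ('v \<Rightarrow> 'w) \<Rightarrow> 'v set \<Rightarrow> bool"
  where "twice_differentiable_within X Y F D \<longleftrightarrow>
    (\<exists>F' F''. \<forall>p\<in>D. frechet_deriv_within X Y F (F' p) p D \<and>
                    frechet_deriv_within X (bounded_linear_maps X Y) F' (F'' p) p D)"


section \<open>Smooth and Schwartz functions\<close>

definition dirderiv ::
    "'a::real_normed_vector \<Rightarrow> ('a \<Rightarrow> 'b::real_normed_vector) \<Rightarrow> 'a \<Rightarrow> 'b"
  where "dirderiv v f = (\<lambda>x. frechet_derivative f (at x) v)"

definition smooth_on :: "'a::euclidean_space set \<Rightarrow> ('a \<Rightarrow> 'b::real_normed_vector) \<Rightarrow> bool"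
  where "smooth_on W f \<longleftrightarrow> open W \<and> (\<forall>vs. \<forall>x\<in>W. foldr dirderiv vs f differentiable (at x))"

definition schwartz :: "('a::euclidean_space \<Rightarrow> 'b::real_normed_vector) set"
  where "schwartz = {\<psi>. smooth_on UNIV \<psi> \<and>
    (\<forall>k::nat. \<forall>vs. \<exists>B. \<forall>x. norm x ^ k * norm (foldr dirderiv vs \<psi> x) \<le> B)}"

definition fourier :: "('a::euclidean_space \<Rightarrow> complex) \<Rightarrow> 'a \<Rightarrow> complex"
  where "fourier \<psi> \<xi> = (LINT x|lborel. cis (- (x \<bullet> \<xi>)) * \<psi> x)"


section \<open>Distributions and Sobolev spaces\<close>

text \<open>Real \<open>\<real>\<^sup>m\<close>-valued distributions on \<open>\<real>\<^sup>n\<close> act on real test functions and are set to \<open>0\<close> off the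
  Schwartz space. Linearity and continuity are not imposed here; they follow from membership in
  a Sobolev space.\<close>

type_synonym ('n, 'm) dist = "(real^'n \<Rightarrow> real) \<Rightarrow> real^'m"

definition slow_fun :: "(real^'n \<Rightarrow> real^'m) \<Rightarrow> bool"
  where "slow_fun f \<longleftrightarrow> f \<in> borel_measurable lborel \<and>
    (\<forall>\<psi>::real^'n \<Rightarrow> real. \<psi> \<in> schwartz \<longrightarrow> integrable lborel (\<lambda>x. \<psi> x *\<^sub>R f x))"

definition dist_of :: "(real^'n \<Rightarrow> real^'m) \<Rightarrow> ('n, 'm) dist"
  where "dist_of f = (\<lambda>\<psi>. if \<psi> \<in> schwartz then (LINT x|lborel. \<psi> x *\<^sub>R f x) else 0)"

text \<open>The Fourier transform of \<open>u\<close> is the function \<open>h\<close>: \<open>\<langle>h, \<psi>\<rangle> = \<langle>u, fourier \<psi>\<rangle>\<close> for complex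
  Schwartz \<open>\<psi>\<close>, where \<open>u\<close> is extended complex linearly.\<close>

definition has_fourier :: "('n::finite, 'm::finite) dist \<Rightarrow> (real^'n \<Rightarrow> complex^'m) \<Rightarrow> bool"
  where "has_fourier u h \<longleftrightarrow> h \<in> borel_measurable lborel \<and>
    (\<forall>\<psi>. \<psi> \<in> schwartz \<longrightarrow> (\<forall>k. integrable lborel (\<lambda>\<xi>. \<psi> \<xi> * h \<xi> $ k) \<and>
       (LINT \<xi>|lborel. \<psi> \<xi> * h \<xi> $ k) =
         Complex (u (\<lambda>x. Re (fourier \<psi> x)) $ k) (u (\<lambda>x. Im (fourier \<psi> x)) $ k)))"

definition sobolev_weight :: "real \<Rightarrow> (real^'n \<Rightarrow> complex^'m) \<Rightarrow> real^'n \<Rightarrow> real"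
  where "sobolev_weight s h \<xi> = (1 + (norm \<xi>)\<^sup>2) powr s * (norm (h \<xi>))\<^sup>2"

text \<open>\<open>H\<^sup>s\<close>; the choice of \<open>h\<close> in the norm is immaterial, as \<open>h\<close> is unique almost everywhere.\<close>

definition sobolev :: "real \<Rightarrow> ('n::finite, 'm::finite) dist normed_space"
  where "sobolev s =
    ({u. (\<forall>\<psi>. \<psi> \<notin> schwartz \<longrightarrow> u \<psi> = 0) \<and>
         (\<exists>h. has_fourier u h \<and> integrable lborel (sobolev_weight s h))},
     \<lambda>u. sqrt (LINT \<xi>|lborel. sobolev_weight s (SOME h. has_fourier u h) \<xi>))"

text \<open>The linear space \<open>H\<^sup>s \<times> H\<^sup>s\<^sup>-\<^sup>1\<close> of increments of Cauchy data.\<close>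

definition sobolev_pair ::
    "real \<Rightarrow> (('n::finite, 'm::finite) dist \<times> ('n, 'm) dist) normed_space"
  where "sobolev_pair s =
    (fst (sobolev s) \<times> fst (sobolev (s - 1)),
     \<lambda>(u, w). snd (sobolev s) u + snd (sobolev (s - 1)) w)"


section \<open>Coordinates on the sphere\<close>

text \<open>Coordinates in the broad sense: a diffeomorphism \<open>\<Psi>\<close> from a nonempty open subset \<open>U\<close> of
  \<open>S\<^sup>m\<^sup>-\<^sup>1\<close> onto a subset of \<open>\<real>\<^sup>m\<close>. The identity on the whole sphere gives the extrinsic coordinates of
  the ambient space; a chart with values in \<open>\<real>\<^sup>m\<^sup>-\<^sup>1\<close> is included by padding with a zero.

  The Christoffel symbols are the coefficients in the coordinate expression
  \<open>(\<nabla>\<^sub>X Y)\<^sup>k = X(Y\<^sup>k) + \<Gamma>\<^sup>k\<^sub>\<alpha>\<^sub>\<beta> X\<^sup>\<alpha> Y\<^sup>\<beta>\<close> of the Levi-Civita connection, which on the round sphere is the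
  tangential part of the ambient derivative. In extrinsic coordinates they may be taken to be
  \<open>\<Gamma>\<^sup>k\<^sub>\<alpha>\<^sub>\<beta>(y) = y\<^sup>k \<delta>\<^sub>\<alpha>\<^sub>\<beta>\<close>; directions not tangent to the image play no role.
  \<open>\<Gamma> y k \<alpha> \<beta>\<close> stands for \<open>\<Gamma>\<^sup>k\<^sub>\<alpha>\<^sub>\<beta>(y)\<close>.\<close>

type_synonym 'm christoffel = "real^'m \<Rightarrow> 'm \<Rightarrow> 'm \<Rightarrow> 'm \<Rightarrow> real"

definition tangential_part :: "real^'m \<Rightarrow> real^'m \<Rightarrow> real^'m"
  where "tangential_part p v = v - (v \<bullet> p) *\<^sub>R p"

definition christoffel_symbols ::
    "(real^'m::finite) set \<Rightarrow> (real^'m \<Rightarrow> real^'m) \<Rightarrow> 'm christoffel \<Rightarrow> bool"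
  where "christoffel_symbols U \<Psi> \<Gamma> \<longleftrightarrow>
    (\<forall>p\<in>U. \<forall>X Y. X \<bullet> p = 0 \<and> (\<exists>W. U \<subseteq> W \<and> smooth_on W Y) \<and> (\<forall>q\<in>U. Y q \<bullet> q = 0) \<longrightarrow>
      (\<forall>k. dirderiv (tangential_part p (dirderiv X Y p)) \<Psi> p $ k =
           dirderiv X (\<lambda>q. dirderiv (Y q) \<Psi> q) p $ k +
           (\<Sum>\<alpha>\<in>UNIV. \<Sum>\<beta>\<in>UNIV.
              \<Gamma> (\<Psi> p) k \<alpha> \<beta> * dirderiv X \<Psi> p $ \<alpha> * dirderiv (Y p) \<Psi> p $ \<beta>)))"

definition sphere_coordinates ::
    "(real^'m::finite) set \<Rightarrow> (real^'m \<Rightarrow> real^'m) \<Rightarrow> 'm christoffel \<Rightarrow> bool"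
  where "sphere_coordinates U \<Psi> \<Gamma> \<longleftrightarrow>
    U \<noteq> {} \<and> openin (top_of_set (sphere 0 1)) U \<and>
    (\<exists>W. U \<subseteq> W \<and> smooth_on W \<Psi>) \<and>
    (\<exists>\<Theta> W. \<Psi> ` U \<subseteq> W \<and> smooth_on W \<Theta> \<and> (\<forall>p\<in>U. \<Theta> (\<Psi> p) = p)) \<and>
    christoffel_symbols U \<Psi> \<Gamma>"

definition coord_tangent_space ::
    "(real^'m::finite) set \<Rightarrow> (real^'m \<Rightarrow> real^'m) \<Rightarrow> real^'m \<Rightarrow> (real^'m) set"
  where "coord_tangent_space U \<Psi> y = {dirderiv X \<Psi> p | p X. p \<in> U \<and> \<Psi> p = y \<and> X \<bullet> p = 0}"


section \<open>Wave maps and their solution operator\<close>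

abbreviation dx :: "'n::finite \<Rightarrow> ((real^'n) \<times> real \<Rightarrow> 'b::real_normed_vector) \<Rightarrow> (real^'n) \<times> real \<Rightarrow> 'b"
  where "dx i \<equiv> dirderiv (axis i 1, 0)"

abbreviation dt :: "((real^'n::finite) \<times> real \<Rightarrow> 'b::real_normed_vector) \<Rightarrow> (real^'n) \<times> real \<Rightarrow> 'b"
  where "dt \<equiv> dirderiv (0, 1)"

definition box_op :: "((real^'n::finite) \<times> real \<Rightarrow> real^'m) \<Rightarrow> (real^'n) \<times> real \<Rightarrow> real^'m"
  where "box_op \<phi> z = (\<Sum>i\<in>UNIV. dx i (dx i \<phi>) z) - dt (dt \<phi>) z"

definition wave_map_equation ::
    "'m::finite christoffel \<Rightarrow> ((real^'n::finite) \<times> real \<Rightarrow> real^'m) \<Rightarrow> (real^'n) \<times> real \<Rightarrow> bool"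
  where "wave_map_equation \<Gamma> \<phi> z \<longleftrightarrow>
    (\<forall>k. box_op \<phi> z $ k +
      (\<Sum>\<alpha>\<in>UNIV. \<Sum>\<beta>\<in>UNIV. \<Gamma> (\<phi> z) k \<alpha> \<beta> *
         ((\<Sum>i\<in>UNIV. dx i \<phi> z $ \<alpha> * dx i \<phi> z $ \<beta>) - dt \<phi> z $ \<alpha> * dt \<phi> z $ \<beta>)) = 0)"

text \<open>Positions: maps into the coordinate image that differ from the constant map \<open>c\<close> (the value
  at infinity) by an element of \<open>H\<^sup>n\<^sup>/\<^sup>2\<close>.\<close>

definition target_position ::
    "(real^'m::finite) set \<Rightarrow> real^'m \<Rightarrow> (real^'n::finite \<Rightarrow> real^'m) \<Rightarrow> bool"
  where "target_position V c f \<longleftrightarrow>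
    f \<in> borel_measurable lborel \<and> (AE x in lborel. f x \<in> V) \<and>
    integrable lborel (\<lambda>x. (norm (f x - c))\<^sup>2) \<and>
    dist_of (\<lambda>x. f x - c) \<in> fst (sobolev (real CARD('n) / 2))"

text \<open>Cauchy data. The velocity lies in \<open>H\<^sup>n\<^sup>/\<^sup>2\<^sup>-\<^sup>1\<close> and is tangent to the target along \<open>f\<close>. Since for
  \<open>n = 1\<close> it need not be a function, tangency is imposed as membership in the closure of the
  tangent vector fields that are functions; for \<open>n \<ge> 2\<close> this is pointwise tangency, in extrinsic
  coordinates \<open>f(x)\<^sup>t g(x) = 0\<close>.\<close>

definition data_space ::
    "(real^'m::finite) set \<Rightarrow> (real^'m \<Rightarrow> real^'m) \<Rightarrow> real^'m \<Rightarrow>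
     (('n::finite, 'm) dist \<times> ('n, 'm) dist) set"
  where "data_space U \<Psi> c =
    {(dist_of f, g) | f g. target_position (\<Psi> ` U) c f \<and>
       g \<in> fst (sobolev (real CARD('n) / 2 - 1)) \<and>
       (\<forall>e>0. \<exists>G. slow_fun G \<and> (AE x in lborel. G x \<in> coord_tangent_space U \<Psi> (f x)) \<and>
          g - dist_of G \<in> fst (sobolev (real CARD('n) / 2 - 1)) \<and>
          snd (sobolev (real CARD('n) / 2 - 1)) (g - dist_of G) < e)}"

definition classical_wave_map ::
    "(real^'m::finite) set \<Rightarrow> (real^'m \<Rightarrow> real^'m) \<Rightarrow> 'm christoffel \<Rightarrow> real^'m \<Rightarrow> real \<Rightarrow>
     ((real^'n::finite) \<times> real \<Rightarrow> real^'m) \<Rightarrow> bool"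
  where "classical_wave_map U \<Psi> \<Gamma> c T \<phi> \<longleftrightarrow>
    (\<exists>W. UNIV \<times> {0..T} \<subseteq> W \<and> smooth_on W \<phi>) \<and>
    (\<forall>x. \<forall>t\<in>{0..T}. \<phi> (x, t) \<in> \<Psi> ` U \<and> wave_map_equation \<Gamma> \<phi> (x, t)) \<and>
    (\<forall>t\<in>{0..T}. target_position (\<Psi> ` U) c (\<lambda>x. \<phi> (x, t)) \<and>
       slow_fun (\<lambda>x. dt \<phi> (x, t)) \<and>
       dist_of (\<lambda>x. dt \<phi> (x, t)) \<in> fst (sobolev (real CARD('n) / 2 - 1)))"

text \<open>\<open>S\<close> is a time-\<open>T\<close> solution operator with domain \<open>D\<close>. Neither existence nor uniqueness of
  generalised solutions is available at this regularity, so no particular notion of generalised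
  solution is fixed: \<open>S\<close> may be any map on any set of data that is defined and correct on all
  data of smooth solutions (which are unique by finite speed of propagation).\<close>

definition solution_operator ::
    "(real^'m::finite) set \<Rightarrow> (real^'m \<Rightarrow> real^'m) \<Rightarrow> 'm christoffel \<Rightarrow> real^'m \<Rightarrow> real \<Rightarrow>
     (('n::finite, 'm) dist \<times> ('n, 'm) dist) set \<Rightarrow>
     (('n, 'm) dist \<times> ('n, 'm) dist \<Rightarrow> ('n, 'm) dist) \<Rightarrow> bool"
  where "solution_operator U \<Psi> \<Gamma> c T D S \<longleftrightarrow>
    D \<subseteq> data_space U \<Psi> c \<and>
    S ` D \<subseteq> {dist_of f | f. target_position (\<Psi> ` U) c f} \<and>
    (\<forall>\<phi>. classical_wave_map U \<Psi> \<Gamma> c T \<phi> \<longrightarrow>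
       (dist_of (\<lambda>x. \<phi> (x, 0)), dist_of (\<lambda>x. dt \<phi> (x, 0))) \<in> D \<and>
       S (dist_of (\<lambda>x. \<phi> (x, 0)), dist_of (\<lambda>x. dt \<phi> (x, 0))) = dist_of (\<lambda>x. \<phi> (x, T)))"

end

theory Submission
  imports Defs
begin

text \<open>
  In extrinsic coordinates a free wave \<open>u\<close> gives the wave maps
  \<open>\<phi>\<^sub>e = cos (e u) c + sin (e u) v\<close> along the geodesic through \<open>c\<close> with direction \<open>v\<close>. If \<open>u\<close>
  vanishes at time \<open>0\<close>, the data of \<open>\<phi>\<^sub>e\<close> are \<open>(c, e g v)\<close> with \<open>g = u\<^sub>t(0)\<close>: they move along a
  straight line, on which the derivatives of the solution operator are determined. A second
  derivative at the constant data \<open>(c, 0)\<close> must therefore map \<open>(0, g v)\<close> twice to a distribution with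
  \<open>c\<close>-component \<open>- u(T)\<^sup>2\<close>, so that the norm of \<open>u(T)\<^sup>2\<close> in \<open>H\<^sup>n\<^sup>/\<^sup>2\<close> would be bounded by the square of the
  norm of \<open>g\<close> in \<open>H\<^sup>n\<^sup>/\<^sup>2\<^sup>-\<^sup>1\<close>. This fails because \<open>H\<^sup>n\<^sup>/\<^sup>2\<close> does not embed in \<open>L\<^sup>\<infinity>\<close>. Let \<open>u(T)\<close> have the Fourier
  transform \<open>sin\<^sup>2(T \<bar>\<xi>\<bar>) \<bar>\<xi>\<bar>\<^sup>-\<^sup>n\<close>, smoothly cut off to \<open>1 \<le> \<bar>\<xi>\<bar> \<le> R\<close>, and let \<open>I\<close> be its integral, which is
  comparable to \<open>log R\<close>. The squared norm of \<open>g\<close> is at most a multiple of \<open>I\<close>. The Fourier transform of \<open>u(T)\<^sup>2\<close>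
  has integral \<open>I\<^sup>2\<close> and lives on \<open>\<bar>\<xi>\<bar> \<le> 2 R\<close>, hence by Cauchy-Schwarz the norm of \<open>u(T)\<^sup>2\<close> is at least
  a multiple of \<open>I\<^sup>2 / sqrt (log R)\<close>.
\<close>

text \<open>The amplitude \<open>amp\<close> carries one factor sin (T |xi|); the evolution supplies
  sin (t |xi|), and at t = T the two combine to the nonnegative sin^2. Nonnegativity rules out
  cancellation in the transform of u(T)^2. The power |xi|^(-n) is critical: the velocity has
  transform |xi| \<open>amp\<close> up to a constant, so its H^(n/2-1) density is at most a multiple
  of sin^2 |xi|^(-n), the integrand of I. A bounded second derivative would give I^2 / sqrt (log R)
  <= const * I, hence I <= const * sqrt (log R), against the growth of I.

  The domain of the solution operator may be curved and its derivatives need not be unique, so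
  everything is read off from one scalar function of e: the c-component of the solution, paired with
  the Fourier transform of a bump of radius 3 R. Its second derivative at e = 0 is minus the
  integral of u(T)^2 against this test function, and duality between Sobolev spaces bounds it. The
  constants, the normalisation of the Fourier transform included, must not depend on R.\<close>

section \<open>Control of iterated directional derivatives\<close>

text \<open>The constant \<open>C\<close> absorbs the norms of linear and bilinear maps; domination
  also passes from the norms of two summands to the norm of their sum.\<close>

definition decay_class :: "(('a \<Rightarrow> real) \<Rightarrow> bool) \<Rightarrow> bool"
  where "decay_class Q \<longleftrightarrow> (\<forall>p q. Q p \<longrightarrow> Q q \<longrightarrow> Q (\<lambda>x. p x + q x)) \<and>
    (\<forall>p q C. Q p \<longrightarrow> (\<forall>x. 0 \<le> q x \<and> q x \<le> C * p x) \<longrightarrow> Q q)"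

lemma decay_class_add: "decay_class Q \<Longrightarrow> Q p \<Longrightarrow> Q q \<Longrightarrow> Q (\<lambda>x. p x + q x)"
  unfolding decay_class_def by blast

lemma decay_class_mono:
  "decay_class Q \<Longrightarrow> Q p \<Longrightarrow> (\<And>x. 0 \<le> q x) \<Longrightarrow> (\<And>x. q x \<le> C * p x) \<Longrightarrow> Q q"
  unfolding decay_class_def by blast

text \<open>\<open>Q\<close> limits the size on \<open>W\<close> of the derivatives of order at most \<open>k\<close>. The instances \<open>True\<close>,
  \<open>bdd\<close> and \<open>rapid\<close> (for all \<open>k\<close>) give smooth functions, smooth functions with bounded derivatives and
  Schwartz functions, so that the closure properties are proved once for all three.\<close>

definition ders ::
    "'a::euclidean_space set \<Rightarrow> (('a \<Rightarrow> real) \<Rightarrow> bool) \<Rightarrow> nat \<Rightarrow> ('a \<Rightarrow> 'b::real_normed_vector) \<Rightarrow> bool"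
  where "ders W Q k f \<longleftrightarrow> (\<forall>vs. length vs \<le> k \<longrightarrow>
     (\<forall>x\<in>W. foldr dirderiv vs f differentiable (at x)) \<and>
     Q (\<lambda>x. indicator W x * norm (foldr dirderiv vs f x)))"

lemma dirderiv_eqI: "(f has_derivative f') (at x) \<Longrightarrow> dirderiv v f x = f' v"
  unfolding dirderiv_def using frechet_derivative_at by metis

lemma has_derivative_dirderiv:
  "f differentiable (at x) \<Longrightarrow> (f has_derivative (\<lambda>v. dirderiv v f x)) (at x)"
  unfolding dirderiv_def by (simp add: frechet_derivative_works[symmetric])

lemma ders_0: "ders W Q 0 f \<longleftrightarrow> (\<forall>x\<in>W. f differentiable (at x)) \<and> Q (\<lambda>x. indicator W x * norm (f x))"
  unfolding ders_def by simp

text \<open>\<open>foldr\<close> applies the last direction of the list first, so lists are split at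
  their end. In this form the closure properties follow by induction on the order, with the function
  generalised.\<close>

lemma ders_Suc: "ders W Q (Suc k) f \<longleftrightarrow> ders W Q 0 f \<and> (\<forall>v. ders W Q k (dirderiv v f))"
proof safe
  assume a: "ders W Q (Suc k) f"
  show "ders W Q 0 f" using a[unfolded ders_def, rule_format, of "[]"] by (simp add: ders_0)
  fix v
  show "ders W Q k (dirderiv v f)"
    unfolding ders_def
  proof (intro allI impI)
    fix vs :: "'a list"
    assume "length vs \<le> k"
    then show "(\<forall>x\<in>W. foldr dirderiv vs (dirderiv v f) differentiable at x) \<and>
          Q (\<lambda>x. indicat_real W x * norm (foldr dirderiv vs (dirderiv v f) x))"
      using a[unfolded ders_def, rule_format, of "vs @ [v]"] by simp
  qed
next
  assume 0: "ders W Q 0 f" and s: "\<forall>v. ders W Q k (dirderiv v f)"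
  show "ders W Q (Suc k) f"
    unfolding ders_def
  proof (intro allI impI)
    fix vs :: "'a list"
    assume l: "length vs \<le> Suc k"
    show "(\<forall>x\<in>W. foldr dirderiv vs f differentiable at x) \<and>
          Q (\<lambda>x. indicat_real W x * norm (foldr dirderiv vs f x))"
    proof (cases vs rule: rev_cases)
      case Nil
      then show ?thesis using 0 by (simp add: ders_0)
    next
      case (snoc ws w)
      then show ?thesis using s[rule_format, of w] l unfolding ders_def by simp
    qed
  qed
qed

lemma ders_antimono: "ders W Q k f \<Longrightarrow> j \<le> k \<Longrightarrow> ders W Q j f"
  unfolding ders_def by simp

lemma ders_SucD: "ders W Q (Suc k) f \<Longrightarrow> ders W Q k f"
  by (rule ders_antimono) auto

lemma ders_dirderiv: "ders W Q (Suc k) f \<Longrightarrow> ders W Q k (dirderiv v f)"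
  by (simp add: ders_Suc)

lemma ders_differentiable: "ders W Q k f \<Longrightarrow> x \<in> W \<Longrightarrow> f differentiable (at x)"
  by (metis ders_0 ders_antimono zero_le)

lemma ders_has_derivative:
  "ders W Q k f \<Longrightarrow> x \<in> W \<Longrightarrow> (f has_derivative (\<lambda>v. dirderiv v f x)) (at x)"
  by (simp add: ders_differentiable has_derivative_dirderiv)

lemma ders_bound: "ders W Q k f \<Longrightarrow> Q (\<lambda>x. indicator W x * norm (f x))"
  by (metis ders_0 ders_antimono zero_le)

lemma indicator_mult_cong: "(\<And>x. x \<in> W \<Longrightarrow> p x = q x) \<Longrightarrow>
   (\<lambda>x. indicat_real W x * p x) = (\<lambda>x. indicat_real W x * q x)"
  by (auto simp: indicator_def fun_eq_iff)

lemma differentiable_cong_open: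
  assumes "open W" "x \<in> W" "\<And>y. y \<in> W \<Longrightarrow> f y = g y" "f differentiable (at x)"
  shows "g differentiable (at x)"
  using assms has_derivative_transform_within_open unfolding differentiable_def by blast

text \<open>Openness of \<open>W\<close> makes the derivatives on \<open>W\<close> agree although
  the functions may differ elsewhere, and the indicator hides the rest from
  \<open>Q\<close>.\<close>

lemma ders_cong:
  assumes "open W" "\<And>x. x \<in> W \<Longrightarrow> f x = g x" "ders W Q k f"
  shows "ders W Q k g"
  using assms(2,3)
proof (induction k arbitrary: f g)
  case 0
  then show ?case unfolding ders_0
    using differentiable_cong_open[OF \<open>open W\<close>] indicator_mult_cong[of W "\<lambda>x. norm (f x)" "\<lambda>x. norm (g x)"]
    by metis
next
  case (Suc k)
  have "ders W Q 0 g"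
    using Suc.prems unfolding ders_Suc ders_0
    using differentiable_cong_open[OF \<open>open W\<close>] indicator_mult_cong[of W "\<lambda>x. norm (f x)" "\<lambda>x. norm (g x)"]
    by metis
  moreover have "ders W Q k (dirderiv v g)" for v
  proof (rule Suc.IH)
    show "ders W Q k (dirderiv v f)" using Suc.prems ders_dirderiv by blast
    fix x assume x: "x \<in> W"
    have "(g has_derivative (\<lambda>v. dirderiv v f x)) (at x)"
      using has_derivative_transform_within_open[OF ders_has_derivative[OF Suc.prems(2) x] \<open>open W\<close> x]
        Suc.prems(1) by simp
    then show "dirderiv v f x = dirderiv v g x" by (simp add: dirderiv_eqI)
  qed
  ultimately show ?case by (simp add: ders_Suc)
qed

text \<open>The induction step of most closure properties below: the derivative is given in closed
  form on \<open>W\<close> only, and \<open>ders_cong\<close> exchanges it for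
  \<open>dirderiv\<close>.\<close>

lemma ders_SucI:
  assumes "open W" "Q (\<lambda>x. indicator W x * norm (f x))"
    "\<And>x. x \<in> W \<Longrightarrow> (f has_derivative f' x) (at x)" "\<And>v. ders W Q k (\<lambda>x. f' x v)"
  shows "ders W Q (Suc k) f"
  unfolding ders_Suc ders_0
proof (intro conjI allI ballI)
  show "f differentiable at x" if "x \<in> W" for x using assms(3)[OF that] differentiable_def by blast
  show "Q (\<lambda>x. indicator W x * norm (f x))" by fact
  show "ders W Q k (dirderiv v f)" for v
    by (rule ders_cong[OF assms(1) _ assms(4)]) (simp add: dirderiv_eqI[OF assms(3)])
qed

lemma ders_0I:
  assumes "Q (\<lambda>x. indicator W x * norm (f x))"
    "\<And>x. x \<in> W \<Longrightarrow> (f has_derivative f' x) (at x)"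
  shows "ders W Q 0 f"
  using assms unfolding ders_0 differentiable_def by blast

lemma ders_add:
  assumes "open W" "decay_class Q" "ders W Q k f" "ders W Q k g"
  shows "ders W Q k (\<lambda>x. f x + g x)"
  using assms(3,4)
proof (induction k arbitrary: f g)
  case 0
  have "Q (\<lambda>x. indicator W x * norm (f x + g x))"
    by (rule decay_class_mono[OF assms(2), OF decay_class_add[OF assms(2), OF ders_bound[OF 0(1)] ders_bound[OF 0(2)]], where C=1])
       (auto simp: indicator_def norm_triangle_ineq)
  with 0 show ?case by (auto simp: ders_0)
next
  case (Suc k)
  show ?case
  proof (rule ders_SucI[OF assms(1), where f'="\<lambda>x v. dirderiv v f x + dirderiv v g x"])
    show "Q (\<lambda>x. indicator W x * norm (f x + g x))"
      by (rule decay_class_mono[OF assms(2), OF decay_class_add[OF assms(2), OF ders_bound[OF Suc.prems(1)] ders_bound[OF Suc.prems(2)]], where C=1])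
         (auto simp: indicator_def norm_triangle_ineq)
    show "((\<lambda>x. f x + g x) has_derivative (\<lambda>v. dirderiv v f x + dirderiv v g x)) (at x)" if "x \<in> W" for x
      using Suc.prems that by (intro has_derivative_add ders_has_derivative)
    show "ders W Q k (\<lambda>x. dirderiv v f x + dirderiv v g x)" for v
      using Suc.prems by (intro Suc.IH ders_dirderiv)
  qed
qed

lemma ders_bounded_linear:
  assumes "open W" "decay_class Q" "bounded_linear L" "ders W Q k f"
  shows "ders W Q k (\<lambda>x. L (f x))"
proof -
  obtain K where K: "\<And>x. norm (L x) \<le> norm x * K" using bounded_linear.bounded[OF assms(3)] by blast
  have Q: "Q (\<lambda>x. indicator W x * norm (L (f x)))" if "ders W Q k f" for f k
    by (rule decay_class_mono[OF assms(2), OF ders_bound[OF that], where C=K])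
       (use K in \<open>auto simp: indicator_def mult.commute\<close>)
  have D: "((\<lambda>x. L (f x)) has_derivative (\<lambda>v. L (dirderiv v f x))) (at x)" if "ders W Q k f" "x \<in> W" for f k x
    using that by (intro bounded_linear.has_derivative[OF assms(3)] ders_has_derivative)
  show ?thesis using assms(4)
  proof (induction k arbitrary: f)
    case 0
    show ?case
      by (rule ders_0I[where f'="\<lambda>x v. L (dirderiv v f x)"]) (fact Q[OF 0], rule D[OF 0])
  next
    case (Suc k)
    show ?case
      by (rule ders_SucI[where f'="\<lambda>x v. L (dirderiv v f x)"])
        (fact assms(1), fact Q[OF Suc.prems], rule D[OF Suc.prems], assumption,
          rule Suc.IH[OF ders_dirderiv[OF Suc.prems]])
  qed
qed

text \<open>Three separate classes, so that a factor of polynomial growth may multiply a rapidly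
  decreasing one.\<close>

definition decay_product where
  "decay_product Q1 Q2 Q \<longleftrightarrow> (\<forall>p q. Q1 p \<longrightarrow> Q2 q \<longrightarrow> Q (\<lambda>x. p x * q x :: real))"

lemma ders_bilinear:
  assumes "open W" "decay_class Q" "decay_product Q1 Q2 Q" "bounded_bilinear pr"
    "ders W Q1 k f" "ders W Q2 k g"
  shows "ders W Q k (\<lambda>x. pr (f x) (g x))"
proof -
  obtain K where K: "\<And>a b. norm (pr a b) \<le> norm a * norm b * K"
    using bounded_bilinear.bounded[OF assms(4)] by blast
  have Q: "Q (\<lambda>x. indicator W x * norm (pr (f x) (g x)))"
    if "ders W Q1 k f" "ders W Q2 k g" for f g k
  proof (rule decay_class_mono[OF assms(2), where C=K])
    show "Q (\<lambda>x. (indicator W x * norm (f x)) * (indicator W x * norm (g x)))"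
      using assms(3) ders_bound[OF that(1)] ders_bound[OF that(2)] unfolding decay_product_def by blast
  qed (use K in \<open>auto simp: indicator_def mult_ac\<close>)
  have D: "((\<lambda>x. pr (f x) (g x)) has_derivative (\<lambda>v. pr (f x) (dirderiv v g x) + pr (dirderiv v f x) (g x))) (at x)"
    if "ders W Q1 k f" "ders W Q2 k g" "x \<in> W" for f g k x
    by (intro bounded_bilinear.FDERIV[OF assms(4)] ders_has_derivative[OF that(1)] ders_has_derivative[OF that(2)] that)
  show ?thesis using assms(5,6)
  proof (induction k arbitrary: f g)
    case 0
    show ?case
      by (rule ders_0I[where f'="\<lambda>x v. pr (f x) (dirderiv v g x) + pr (dirderiv v f x) (g x)"])
        (fact Q[OF 0], rule D[OF 0])
  next
    case (Suc k)
    show ?case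
    proof (rule ders_SucI[where f'="\<lambda>x v. pr (f x) (dirderiv v g x) + pr (dirderiv v f x) (g x)"])
      show "ders W Q k (\<lambda>x. pr (f x) (dirderiv v g x) + pr (dirderiv v f x) (g x))" for v
        by (rule ders_add[OF assms(1,2) Suc.IH Suc.IH])
          (use Suc.prems in \<open>auto intro: ders_SucD ders_dirderiv\<close>)
    qed (fact assms(1), fact Q[OF Suc.prems], rule D[OF Suc.prems], assumption)
  qed
qed

lemma ders_const:
  assumes "open W" "decay_class Q" "Q (\<lambda>_. 1)"
  shows "ders W Q k (\<lambda>_. c)"
proof (induction k arbitrary: c)
  case 0
  show ?case by (rule ders_0I[where f'="\<lambda>_ _. 0"], rule decay_class_mono[OF assms(2), OF assms(3), where C="norm c"])
      (auto simp: indicator_def)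
next
  case (Suc k)
  show ?case by (rule ders_SucI[OF assms(1), where f'="\<lambda>_ _. 0"],
        rule decay_class_mono[OF assms(2), OF assms(3), where C="norm c"]) (auto simp: indicator_def Suc)
qed

section \<open>Classes of growth and decay\<close>

lemma smooth_on_iff_ders: "smooth_on W f \<longleftrightarrow> open W \<and> (\<forall>k. ders W (\<lambda>_. True) k f)"
  unfolding smooth_on_def ders_def by auto

lemma decay_class_True: "decay_class (\<lambda>_. True)"
  unfolding decay_class_def by simp

lemma decay_product_True: "decay_product (\<lambda>_. True) (\<lambda>_. True) (\<lambda>_. True)"
  unfolding decay_product_def by simp

definition bdd :: "('a \<Rightarrow> real) \<Rightarrow> bool" where "bdd p \<longleftrightarrow> (\<exists>B. \<forall>x. \<bar>p x\<bar> \<le> B)"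

definition slow_growth :: "('a::real_normed_vector \<Rightarrow> real) \<Rightarrow> bool"
  where "slow_growth p \<longleftrightarrow> (\<exists>k B. \<forall>x. \<bar>p x\<bar> \<le> B * (1 + norm x) ^ k)"

definition rapid :: "('a::real_normed_vector \<Rightarrow> real) \<Rightarrow> bool"
  where "rapid p \<longleftrightarrow> (\<forall>k. \<exists>B. \<forall>x. (1 + norm x) ^ k * \<bar>p x\<bar> \<le> B)"

lemma decay_class_bdd: "decay_class bdd"
  unfolding decay_class_def bdd_def
proof safe
  fix p q :: "'a \<Rightarrow> real" and B B' C
  show "\<exists>B. \<forall>x. \<bar>p x + q x\<bar> \<le> B" if "\<forall>x. \<bar>p x\<bar> \<le> B" "\<forall>x. \<bar>q x\<bar> \<le> B'"
    using that by (intro exI[of _ "B + B'"] allI order_trans[OF abs_triangle_ineq] add_mono) auto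
  show "\<exists>B. \<forall>x. \<bar>q x\<bar> \<le> B" if "\<forall>x. \<bar>p x\<bar> \<le> B" "\<forall>x. 0 \<le> q x \<and> q x \<le> C * p x"
  proof (intro exI allI)
    fix x
    have "C * p x \<le> \<bar>C\<bar> * \<bar>p x\<bar>" by (metis abs_ge_self abs_mult)
    also have "\<dots> \<le> \<bar>C\<bar> * B" using that(1) by (simp add: mult_left_mono)
    finally show "\<bar>q x\<bar> \<le> \<bar>C\<bar> * B" using that(2) by (smt (verit))
  qed
qed

lemma decay_class_rapid: "decay_class rapid"
  unfolding decay_class_def rapid_def
proof (intro conjI allI impI)
  fix p q :: "'a \<Rightarrow> real" and C k
  show "\<exists>B. \<forall>x. (1 + norm x) ^ k * \<bar>p x + q x\<bar> \<le> B"
    if h: "\<forall>k. \<exists>B. \<forall>x. (1 + norm x) ^ k * \<bar>p x\<bar> \<le> B" "\<forall>k. \<exists>B. \<forall>x. (1 + norm x) ^ k * \<bar>q x\<bar> \<le> B"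
  proof -
    obtain B where B: "\<And>x. (1 + norm x) ^ k * \<bar>p x\<bar> \<le> B" using h(1) by metis
    obtain B' where B': "\<And>x. (1 + norm x) ^ k * \<bar>q x\<bar> \<le> B'" using h(2) by metis
    show ?thesis
    proof (intro exI allI)
      fix x
      have "(1 + norm x) ^ k * \<bar>p x + q x\<bar> \<le> (1 + norm x) ^ k * (\<bar>p x\<bar> + \<bar>q x\<bar>)"
        by (intro mult_left_mono) auto
      then show "(1 + norm x) ^ k * \<bar>p x + q x\<bar> \<le> B + B'" using B[of x] B'[of x] by (simp add: algebra_simps)
    qed
  qed
  show "\<exists>B. \<forall>x. (1 + norm x) ^ k * \<bar>q x\<bar> \<le> B"
    if h: "\<forall>k. \<exists>B. \<forall>x. (1 + norm x) ^ k * \<bar>p x\<bar> \<le> B" "\<forall>x. 0 \<le> q x \<and> q x \<le> C * p x"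
  proof -
    obtain B where B: "\<And>x. (1 + norm x) ^ k * \<bar>p x\<bar> \<le> B" using h by metis
    show ?thesis
    proof (intro exI allI)
      fix x
      have "\<bar>q x\<bar> \<le> \<bar>C\<bar> * \<bar>p x\<bar>" using h(2) by (metis abs_ge_self abs_mult abs_of_nonneg order_trans)
      then have "(1 + norm x) ^ k * \<bar>q x\<bar> \<le> (1 + norm x) ^ k * (\<bar>C\<bar> * \<bar>p x\<bar>)"
        by (intro mult_left_mono) auto
      also have "\<dots> = \<bar>C\<bar> * ((1 + norm x) ^ k * \<bar>p x\<bar>)" by simp
      also have "\<dots> \<le> \<bar>C\<bar> * B" by (intro mult_left_mono B) auto
      finally show "(1 + norm x) ^ k * \<bar>q x\<bar> \<le> \<bar>C\<bar> * B" .
    qed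
  qed
qed

lemma decay_class_slow_growth: "decay_class slow_growth"
  unfolding decay_class_def slow_growth_def
proof (intro conjI allI impI)
  fix p q :: "'a \<Rightarrow> real" and C
  show "\<exists>k B. \<forall>x. \<bar>p x + q x\<bar> \<le> B * (1 + norm x) ^ k"
    if h: "\<exists>k B. \<forall>x. \<bar>p x\<bar> \<le> B * (1 + norm x) ^ k" "\<exists>k B. \<forall>x. \<bar>q x\<bar> \<le> B * (1 + norm x) ^ k"
  proof -
    obtain k B k' B' where B: "\<And>x. \<bar>p x\<bar> \<le> B * (1 + norm x) ^ k" "\<And>x. \<bar>q x\<bar> \<le> B' * (1 + norm x) ^ k'"
      using h by metis
    show ?thesis
    proof (intro exI allI)
      fix x :: 'a
      have "B * (1 + norm x) ^ k \<le> \<bar>B\<bar> * (1 + norm x) ^ (k + k')"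
        by (intro mult_mono power_increasing) auto
      moreover have "B' * (1 + norm x) ^ k' \<le> \<bar>B'\<bar> * (1 + norm x) ^ (k + k')"
        by (intro mult_mono power_increasing) auto
      ultimately show "\<bar>p x + q x\<bar> \<le> (\<bar>B\<bar> + \<bar>B'\<bar>) * (1 + norm x) ^ (k + k')"
        using B[of x] by (simp add: algebra_simps)
    qed
  qed
  show "\<exists>k B. \<forall>x. \<bar>q x\<bar> \<le> B * (1 + norm x) ^ k"
    if h: "\<exists>k B. \<forall>x. \<bar>p x\<bar> \<le> B * (1 + norm x) ^ k" "\<forall>x. 0 \<le> q x \<and> q x \<le> C * p x"
  proof -
    obtain k B where B: "\<And>x. \<bar>p x\<bar> \<le> B * (1 + norm x) ^ k" using h by metis
    show ?thesis
    proof (intro exI allI)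
      fix x :: 'a
      have "\<bar>q x\<bar> \<le> \<bar>C\<bar> * \<bar>p x\<bar>" using h(2) by (metis abs_ge_self abs_mult abs_of_nonneg order_trans)
      also have "\<dots> \<le> \<bar>C\<bar> * (B * (1 + norm x) ^ k)" by (intro mult_left_mono B) auto
      finally show "\<bar>q x\<bar> \<le> (\<bar>C\<bar> * B) * (1 + norm x) ^ k" by simp
    qed
  qed
qed

lemma decay_product_bdd: "decay_product bdd bdd bdd"
  unfolding decay_product_def bdd_def abs_mult
  by (metis abs_ge_zero mult_mono' )

lemma decay_product_slow_rapid: "decay_product slow_growth rapid rapid"
  unfolding decay_product_def
proof (intro allI impI)
  fix p q :: "'a \<Rightarrow> real"
  assume "slow_growth p" and q: "rapid q"
  then obtain k B where B: "\<And>x. \<bar>p x\<bar> \<le> B * (1 + norm x) ^ k" unfolding slow_growth_def by metis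
  show "rapid (\<lambda>x. p x * q x)"
    unfolding rapid_def
  proof
    fix j
    obtain B' where B': "\<And>x. (1 + norm x) ^ (j + k) * \<bar>q x\<bar> \<le> B'" using q unfolding rapid_def by metis
    show "\<exists>B. \<forall>x. (1 + norm x) ^ j * \<bar>p x * q x\<bar> \<le> B"
    proof (intro exI allI)
      fix x :: 'a
      have B'': "\<bar>p x\<bar> \<le> \<bar>B\<bar> * (1 + norm x) ^ k"
        using B[of x] by (rule order_trans) (intro mult_right_mono, auto)
      have "(1 + norm x) ^ j * \<bar>p x * q x\<bar> \<le> (1 + norm x) ^ j * ((\<bar>B\<bar> * (1 + norm x) ^ k) * \<bar>q x\<bar>)"
        unfolding abs_mult using B'' by (intro mult_left_mono mult_right_mono) auto
      also have "\<dots> = \<bar>B\<bar> * ((1 + norm x) ^ (j + k) * \<bar>q x\<bar>)" by (simp add: power_add)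
      also have "\<dots> \<le> \<bar>B\<bar> * B'" by (intro mult_left_mono B') auto
      finally show "(1 + norm x) ^ j * \<bar>p x * q x\<bar> \<le> \<bar>B\<bar> * B'" .
    qed
  qed
qed

lemma bdd_imp_slow_growth: "bdd p \<Longrightarrow> slow_growth p"
  unfolding bdd_def slow_growth_def by (rule exI[of _ 0]) simp

lemma rapid_imp_bdd: "rapid p \<Longrightarrow> bdd p"
  unfolding bdd_def rapid_def by (drule spec[of _ 0]) simp

text \<open>\<open>schwartz\<close> uses the weights \<open>norm x ^ k\<close>, whereas powers of
  \<open>1 + norm x\<close> are monotone in the exponent and so easier to multiply. The two are
  equivalent because (1 + r)^k <= 2^k (1 + r^k), by comparing r with 1.\<close>

lemma rapid_iff: "rapid p \<longleftrightarrow> (\<forall>k. \<exists>B. \<forall>x. norm x ^ k * \<bar>p x\<bar> \<le> B)"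
proof
  assume r: "rapid p"
  show "\<forall>k. \<exists>B. \<forall>x. norm x ^ k * \<bar>p x\<bar> \<le> B"
  proof
    fix k
    obtain B where B: "\<And>x. (1 + norm x) ^ k * \<bar>p x\<bar> \<le> B" using r unfolding rapid_def by metis
    have "norm x ^ k * \<bar>p x\<bar> \<le> (1 + norm x) ^ k * \<bar>p x\<bar>" for x
      by (intro mult_right_mono power_mono) auto
    then show "\<exists>B. \<forall>x. norm x ^ k * \<bar>p x\<bar> \<le> B" using B order_trans by blast
  qed
next
  assume r: "\<forall>k. \<exists>B. \<forall>x. norm x ^ k * \<bar>p x\<bar> \<le> B"
  show "rapid p"
    unfolding rapid_def
  proof
    fix k
    obtain B B' where B: "\<And>x. norm x ^ k * \<bar>p x\<bar> \<le> B" "\<And>x. norm x ^ 0 * \<bar>p x\<bar> \<le> B'" using r by metis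
    show "\<exists>B. \<forall>x. (1 + norm x) ^ k * \<bar>p x\<bar> \<le> B"
    proof (intro exI allI)
      fix x :: 'a
      have "(1 + norm x) ^ k \<le> 2 ^ k * (1 + norm x ^ k)"
      proof (cases "norm x \<le> 1")
        case True
        then have "(1 + norm x) ^ k \<le> 2 ^ k" by (intro power_mono) auto
        then show ?thesis by (smt (verit) mult_le_cancel_left1 zero_le_power norm_ge_zero zero_less_power)
      next
        case False
        then have "(1 + norm x) ^ k \<le> (2 * norm x) ^ k" by (intro power_mono) auto
        then show ?thesis by (simp add: power_mult_distrib distrib_left add_increasing)
      qed
      then have "(1 + norm x) ^ k * \<bar>p x\<bar> \<le> 2 ^ k * (1 + norm x ^ k) * \<bar>p x\<bar>" by (intro mult_right_mono) auto
      also have "\<dots> = 2 ^ k * (\<bar>p x\<bar> + norm x ^ k * \<bar>p x\<bar>)" by (simp add: algebra_simps)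
      also have "\<dots> \<le> 2 ^ k * (B' + B)" using B[of x] by (intro mult_left_mono) auto
      finally show "(1 + norm x) ^ k * \<bar>p x\<bar> \<le> 2 ^ k * (B' + B)" .
    qed
  qed
qed

lemma schwartz_iff_ders: "f \<in> schwartz \<longleftrightarrow> (\<forall>k. ders UNIV rapid k f)"
proof -
  have "f \<in> schwartz \<longleftrightarrow> (\<forall>vs. (\<forall>x. foldr dirderiv vs f differentiable at x) \<and>
      rapid (\<lambda>x. norm (foldr dirderiv vs f x)))"
    unfolding schwartz_def smooth_on_def rapid_iff by auto
  then show ?thesis unfolding ders_def by auto
qed

section \<open>Smooth functions: closure rules, flat functions, powers of the norm\<close>

abbreviation smooth_upto :: "'a::euclidean_space set \<Rightarrow> nat \<Rightarrow> ('a \<Rightarrow> 'b::real_normed_vector) \<Rightarrow> bool"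
  where "smooth_upto W \<equiv> ders W (\<lambda>_. True)"

lemma smooth_upto_0I:
  "(\<And>x. x \<in> W \<Longrightarrow> (f has_derivative f' x) (at x)) \<Longrightarrow> smooth_upto W 0 f"
  by (rule ders_0I[where f'=f']) auto

lemma smooth_upto_SucI:
  "open W \<Longrightarrow> (\<And>x. x \<in> W \<Longrightarrow> (f has_derivative f' x) (at x)) \<Longrightarrow>
   (\<And>v. smooth_upto W k (\<lambda>x. f' x v)) \<Longrightarrow> smooth_upto W (Suc k) f"
  by (rule ders_SucI[where f'=f']) auto

lemmas smooth_upto_bilinear = ders_bilinear[OF _ decay_class_True decay_product_True]
lemmas smooth_upto_mult = smooth_upto_bilinear[OF _ bounded_bilinear_mult]
lemmas smooth_upto_add = ders_add[OF _ decay_class_True]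
lemmas smooth_upto_bounded_linear = ders_bounded_linear[OF _ decay_class_True]

lemma smooth_upto_const: "open W \<Longrightarrow> smooth_upto W k (\<lambda>_. c)"
  by (rule ders_const[OF _ decay_class_True]) auto

lemma ders_linear:
  assumes "open W" "decay_class Q" "Q (\<lambda>_. 1)" "Q norm" "bounded_linear L"
  shows "ders W Q k L"
proof -
  obtain K where K: "\<And>x. norm (L x) \<le> norm x * K" using bounded_linear.bounded[OF assms(5)] by blast
  have K': "norm (L x) \<le> \<bar>K\<bar> * norm x" for x
    using K[of x] mult_left_mono[OF abs_ge_self[of K] norm_ge_zero[of x]] by (simp add: mult.commute)
  have Q: "Q (\<lambda>x. indicator W x * norm (L x))"
    by (rule decay_class_mono[OF assms(2), OF assms(4), where C="\<bar>K\<bar>"])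
      (use K' in \<open>auto simp: indicator_def\<close>)
  have D: "(L has_derivative L) (at x)" for x by (rule bounded_linear_imp_has_derivative[OF assms(5)])
  show ?thesis
  proof (cases k)
    case 0
    show ?thesis unfolding 0 by (rule ders_0I[where f'="\<lambda>x. L"]) (fact Q, rule D)
  next
    case (Suc j)
    show ?thesis unfolding Suc
      by (rule ders_SucI[where f'="\<lambda>x. L"]) (fact assms(1), fact Q, rule D, rule ders_const[OF assms(1,2,3)])
  qed
qed

lemma smooth_upto_linear: "open W \<Longrightarrow> bounded_linear L \<Longrightarrow> smooth_upto W k L"
  by (rule ders_linear[OF _ decay_class_True]) auto

lemma ders_uminus:
  fixes f :: "'a::euclidean_space \<Rightarrow> 'b::real_normed_vector"
  assumes "open W" "decay_class Q" "ders W Q k f" shows "ders W Q k (\<lambda>x. - f x)"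
  by (rule ders_bounded_linear[OF assms(1,2) bounded_linear_minus[OF bounded_linear_ident] assms(3)])

lemma ders_weaken: "ders W Q k f \<Longrightarrow> (\<And>p. Q p \<Longrightarrow> Q' p) \<Longrightarrow> ders W Q' k f"
  unfolding ders_def by blast

text \<open>Stated jointly, since differentiating either function produces the other.\<close>

lemma ders_cos_sin:
  fixes u :: "'a::euclidean_space \<Rightarrow> real"
  assumes "open W" "decay_class Q" "decay_product Q Q Q" "Q (\<lambda>_. 1)" "ders W Q k u"
  shows "ders W Q k (\<lambda>x. cos (u x)) \<and> ders W Q k (\<lambda>x. sin (u x))"
proof -
  have Q: "Q (\<lambda>x. indicator W x * norm (cos (u x)))" "Q (\<lambda>x. indicator W x * norm (sin (u x)))"
    by (rule decay_class_mono[OF assms(2), OF assms(4), where C=1]; simp add: indicator_def)+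
  have D: "((\<lambda>x. cos (u x)) has_derivative (\<lambda>v. - (sin (u x) * dirderiv v u x))) (at x)"
    "((\<lambda>x. sin (u x)) has_derivative (\<lambda>v. cos (u x) * dirderiv v u x)) (at x)" if "x \<in> W" for x
    using ders_has_derivative[OF assms(5) that]
    by (auto intro!: derivative_eq_intros simp: mult.commute)
  show ?thesis using assms(5)
  proof (induction k)
    case 0
    show ?case
      by (intro conjI; rule ders_0I; (rule Q | rule D, assumption))
  next
    case (Suc k)
    have IH: "ders W Q k (\<lambda>x. cos (u x))" "ders W Q k (\<lambda>x. sin (u x))" "ders W Q k u"
      using Suc ders_SucD by blast+
    have "ders W Q k (\<lambda>x. - (sin (u x) * dirderiv v u x))" "ders W Q k (\<lambda>x. cos (u x) * dirderiv v u x)" for v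
      using ders_bilinear[OF assms(1-3) bounded_bilinear_mult] IH ders_dirderiv[OF Suc.prems]
      by (auto intro!: ders_uminus assms)
    then show ?case
      using ders_SucI[where Q=Q, OF assms(1) Q(1) D(1)] ders_SucI[where Q=Q, OF assms(1) Q(2) D(2)] by auto
  qed
qed

lemma smooth_upto_cos_sin:
  fixes u :: "'a::euclidean_space \<Rightarrow> real"
  assumes "open W" "smooth_upto W k u"
  shows "smooth_upto W k (\<lambda>x. cos (u x))" "smooth_upto W k (\<lambda>x. sin (u x))"
  using ders_cos_sin[of W "\<lambda>_. True", OF assms(1) decay_class_True decay_product_True TrueI assms(2)]
  by simp_all

text \<open>The classical exp (-1/x) with a polynomial factor in y = 1/x. The factor closes the
  family under differentiation: the derivative belongs to the polynomial y^2 (p - p'). Smoothness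
  then needs one induction with p arbitrary.\<close>

definition flat :: "real poly \<Rightarrow> real \<Rightarrow> real"
  where "flat p x = (if x > 0 then poly p (1 / x) * exp (- (1 / x)) else 0)"

lemma poly_exp_tendsto_0: "((\<lambda>y::real. poly p y * exp (- y)) \<longlongrightarrow> 0) at_top"
proof -
  have "((\<lambda>y::real. \<Sum>i\<le>degree p. coeff p i * (y ^ i / exp y)) \<longlongrightarrow> (\<Sum>i\<le>degree p. coeff p i * 0)) at_top"
    by (intro tendsto_sum tendsto_mult tendsto_const tendsto_power_div_exp_0)
  then show ?thesis
    by (simp add: poly_altdef exp_minus field_simps sum_divide_distrib)
qed

lemma flat_tendsto_0: "(flat p \<longlongrightarrow> 0) (at 0)"
proof -
  have "((\<lambda>x. poly p (1 / x) * exp (- (1 / x))) \<longlongrightarrow> 0) (at_right 0)"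
    using filterlim_compose[OF poly_exp_tendsto_0 filterlim_inverse_at_top_right]
    by (simp add: inverse_eq_divide)
  then have "(flat p \<longlongrightarrow> 0) (at_right 0)"
    by (rule Lim_transform_eventually) (auto simp: flat_def eventually_at_filter)
  moreover have "(flat p \<longlongrightarrow> 0) (at_left 0)"
    by (rule Lim_transform_eventually[OF tendsto_const]) (auto simp: flat_def eventually_at_filter)
  ultimately show ?thesis by (simp add: filterlim_split_at)
qed

lemma flat_has_derivative:
  "(flat p has_real_derivative flat (pCons 0 (pCons 0 (p - pderiv p))) x) (at x)"
proof -
  consider "x > 0" | "x < 0" | "x = 0" by linarith
  then show ?thesis
  proof cases
    case 1
    have "((\<lambda>x. poly p (1 / x) * exp (- (1 / x))) has_real_derivative
        flat (pCons 0 (pCons 0 (p - pderiv p))) x) (at x)"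
      using 1 by (auto intro!: derivative_eq_intros poly_DERIV DERIV_chain2[OF poly_DERIV] simp: flat_def field_simps power2_eq_square)
    then show ?thesis
      by (rule has_field_derivative_transform_within_open[where S="{0<..}"]) (use 1 in \<open>auto simp: flat_def\<close>)
  next
    case 2
    have "((\<lambda>x. 0) has_real_derivative flat (pCons 0 (pCons 0 (p - pderiv p))) x) (at x)"
      using 2 by (auto simp: flat_def)
    then show ?thesis
      by (rule has_field_derivative_transform_within_open[where S="{..<0}"]) (use 2 in \<open>auto simp: flat_def\<close>)
  next
    case 3
    \<comment> \<open>At the origin the difference quotient stays in the family: division by h
      multiplies the polynomial by 1/h.\<close>
    have "(\<lambda>h. (flat p (0 + h) - flat p 0) / h) = flat (pCons 0 p)"
      by (auto simp: flat_def fun_eq_iff field_simps)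
    then show ?thesis unfolding 3 DERIV_def using flat_tendsto_0[of "pCons 0 p"] by (simp add: flat_def)
  qed
qed

lemma flat_compose_has_derivative:
  assumes "(u has_derivative u') (at x)"
  shows "((\<lambda>x. flat p (u x)) has_derivative (\<lambda>v. flat (pCons 0 (pCons 0 (p - pderiv p))) (u x) * u' v)) (at x)"
  using has_derivative_compose[OF assms flat_has_derivative[unfolded has_field_derivative_def]]
  by simp

lemma smooth_upto_flat:
  assumes "open W" "smooth_upto W k u"
  shows "smooth_upto W k (\<lambda>x. flat p (u x))"
  using assms(2)
proof (induction k arbitrary: p)
  case 0
  show ?case by (rule smooth_upto_0I[OF flat_compose_has_derivative[OF ders_has_derivative[OF 0]]])
next
  case (Suc k)
  show ?case
    by (rule smooth_upto_SucI[OF assms(1) flat_compose_has_derivative[OF ders_has_derivative[OF Suc.prems]]], assumption)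
      (rule smooth_upto_mult[OF assms(1) Suc.IH[OF ders_SucD[OF Suc.prems]] ders_dirderiv[OF Suc.prems]])
qed

text \<open>The derivative is written as a product of \<open>v \<bullet> x\<close> and three copies
  of the function itself, so that the induction hypothesis of the next lemma applies to it.\<close>

lemma inverse_norm_has_derivative:
  fixes x :: "'a::euclidean_space"
  assumes "x \<noteq> 0"
  shows "((\<lambda>x. inverse (norm x)) has_derivative
      (\<lambda>v. - ((v \<bullet> x) * (inverse (norm x) * (inverse (norm x) * inverse (norm x)))))) (at x)"
  using assms
  by (auto intro!: derivative_eq_intros has_derivative_norm[OF assms] simp: sgn_div_norm divide_inverse mult_ac)

lemma smooth_upto_inverse_norm: "smooth_upto (- {0::'a::euclidean_space}) k (\<lambda>x. inverse (norm x))"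
proof (induction k)
  case 0
  show ?case by (rule smooth_upto_0I) (rule inverse_norm_has_derivative, simp)
next
  case (Suc k)
  have o: "open (- {0::'a})" by auto
  show ?case
  proof (rule smooth_upto_SucI[OF o])
    fix v :: 'a
    have "smooth_upto (- {0}) k (\<lambda>x::'a. v \<bullet> x)"
      by (rule smooth_upto_linear[OF o bounded_linear_inner_right])
    then show "smooth_upto (- {0}) k
        (\<lambda>x. - ((v \<bullet> x) * (inverse (norm x) * (inverse (norm x) * inverse (norm x)))))"
      by (rule ders_uminus[OF o decay_class_True smooth_upto_mult[OF o _ smooth_upto_mult[OF o Suc smooth_upto_mult[OF o Suc Suc]]]])
  qed (rule inverse_norm_has_derivative, simp)
qed

lemma smooth_upto_norm_sq: "open W \<Longrightarrow> smooth_upto W k (\<lambda>x::'a::euclidean_space. (norm x)\<^sup>2)"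
  unfolding power2_norm_eq_inner
  by (rule smooth_upto_bilinear[OF _ bounded_bilinear_inner]) (simp_all add: smooth_upto_linear bounded_linear_ident)

text \<open>Writing the norm as its smooth square times its inverse reduces it to functions already
  treated.\<close>

lemma smooth_upto_norm: "smooth_upto (- {0::'a::euclidean_space}) k norm"
proof (rule ders_cong)
  show "open (- {0::'a})" by auto
  show "smooth_upto (- {0::'a}) k (\<lambda>x. (norm x)\<^sup>2 * inverse (norm x))"
    by (rule smooth_upto_mult[OF _ smooth_upto_norm_sq smooth_upto_inverse_norm]) auto
qed (auto simp: power2_eq_square)

lemma smooth_upto_power:
  "open W \<Longrightarrow> smooth_upto W k (f :: 'a::euclidean_space \<Rightarrow> real) \<Longrightarrow> smooth_upto W k (\<lambda>x. f x ^ j)"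
proof (induction j)
  case 0
  then show ?case by (simp add: smooth_upto_const)
next
  case (Suc j)
  then show ?case using smooth_upto_mult[of W k f "\<lambda>x. f x ^ j"] by simp
qed

lemma smooth_upto_Un: "smooth_upto V k f \<Longrightarrow> smooth_upto W k f \<Longrightarrow> smooth_upto (V \<union> W) k f"
  unfolding ders_def by blast

lemma smooth_upto_subset: "smooth_upto V k f \<Longrightarrow> W \<subseteq> V \<Longrightarrow> smooth_upto W k f"
  unfolding ders_def by blast

section \<open>Schwartz functions\<close>

lemma schwartz_smooth: "f \<in> schwartz \<Longrightarrow> smooth_upto UNIV k f"
  by (rule ders_weaken[where Q=rapid]) (auto simp: schwartz_iff_ders)

lemma schwartz_bdd: "f \<in> schwartz \<Longrightarrow> ders UNIV bdd k f"
  by (rule ders_weaken[where Q=rapid]) (auto simp: schwartz_iff_ders rapid_imp_bdd)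

lemma schwartz_dirderiv: "f \<in> schwartz \<Longrightarrow> dirderiv v f \<in> schwartz"
  unfolding schwartz_iff_ders using ders_dirderiv by blast

lemma schwartz_has_derivative: "f \<in> schwartz \<Longrightarrow> (f has_derivative (\<lambda>v. dirderiv v f x)) (at x)"
  by (rule ders_has_derivative[OF schwartz_smooth UNIV_I])

lemma schwartz_continuous: "f \<in> schwartz \<Longrightarrow> continuous_on S f"
  by (meson schwartz_has_derivative has_derivative_continuous continuous_at_imp_continuous_on)

lemma schwartz_rapid: "f \<in> schwartz \<Longrightarrow> rapid (\<lambda>x. norm (f x))"
  using ders_bound[of UNIV rapid 0 f] by (simp add: schwartz_iff_ders)

lemma schwartz_add: "f \<in> schwartz \<Longrightarrow> g \<in> schwartz \<Longrightarrow> (\<lambda>x. f x + g x) \<in> schwartz"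
  by (simp add: schwartz_iff_ders ders_add decay_class_rapid)

lemma schwartz_bounded_linear: "bounded_linear L \<Longrightarrow> f \<in> schwartz \<Longrightarrow> (\<lambda>x. L (f x)) \<in> schwartz"
  by (simp add: schwartz_iff_ders ders_bounded_linear decay_class_rapid)

lemma decay_product_bdd_rapid: "decay_product bdd rapid rapid"
  using decay_product_slow_rapid bdd_imp_slow_growth unfolding decay_product_def by blast

lemma bdd_one: "bdd (\<lambda>_. 1)"
  unfolding bdd_def by auto

lemma slow_growth_norm: "slow_growth norm"
  unfolding slow_growth_def by (rule exI[of _ 1], rule exI[of _ 1]) auto

lemma schwartz_bilinear_bdd:
  assumes "bounded_bilinear pr" "\<And>k. ders UNIV bdd k f" "g \<in> schwartz"
  shows "(\<lambda>x. pr (f x) (g x)) \<in> schwartz"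
  unfolding schwartz_iff_ders
proof
  fix k show "ders UNIV rapid k (\<lambda>x. pr (f x) (g x))"
    using assms(3) by (intro ders_bilinear[OF open_UNIV decay_class_rapid decay_product_bdd_rapid assms(1,2)])
      (simp add: schwartz_iff_ders)
qed

lemma schwartz_bilinear:
  "bounded_bilinear pr \<Longrightarrow> f \<in> schwartz \<Longrightarrow> g \<in> schwartz \<Longrightarrow> (\<lambda>x. pr (f x) (g x)) \<in> schwartz"
  by (rule schwartz_bilinear_bdd[OF _ schwartz_bdd])

lemma schwartz_bilinear_linear:
  assumes "bounded_bilinear pr" "bounded_linear L" "g \<in> schwartz"
  shows "(\<lambda>x. pr (L x) (g x)) \<in> schwartz"
  unfolding schwartz_iff_ders
proof
  fix k show "ders UNIV rapid k (\<lambda>x. pr (L x) (g x))"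
  proof (rule ders_bilinear[OF open_UNIV decay_class_rapid decay_product_slow_rapid assms(1)])
    show "ders UNIV slow_growth k L"
      by (rule ders_linear[OF open_UNIV decay_class_slow_growth _ slow_growth_norm assms(2)])
        (rule bdd_imp_slow_growth[OF bdd_one])
    show "ders UNIV rapid k g" using assms(3) by (simp add: schwartz_iff_ders)
  qed
qed

text \<open>Outside the closed ball the function vanishes on an open set, so all its derivatives
  vanish there too; on the ball, continuity and compactness bound each weighted derivative.\<close>

lemma schwartz_compact_support:
  fixes f :: "'a::euclidean_space \<Rightarrow> 'b::real_normed_vector"
  assumes "\<And>k. smooth_upto UNIV k f" "\<And>x. norm x > r \<Longrightarrow> f x = 0"
  shows "f \<in> schwartz"
proof -
  have Q: "rapid (\<lambda>x. indicator UNIV x * norm (f x))"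
    if "continuous_on UNIV f" "\<And>x. norm x > r \<Longrightarrow> f x = 0" for f :: "'a \<Rightarrow> 'b"
    unfolding rapid_def
  proof
    fix k
    have "continuous_on (cball 0 r) (\<lambda>x. (1 + norm x) ^ k * norm (f x))"
      by (intro continuous_intros continuous_on_subset[OF that(1)]) auto
    then have "bounded ((\<lambda>x. (1 + norm x) ^ k * norm (f x)) ` cball 0 r)"
      by (intro compact_imp_bounded compact_continuous_image) auto
    then obtain B where B: "\<And>x. norm x \<le> r \<Longrightarrow> norm ((1 + norm x) ^ k * norm (f x)) \<le> B"
      unfolding bounded_iff by (metis (no_types, lifting) image_eqI mem_cball_0)
    show "\<exists>B. \<forall>x. (1 + norm x) ^ k * \<bar>indicat_real UNIV x * norm (f x)\<bar> \<le> B"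
    proof (intro exI allI)
      fix x show "(1 + norm x) ^ k * \<bar>indicat_real UNIV x * norm (f x)\<bar> \<le> max B 0"
        using B[of x] that(2)[of x] by (cases "norm x \<le> r") (auto simp: abs_mult)
    qed
  qed
  have C: "continuous_on UNIV f" if "smooth_upto UNIV k f" for f :: "'a \<Rightarrow> 'b" and k
    using that by (meson UNIV_I ders_has_derivative has_derivative_continuous continuous_at_imp_continuous_on)
  have "ders UNIV rapid k f" if "smooth_upto UNIV k f" "\<And>x. norm x > r \<Longrightarrow> f x = 0" for f :: "'a \<Rightarrow> 'b" and k
    using that
  proof (induction k arbitrary: f)
    case 0
    show ?case by (rule ders_0I[where Q=rapid, OF Q[OF C[OF 0(1)] 0(2)] ders_has_derivative[OF 0(1)]])
  next
    case (Suc k)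
    have "dirderiv v f x = 0" if "norm x > r" for v x
    proof -
      have "((\<lambda>_. 0) has_derivative (\<lambda>_. 0)) (at x)" by simp
      then have "(f has_derivative (\<lambda>_. 0)) (at x)"
        by (rule has_derivative_transform_within_open[where s="- cball 0 r"]) (use that Suc.prems(2) in auto)
      then show ?thesis by (simp add: dirderiv_eqI)
    qed
    then show ?case unfolding ders_Suc
      using Suc.IH[OF ders_dirderiv[OF Suc.prems(1)]]
      by (auto intro!: ders_0I[where Q=rapid, OF Q[OF C[OF Suc.prems(1)] Suc.prems(2)] ders_has_derivative[OF Suc.prems(1)]])
  qed
  then show ?thesis using assms unfolding schwartz_iff_ders by blast
qed

text \<open>The cosine tends to 1 at infinity, hence the subtraction of 1. At order zero the decay
  comes from |sin y| <= |y| and |cos y - 1| <= |y|; every derivative is a function with bounded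
  derivatives times a Schwartz derivative of \<open>u\<close>.\<close>

lemma schwartz_sin_cos:
  fixes u :: "'a::euclidean_space \<Rightarrow> real"
  assumes "u \<in> schwartz"
  shows "\<And>k. ders UNIV bdd k (\<lambda>x. cos (u x))" "\<And>k. ders UNIV bdd k (\<lambda>x. sin (u x))"
    "(\<lambda>x. sin (u x)) \<in> schwartz" "(\<lambda>x. cos (u x) - 1) \<in> schwartz"
proof -
  show c: "ders UNIV bdd k (\<lambda>x. cos (u x))" and s: "ders UNIV bdd k (\<lambda>x. sin (u x))" for k
    using ders_cos_sin[OF open_UNIV decay_class_bdd decay_product_bdd bdd_one schwartz_bdd[OF assms]] by auto
  have Q: "rapid (\<lambda>x. indicator UNIV x * norm (sin (u x)))" "rapid (\<lambda>x. indicator UNIV x * norm (cos (u x) - 1))"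
  proof -
    have "\<bar>cos y - 1\<bar> \<le> \<bar>y\<bar>" for y :: real
    proof -
      have "cos y - 1 = - 2 * (sin (y / 2))\<^sup>2" using cos_double_sin[of "y/2"] by simp
      then have "\<bar>cos y - 1\<bar> = 2 * (\<bar>sin (y / 2)\<bar> * \<bar>sin (y / 2)\<bar>)" by (simp add: power2_eq_square abs_mult)
      also have "\<dots> \<le> 2 * (1 * \<bar>y / 2\<bar>)"
        by (intro mult_left_mono mult_mono abs_sin_x_le_abs_x) auto
      finally show ?thesis by simp
    qed
    then show "rapid (\<lambda>x. indicator UNIV x * norm (cos (u x) - 1))"
      by (intro decay_class_mono[OF decay_class_rapid, OF schwartz_rapid[OF assms], where C=1]) auto
    show "rapid (\<lambda>x. indicator UNIV x * norm (sin (u x)))"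
      using abs_sin_x_le_abs_x by (intro decay_class_mono[OF decay_class_rapid, OF schwartz_rapid[OF assms], where C=1]) auto
  qed
  have D: "((\<lambda>x. cos (u x) - 1) has_derivative (\<lambda>v. - (sin (u x) * dirderiv v u x))) (at x)"
    "((\<lambda>x. sin (u x)) has_derivative (\<lambda>v. cos (u x) * dirderiv v u x)) (at x)" for x
    using schwartz_has_derivative[OF assms, of x]
    by (auto intro!: derivative_eq_intros simp: mult.commute)
  have P: "(\<lambda>x. sin (u x) * dirderiv v u x) \<in> schwartz" "(\<lambda>x. cos (u x) * dirderiv v u x) \<in> schwartz" for v
    by (rule schwartz_bilinear_bdd[OF bounded_bilinear_mult s schwartz_dirderiv[OF assms]],
        rule schwartz_bilinear_bdd[OF bounded_bilinear_mult c schwartz_dirderiv[OF assms]])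
  have P': "(\<lambda>x. - (sin (u x) * dirderiv v u x)) \<in> schwartz" for v
    by (rule schwartz_bounded_linear[OF bounded_linear_minus[OF bounded_linear_ident] P(1)])
  show "(\<lambda>x. sin (u x)) \<in> schwartz"
    unfolding schwartz_iff_ders
  proof
    fix k
    have "ders UNIV rapid (Suc k) (\<lambda>x. sin (u x))"
      by (rule ders_SucI[where Q=rapid, OF open_UNIV Q(1) D(2)]) (use P(2) in \<open>simp add: schwartz_iff_ders\<close>)
    then show "ders UNIV rapid k (\<lambda>x. sin (u x))" by (rule ders_SucD)
  qed
  show "(\<lambda>x. cos (u x) - 1) \<in> schwartz"
    unfolding schwartz_iff_ders
  proof
    fix k
    have "ders UNIV rapid (Suc k) (\<lambda>x. cos (u x) - 1)"
      by (rule ders_SucI[where Q=rapid, OF open_UNIV Q(2) D(1)]) (use P' in \<open>simp add: schwartz_iff_ders\<close>)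
    then show "ders UNIV rapid k (\<lambda>x. cos (u x) - 1)" by (rule ders_SucD)
  qed
qed

section \<open>Integrability of rapidly decreasing functions\<close>

lemma nn_integral_inverse_1_plus_square_finite: "(\<integral>\<^sup>+x. ennreal (inverse (1 + x\<^sup>2)) \<partial>lborel) < \<infinity>"
proof -
  have half: "(\<integral>\<^sup>+x. ennreal (inverse (1 + x\<^sup>2)) * indicator {0..} x \<partial>lborel) = ennreal (pi / 2 - arctan 0)"
    by (rule nn_integral_FTC_atLeast)
       (auto intro!: tendsto_arctan_at_top derivative_eq_intros simp: power2_eq_square)
  have half': "(\<integral>\<^sup>+x. ennreal (inverse (1 + x\<^sup>2)) * indicator {..0} x \<partial>lborel) = ennreal (pi / 2 - arctan 0)"
    using half by (subst nn_integral_real_affine[where c="-1" and t=0]) (auto simp: indicator_def cong: if_cong)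
  have "(\<integral>\<^sup>+x. ennreal (inverse (1 + x\<^sup>2)) \<partial>lborel)
     \<le> (\<integral>\<^sup>+x. ennreal (inverse (1 + x\<^sup>2)) * indicator {0..} x + ennreal (inverse (1 + x\<^sup>2)) * indicator {..0} x \<partial>lborel)"
    by (rule nn_integral_mono) (auto simp: indicator_def)
  also have "\<dots> = ennreal (pi / 2 - arctan 0) + ennreal (pi / 2 - arctan 0)"
    by (subst nn_integral_add) (auto simp: half half')
  also have "\<dots> < \<infinity>" by simp
  finally show ?thesis .
qed

text \<open>For each basis vector b, 1 + |x|^2 dominates 1 + (x . b)^2. The function is therefore at
  most a product of functions of one coordinate, and Tonelli reduces it to the arctangent
  integral.\<close>

lemma integrable_inverse_power_DIM:
  "integrable lborel (\<lambda>x::'a::euclidean_space. inverse ((1 + (norm x)\<^sup>2) ^ DIM('a)))"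
proof (rule integrableI_bounded)
  have "inverse ((1 + (norm x)\<^sup>2) ^ DIM('a)) \<le> (\<Prod>b\<in>Basis. inverse (1 + (x \<bullet> b)\<^sup>2))" for x :: 'a
  proof -
    have "(\<Prod>b\<in>(Basis::'a set). (1 + (x \<bullet> b)\<^sup>2)) \<le> (\<Prod>b\<in>(Basis::'a set). (1 + (norm x)\<^sup>2))"
    proof (rule prod_mono)
      fix b :: 'a assume "b \<in> Basis"
      then have "\<bar>x \<bullet> b\<bar> \<le> norm x" by (rule Basis_le_norm)
      then have "(x \<bullet> b)\<^sup>2 \<le> (norm x)\<^sup>2" using abs_le_square_iff[of "x \<bullet> b" "norm x"] by simp
      then show "0 \<le> 1 + (x \<bullet> b)\<^sup>2 \<and> 1 + (x \<bullet> b)\<^sup>2 \<le> 1 + (norm x)\<^sup>2" by simp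
    qed
    then have "inverse (\<Prod>b\<in>(Basis::'a set). (1 + (norm x)\<^sup>2)) \<le> inverse (\<Prod>b\<in>(Basis::'a set). (1 + (x \<bullet> b)\<^sup>2))"
      by (intro le_imp_inverse_le prod_pos) (auto intro: add_pos_nonneg)
    then show ?thesis using prod_inversef[of "\<lambda>b. 1 + (x \<bullet> b)\<^sup>2" "Basis::'a set"] by (simp add: o_def)
  qed
  then have "(\<integral>\<^sup>+x. ennreal (norm (inverse ((1 + (norm (x::'a))\<^sup>2) ^ DIM('a)))) \<partial>lborel)
     \<le> (\<integral>\<^sup>+x. (\<Prod>b\<in>(Basis::'a set). ennreal (inverse (1 + (x \<bullet> b)\<^sup>2))) \<partial>lborel)"
    by (intro nn_integral_mono) (auto simp: prod_ennreal intro!: ennreal_leI)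
  also have "\<dots> = (\<Prod>b\<in>(Basis::'a set). (\<integral>\<^sup>+x. ennreal (inverse (1 + x\<^sup>2)) \<partial>lborel))"
    by (rule nn_integral_lborel_prod) auto
  also have "\<dots> < \<infinity>"
  proof -
    obtain r where "0 \<le> r" "(\<integral>\<^sup>+x. ennreal (inverse (1 + x\<^sup>2)) \<partial>lborel) = ennreal r"
      using nn_integral_inverse_1_plus_square_finite by (cases rule: ennreal_cases) auto
    then show ?thesis by (simp add: ennreal_power)
  qed
  finally show "(\<integral>\<^sup>+x. ennreal (norm (inverse ((1 + (norm (x::'a))\<^sup>2) ^ DIM('a)))) \<partial>lborel) < \<infinity>" .
qed auto

text \<open>The exponent is twice the dimension because 1 + |x|^2 <= (1 + |x|)^2. The right-hand
  side is the standard integrable majorant.\<close>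

lemma rapid_bound:
  fixes p :: "'a::euclidean_space \<Rightarrow> real"
  assumes "rapid p"
  obtains B where "\<And>x. \<bar>p x\<bar> \<le> B * inverse ((1 + (norm x)\<^sup>2) ^ DIM('a))"
proof -
  obtain B where B: "\<And>x. (1 + norm x) ^ (2 * DIM('a)) * \<bar>p x\<bar> \<le> B"
    using assms unfolding rapid_def by blast
  have "\<bar>p x\<bar> \<le> B * inverse ((1 + (norm x)\<^sup>2) ^ DIM('a))" for x
  proof -
    have "(1 + (norm x)\<^sup>2) ^ DIM('a) \<le> ((1 + norm x)\<^sup>2) ^ DIM('a)"
      by (rule power_mono) (auto simp: power2_eq_square algebra_simps)
    then have "(1 + (norm x)\<^sup>2) ^ DIM('a) * \<bar>p x\<bar> \<le> (1 + norm x) ^ (2 * DIM('a)) * \<bar>p x\<bar>"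
      by (intro mult_right_mono) (auto simp: power_mult)
    then have "(1 + (norm x)\<^sup>2) ^ DIM('a) * \<bar>p x\<bar> \<le> B" using B[of x] by linarith
    moreover have "(1 + (norm x)\<^sup>2) ^ DIM('a) > 0" by (intro zero_less_power) (auto intro: add_pos_nonneg)
    ultimately show ?thesis by (simp add: field_simps)
  qed
  then show ?thesis by (rule that)
qed

lemma rapid_integrable:
  fixes f :: "'a::euclidean_space \<Rightarrow> 'b::{banach, second_countable_topology}"
  assumes "f \<in> borel_measurable borel" "rapid (\<lambda>x. norm (f x))"
  shows "integrable lborel f"
proof -
  obtain B where B: "\<And>x. \<bar>norm (f x)\<bar> \<le> B * inverse ((1 + (norm x)\<^sup>2) ^ DIM('a))"
    using rapid_bound[OF assms(2)] by blast
  show ?thesis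
  proof (rule Bochner_Integration.integrable_bound)
    show "integrable lborel (\<lambda>x::'a. B * inverse ((1 + (norm x)\<^sup>2) ^ DIM('a)))"
      by (intro integrable_mult_right integrable_inverse_power_DIM)
  qed (use B assms(1) in \<open>auto intro: order_trans[OF _ abs_ge_self]\<close>)
qed

lemma schwartz_measurable: "f \<in> schwartz \<Longrightarrow> f \<in> borel_measurable borel"
  by (rule borel_measurable_continuous_onI[OF schwartz_continuous])

lemma schwartz_integrable:
  fixes f :: "'a::euclidean_space \<Rightarrow> 'b::{banach, second_countable_topology}"
  shows "f \<in> schwartz \<Longrightarrow> integrable lborel f"
  by (rule rapid_integrable[OF schwartz_measurable schwartz_rapid])

lemma lborel_integral_affine:
  fixes f :: "'a::euclidean_space \<Rightarrow> 'b::{banach, second_countable_topology}"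
  assumes "c \<noteq> 0" "f \<in> borel_measurable borel"
  shows "(\<integral>x. f x \<partial>lborel) = \<bar>c\<bar> ^ DIM('a) *\<^sub>R (\<integral>x. f (t + c *\<^sub>R x) \<partial>lborel)"
  by (subst lborel_affine[OF assms(1), of t], subst integral_density)
     (use assms(2) in \<open>auto simp: integral_distr\<close>)

lemma lborel_integrable_affine:
  fixes f :: "'a::euclidean_space \<Rightarrow> 'b::{banach, second_countable_topology}"
  assumes "c \<noteq> 0" "integrable lborel f"
  shows "integrable lborel (\<lambda>x. f (t + c *\<^sub>R x))"
proof -
  have [measurable]: "f \<in> borel_measurable borel" using assms(2) by auto
  have "integrable (density (distr lborel borel (\<lambda>x. t + c *\<^sub>R x)) (\<lambda>_. \<bar>c\<bar> ^ DIM('a))) f"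
    using assms(2) lborel_affine[OF assms(1), of t] by (simp add: ennreal_power)
  then have "integrable lborel (\<lambda>x. \<bar>c\<bar> ^ DIM('a) *\<^sub>R f (t + c *\<^sub>R x))"
    by (simp add: integrable_density integrable_distr_eq)
  from integrable_scaleR_right[OF this, of "inverse (\<bar>c\<bar> ^ DIM('a))"] show ?thesis
    using assms(1) by simp
qed

lemma lborel_integral_translate:
  fixes f :: "'a::euclidean_space \<Rightarrow> 'b::{banach, second_countable_topology}"
  assumes "f \<in> borel_measurable borel"
  shows "(\<integral>x. f (x + t) \<partial>lborel) = (\<integral>x. f x \<partial>lborel)"
  using lborel_integral_affine[of 1 f t] assms by (simp add: add.commute)

lemma lborel_integral_uminus:
  fixes f :: "'a::euclidean_space \<Rightarrow> 'b::{banach, second_countable_topology}"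
  assumes "f \<in> borel_measurable borel"
  shows "(\<integral>x. f (- x) \<partial>lborel) = (\<integral>x. f x \<partial>lborel)"
  using lborel_integral_affine[of "-1" f 0] assms by simp

section \<open>Oscillatory integrals\<close>

text \<open>The phase map \<open>\<zeta>\<close> is left general so that differentiation under the
  integral is carried out once. It is \<open>uminus\<close> for the Fourier transform,
  \<open>freq\<close> for free waves on space-time, and a scalar wave profile for the dependence of
  the wave maps on the parameter e.\<close>

definition osc :: "'w::euclidean_space measure \<Rightarrow> ('w \<Rightarrow> 'a::euclidean_space) \<Rightarrow> ('w \<Rightarrow> complex) \<Rightarrow> 'a \<Rightarrow> complex"
  where "osc M \<zeta> h z = (LINT w|M. cis (z \<bullet> \<zeta> w) * h w)"

text \<open>Each derivative in direction v multiplies the density by i (v . zeta), so finiteness of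
  all absolute moments is stable under differentiation and gives smoothness.\<close>

definition moments :: "'w::euclidean_space measure \<Rightarrow> ('w \<Rightarrow> 'a::euclidean_space) \<Rightarrow> ('w \<Rightarrow> complex) \<Rightarrow> bool"
  where "moments M \<zeta> h \<longleftrightarrow> \<zeta> \<in> borel_measurable M \<and> h \<in> borel_measurable M \<and>
    (\<forall>j. integrable M (\<lambda>w. norm (\<zeta> w) ^ j * norm (h w)))"

lemma measurable_cis[measurable]: "cis \<in> borel_measurable borel"
  by (intro borel_measurable_continuous_onI continuous_intros)

text \<open>A first-order expansion with a quadratic remainder uniform in \<open>a\<close> and
  \<open>b\<close>; after integration the error is controlled by the second moment alone. The factor
  \<open>cis a\<close> has modulus 1 and splits off.\<close>

lemma norm_cis_approx: "norm (cis (a + b) - cis a - \<i> * of_real b * cis a) \<le> 2 * b\<^sup>2"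
proof -
  have "cis (a + b) - cis a - \<i> * of_real b * cis a = cis a * (cis b - 1 - \<i> * of_real b)"
    by (simp add: cis_mult[symmetric] algebra_simps)
  then have "norm (cis (a + b) - cis a - \<i> * of_real b * cis a) = norm (cis b - 1 - \<i> * of_real b)"
    by (simp add: norm_mult)
  also have "\<dots> \<le> \<bar>cos b - 1\<bar> + \<bar>sin b - b\<bar>"
    using cmod_le[of "cis b - 1 - \<i> * of_real b"] by simp
  also have "\<bar>sin b - b\<bar> \<le> b\<^sup>2"
  proof -
    have "\<bar>sin b - b\<bar> * 2 \<le> b\<^sup>2"
      using Maclaurin_sin_bound[of b 2] by (simp add: sin_coeff_def numeral_2_eq_2)
    moreover have "\<bar>sin b - b\<bar> \<le> \<bar>sin b - b\<bar> * 2" by simp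
    ultimately show ?thesis by (rule order_trans[rotated])
  qed
  also have "\<bar>cos b - 1\<bar> \<le> b\<^sup>2"
  proof -
    have "cos b - 1 = - 2 * (sin (b / 2))\<^sup>2" using cos_double_sin[of "b/2"] by simp
    moreover have "(sin (b / 2))\<^sup>2 \<le> (b / 2)\<^sup>2" using abs_sin_x_le_abs_x[of "b/2"] abs_le_square_iff by blast
    moreover have "0 \<le> (sin (b / 2))\<^sup>2" "(b / 2)\<^sup>2 = b\<^sup>2 / 4" by (auto simp: power_divide)
    ultimately show ?thesis using zero_le_power2[of b] by linarith
  qed
  finally show ?thesis by simp
qed

lemma moments_integrable:
  assumes "moments M \<zeta> h" shows "integrable M (\<lambda>w. cis (z \<bullet> \<zeta> w) * h w)"
proof -
  have [measurable]: "\<zeta> \<in> borel_measurable M" "h \<in> borel_measurable M" using assms by (auto simp: moments_def)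
  have "integrable M (\<lambda>w. norm (h w))" using assms unfolding moments_def by (auto dest: spec[of _ 0])
  then show ?thesis
    by (rule Bochner_Integration.integrable_bound) (auto simp: norm_mult)
qed

lemma moments_dirderiv:
  assumes "moments M \<zeta> h" shows "moments M \<zeta> (\<lambda>w. \<i> * of_real (v \<bullet> \<zeta> w) * h w)"
proof -
  have [measurable]: "\<zeta> \<in> borel_measurable M" "h \<in> borel_measurable M" using assms by (auto simp: moments_def)
  have "integrable M (\<lambda>w. norm (\<zeta> w) ^ j * norm (\<i> * of_real (v \<bullet> \<zeta> w) * h w))" for j
  proof (rule Bochner_Integration.integrable_bound)
    show "integrable M (\<lambda>w. norm v * (norm (\<zeta> w) ^ Suc j * norm (h w)))"
      using assms unfolding moments_def by (intro integrable_mult_right) blast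
    have "norm (\<zeta> w) ^ j * (\<bar>v \<bullet> \<zeta> w\<bar> * norm (h w)) \<le> norm (\<zeta> w) ^ j * ((norm v * norm (\<zeta> w)) * norm (h w))" for w
      by (intro mult_left_mono mult_right_mono Cauchy_Schwarz_ineq2) auto
    then show "AE w in M. norm (norm (\<zeta> w) ^ j * norm (\<i> * of_real (v \<bullet> \<zeta> w) * h w))
        \<le> norm (norm v * (norm (\<zeta> w) ^ Suc j * norm (h w)))"
      by (auto simp: norm_mult abs_mult mult_ac)
  qed simp
  then show ?thesis by (auto simp: moments_def)
qed

text \<open>Integrating \<open>norm_cis_approx\<close> bounds the remainder at \<open>y\<close> by 2
  C |y - z|^2 with C the second absolute moment, which gives differentiability directly.\<close>

lemma osc_has_derivative:
  assumes "moments M \<zeta> h"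
  shows "(osc M \<zeta> h has_derivative (\<lambda>v. osc M \<zeta> (\<lambda>w. \<i> * of_real (v \<bullet> \<zeta> w) * h w) z)) (at z)"
proof -
  have [measurable]: "\<zeta> \<in> borel_measurable M" "h \<in> borel_measurable M" using assms by (auto simp: moments_def)
  note I = moments_integrable[OF assms] moments_integrable[OF moments_dirderiv[OF assms]]
  define C where "C = (LINT w|M. norm (\<zeta> w) ^ 2 * norm (h w))"
  have Ci: "integrable M (\<lambda>w. norm (\<zeta> w) ^ 2 * norm (h w))" using assms unfolding moments_def by blast
  let ?D = "\<lambda>v. osc M \<zeta> (\<lambda>w. \<i> * of_real (v \<bullet> \<zeta> w) * h w) z"
  have lin: "linear ?D"
    unfolding osc_def
    by (rule linearI)
      (use I(2) in \<open>auto simp: inner_add_left algebra_simps scaleR_conv_of_real simp flip: Bochner_Integration.integral_add integral_mult_right_zero\<close>)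
  have bound: "norm (osc M \<zeta> h y - osc M \<zeta> h z - ?D (y - z)) \<le> 2 * C * (norm (y - z))\<^sup>2" for y
  proof -
    have "osc M \<zeta> h y - osc M \<zeta> h z - ?D (y - z)
      = (LINT w|M. (cis (y \<bullet> \<zeta> w) - cis (z \<bullet> \<zeta> w) - \<i> * of_real ((y - z) \<bullet> \<zeta> w) * cis (z \<bullet> \<zeta> w)) * h w)"
      unfolding osc_def using I(1) I(2)[of z "y - z"]
      by (simp add: algebra_simps flip: Bochner_Integration.integral_diff)
    also have "norm \<dots> \<le> (LINT w|M. 2 * (norm (y - z))\<^sup>2 * (norm (\<zeta> w) ^ 2 * norm (h w)))"
    proof (rule Bochner_Integration.integral_norm_bound_integral)
      show "integrable M (\<lambda>w. (cis (y \<bullet> \<zeta> w) - cis (z \<bullet> \<zeta> w) - \<i> * of_real ((y - z) \<bullet> \<zeta> w) * cis (z \<bullet> \<zeta> w)) * h w)"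
        using Bochner_Integration.integrable_diff[OF Bochner_Integration.integrable_diff[OF I(1)[of y] I(1)[of z]] I(2)[of z "y - z"]]
        by (simp add: algebra_simps)
      show "integrable M (\<lambda>w. 2 * (norm (y - z))\<^sup>2 * (norm (\<zeta> w) ^ 2 * norm (h w)))"
        using Ci by (rule integrable_mult_right)
      fix w
      have "norm (cis (y \<bullet> \<zeta> w) - cis (z \<bullet> \<zeta> w) - \<i> * of_real ((y - z) \<bullet> \<zeta> w) * cis (z \<bullet> \<zeta> w)) \<le> 2 * ((y - z) \<bullet> \<zeta> w)\<^sup>2"
        using norm_cis_approx[of "z \<bullet> \<zeta> w" "(y - z) \<bullet> \<zeta> w"] by (simp add: inner_diff_left)
      also have "((y - z) \<bullet> \<zeta> w)\<^sup>2 \<le> (norm (y - z) * norm (\<zeta> w))\<^sup>2"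
        using Cauchy_Schwarz_ineq2[of "y - z" "\<zeta> w"] by (simp add: abs_le_square_iff[symmetric])
      finally have "norm (cis (y \<bullet> \<zeta> w) - cis (z \<bullet> \<zeta> w) - \<i> * of_real ((y - z) \<bullet> \<zeta> w) * cis (z \<bullet> \<zeta> w))
          \<le> 2 * (norm (y - z))\<^sup>2 * norm (\<zeta> w) ^ 2" by (simp add: power_mult_distrib)
      then show "norm ((cis (y \<bullet> \<zeta> w) - cis (z \<bullet> \<zeta> w) - \<i> * of_real ((y - z) \<bullet> \<zeta> w) * cis (z \<bullet> \<zeta> w)) * h w)
          \<le> 2 * (norm (y - z))\<^sup>2 * (norm (\<zeta> w) ^ 2 * norm (h w))"
        unfolding norm_mult by (metis mult.assoc mult_right_mono norm_ge_zero)
    qed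
    also have "\<dots> = 2 * C * (norm (y - z))\<^sup>2" by (simp add: C_def)
    finally show ?thesis .
  qed
  show ?thesis
  proof (rule has_derivativeI_sandwich[of 1])
    show "bounded_linear ?D" using lin by (rule linear_conv_bounded_linear[THEN iffD1])
    show "norm ((osc M \<zeta> h y - osc M \<zeta> h z) - ?D (y - z)) / norm (y - z) \<le> 2 * C * norm (y - z)"
      if "y \<noteq> z" for y
      using bound[of y] that by (simp add: divide_le_eq power2_eq_square mult.assoc)
    show "((\<lambda>y. 2 * C * norm (y - z)) \<longlongrightarrow> 0) (at z)"
      by (auto intro!: tendsto_eq_intros)
  qed auto
qed

lemma smooth_upto_osc: "moments M \<zeta> h \<Longrightarrow> smooth_upto UNIV k (osc M \<zeta> h)"
proof (induction k arbitrary: h)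
  case 0
  show ?case by (rule smooth_upto_0I) (rule osc_has_derivative[OF 0])
next
  case (Suc k)
  show ?case
    by (rule smooth_upto_SucI) (simp, rule osc_has_derivative[OF Suc.prems], rule Suc.IH[OF moments_dirderiv[OF Suc.prems]])
qed

section \<open>The Fourier transform on the Schwartz space\<close>

lemma fourier_eq_osc: "fourier \<psi> = osc lborel uminus \<psi>"
  unfolding fourier_def osc_def by (simp add: inner_commute fun_eq_iff)

lemma schwartz_of_real:
  fixes f :: "'a::euclidean_space \<Rightarrow> real"
  shows "f \<in> schwartz \<Longrightarrow> (\<lambda>x. complex_of_real (f x)) \<in> schwartz"
  by (rule schwartz_bounded_linear[OF bounded_linear_of_real])

lemma schwartz_Re: "f \<in> schwartz \<Longrightarrow> (\<lambda>x. Re (f x)) \<in> schwartz"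
  by (rule schwartz_bounded_linear[OF bounded_linear_Re])

lemma schwartz_Im: "f \<in> schwartz \<Longrightarrow> (\<lambda>x. Im (f x)) \<in> schwartz"
  by (rule schwartz_bounded_linear[OF bounded_linear_Im])

lemma schwartz_mult_right: "f \<in> schwartz \<Longrightarrow> (\<lambda>x. c * f x :: complex) \<in> schwartz"
  by (rule schwartz_bounded_linear[OF bounded_linear_mult_right])

lemma schwartz_moments:
  fixes f :: "'a::euclidean_space \<Rightarrow> complex"
  assumes "f \<in> schwartz" shows "moments lborel uminus f"
proof -
  have [measurable]: "f \<in> borel_measurable borel" by (rule schwartz_measurable[OF assms])
  have "integrable lborel (\<lambda>w. norm (- w) ^ j * norm (f w))" for j
  proof (rule rapid_integrable)
    have "rapid (\<lambda>x. norm x ^ j * norm (f x))"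
    proof -
      have "slow_growth (\<lambda>x::'a. norm x ^ j)"
        unfolding slow_growth_def by (rule exI[of _ j], rule exI[of _ 1]) (auto intro!: power_mono)
      then show ?thesis
        using decay_product_slow_rapid schwartz_rapid[OF assms] unfolding decay_product_def by blast
    qed
    then show "rapid (\<lambda>x. norm (norm (- x) ^ j * norm (f x)))" by (simp add: norm_mult)
  qed simp
  then show ?thesis by (simp add: moments_def)
qed

lemma schwartz_mult_inner:
  fixes f :: "'a::euclidean_space \<Rightarrow> 'b::real_normed_vector"
  shows "f \<in> schwartz \<Longrightarrow> (\<lambda>x. (v \<bullet> x) *\<^sub>R f x) \<in> schwartz"
  by (rule schwartz_bilinear_linear[OF bounded_bilinear_scaleR bounded_linear_inner_right])

lemma fourier_bound:
  fixes f :: "'a::euclidean_space \<Rightarrow> complex"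
  assumes "integrable lborel f"
  shows "norm (fourier f x) \<le> (LINT x|lborel. norm (f x))"
proof -
  have [measurable]: "f \<in> borel_measurable borel" using assms by auto
  have "integrable lborel (\<lambda>y. cis (- (y \<bullet> x)) * f y)"
    by (rule Bochner_Integration.integrable_bound[OF assms]) (auto simp: norm_mult)
  from integral_norm_bound[of lborel "\<lambda>y. cis (- (y \<bullet> x)) * f y"] show ?thesis
    unfolding fourier_def by (simp add: norm_mult)
qed

lemma fourier_translate:
  fixes f :: "'a::euclidean_space \<Rightarrow> complex"
  assumes [measurable]: "f \<in> borel_measurable borel"
  shows "fourier (\<lambda>x. f (x + v)) \<xi> = cis (v \<bullet> \<xi>) * fourier f \<xi>"
proof -
  have "fourier (\<lambda>x. f (x + v)) \<xi> = (LINT x|lborel. cis (v \<bullet> \<xi>) * (cis (- ((x + v) \<bullet> \<xi>)) * f (x + v)))"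
    unfolding fourier_def by (simp add: inner_add_left cis_mult mult.assoc[symmetric])
  also have "\<dots> = (LINT x|lborel. cis (v \<bullet> \<xi>) * (cis (- (x \<bullet> \<xi>)) * f x))"
    using lborel_integral_translate[of "\<lambda>x. cis (v \<bullet> \<xi>) * (cis (- (x \<bullet> \<xi>)) * f x)" v] by simp
  finally show ?thesis unfolding fourier_def by simp
qed

text \<open>The difference quotients of \<open>f\<close> in direction \<open>v\<close> are dominated by a fixed rapidly decreasing
  function, and their Fourier transforms are explicit.\<close>

lemma fourier_dirderiv:
  fixes f :: "'a::euclidean_space \<Rightarrow> complex"
  assumes f: "f \<in> schwartz"
  shows "fourier (dirderiv v f) \<xi> = \<i> * of_real (v \<bullet> \<xi>) * fourier f \<xi>"
proof -
  have [measurable]: "f \<in> borel_measurable borel" "dirderiv v f \<in> borel_measurable borel"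
    using f by (auto intro: schwartz_measurable schwartz_dirderiv)
  define t where "t n = 1 / real (Suc n)" for n
  have t: "0 < t n" "t n \<le> 1" for n by (auto simp: t_def)
  have t0: "t \<longlonglongrightarrow> 0" unfolding t_def using LIMSEQ_inverse_real_of_nat by (simp add: inverse_eq_divide)
  have t0': "filterlim t (at 0) sequentially"
    using t0 t(1) by (auto simp: filterlim_at less_imp_neq[symmetric])
  define N where "N = 2 * DIM('a)"
  obtain B where B: "\<And>x. (1 + norm x) ^ N * norm (dirderiv v f x) \<le> B"
    using schwartz_rapid[OF schwartz_dirderiv[OF f, of v]] unfolding rapid_def by auto
  define G where "G x = (1 + norm v) ^ N * B * inverse ((1 + (norm x)\<^sup>2) ^ DIM('a))" for x :: 'a
  have pos: "0 < (1 + (norm x)\<^sup>2) ^ DIM('a)" for x :: 'a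
    by (intro zero_less_power) (auto intro: add_pos_nonneg)
  \<comment> \<open>A shift by \<open>s *\<^sub>R v\<close> with 0 <= s <= 1 costs at most the
    factor (1 + |v|)^N in the weight, since 1 + |x| <= (1 + |v|) (1 + |x + s v|). This is what makes
    the majorant \<open>G\<close> independent of s.\<close>
  have B': "norm (dirderiv v f (x + s *\<^sub>R v)) \<le> G x" if "0 \<le> s" "s \<le> 1" for x s
  proof -
    have "norm x \<le> norm (x + s *\<^sub>R v) + s * norm v"
      using norm_triangle_ineq4[of "x + s *\<^sub>R v" "s *\<^sub>R v"] that by simp
    also have "\<dots> \<le> norm (x + s *\<^sub>R v) + norm v"
      using that by (simp add: mult_left_le_one_le)
    finally have "norm x \<le> norm (x + s *\<^sub>R v) + norm v" .
    moreover have "0 \<le> norm v * norm (x + s *\<^sub>R v)" by simp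
    moreover have "(1 + norm v) * (1 + norm (x + s *\<^sub>R v))
        = 1 + norm v + norm (x + s *\<^sub>R v) + norm v * norm (x + s *\<^sub>R v)" by (simp add: algebra_simps)
    ultimately have "1 + norm x \<le> (1 + norm v) * (1 + norm (x + s *\<^sub>R v))" by linarith
    then have "(1 + norm x) ^ N \<le> (1 + norm v) ^ N * (1 + norm (x + s *\<^sub>R v)) ^ N"
      unfolding power_mult_distrib[symmetric] by (rule power_mono) simp
    then have "(1 + norm x) ^ N * norm (dirderiv v f (x + s *\<^sub>R v))
        \<le> (1 + norm v) ^ N * ((1 + norm (x + s *\<^sub>R v)) ^ N * norm (dirderiv v f (x + s *\<^sub>R v)))"
      unfolding mult.assoc[symmetric] by (rule mult_right_mono) simp
    also have "\<dots> \<le> (1 + norm v) ^ N * B" by (intro mult_left_mono B) auto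
    finally have *: "(1 + norm x) ^ N * norm (dirderiv v f (x + s *\<^sub>R v)) \<le> (1 + norm v) ^ N * B" .
    have "(1 + (norm x)\<^sup>2) ^ DIM('a) \<le> ((1 + norm x)\<^sup>2) ^ DIM('a)"
      by (rule power_mono) (auto simp: power2_eq_square algebra_simps)
    then have "(1 + (norm x)\<^sup>2) ^ DIM('a) * norm (dirderiv v f (x + s *\<^sub>R v))
        \<le> (1 + norm x) ^ N * norm (dirderiv v f (x + s *\<^sub>R v))"
      unfolding N_def power_mult by (intro mult_right_mono) auto
    with * have "(1 + (norm x)\<^sup>2) ^ DIM('a) * norm (dirderiv v f (x + s *\<^sub>R v)) \<le> (1 + norm v) ^ N * B" by linarith
    with pos[of x] show ?thesis unfolding G_def by (simp add: field_simps)
  qed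
  have D: "((\<lambda>s. f (x + s *\<^sub>R v)) has_vector_derivative dirderiv v f (x + s *\<^sub>R v)) (at s within S)" for x s S
  proof -
    have "((\<lambda>s. f (x + s *\<^sub>R v)) has_derivative (\<lambda>h. dirderiv (h *\<^sub>R v) f (x + s *\<^sub>R v))) (at s within S)"
      by (rule has_derivative_compose[OF _ schwartz_has_derivative[OF f]]) (auto intro!: derivative_eq_intros)
    moreover have "dirderiv (h *\<^sub>R v) f (x + s *\<^sub>R v) = h *\<^sub>R dirderiv v f (x + s *\<^sub>R v)" for h
      using linear_cmul[OF has_derivative_linear[OF schwartz_has_derivative[OF f]]] by blast
    ultimately show ?thesis by (simp add: has_vector_derivative_def)
  qed
  have q: "norm (f (x + t n *\<^sub>R v) - f x) \<le> G x * t n" for x n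
  proof -
    have "norm (f (x + t n *\<^sub>R v) - f (x + 0 *\<^sub>R v)) \<le> G x * norm (t n - 0)"
    proof (rule differentiable_bound[where S="{0..t n}" and f="\<lambda>s. f (x + s *\<^sub>R v)"])
      show "((\<lambda>s. f (x + s *\<^sub>R v)) has_derivative (\<lambda>h. h *\<^sub>R dirderiv v f (x + s *\<^sub>R v))) (at s within {0..t n})" for s
        using D[of x s] by (simp add: has_vector_derivative_def)
      show "onorm (\<lambda>h. h *\<^sub>R dirderiv v f (x + s *\<^sub>R v)) \<le> G x" if "s \<in> {0..t n}" for s
      proof (rule onorm_le)
        fix h :: real
        have "norm (dirderiv v f (x + s *\<^sub>R v)) \<le> G x" using B'[of s x] that t[of n] by simp
        then have "norm (dirderiv v f (x + s *\<^sub>R v)) * norm h \<le> G x * norm h" by (rule mult_right_mono) simp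
        then show "norm (h *\<^sub>R dirderiv v f (x + s *\<^sub>R v)) \<le> G x * norm h" by (simp add: mult.commute)
      qed
    qed (use t[of n] in auto)
    then show ?thesis using t[of n] by simp
  qed
  have lim1: "(\<lambda>n. LINT x|lborel. cis (- (x \<bullet> \<xi>)) * ((f (x + t n *\<^sub>R v) - f x) / t n)) \<longlonglongrightarrow> fourier (dirderiv v f) \<xi>"
    unfolding fourier_def
  proof (rule integral_dominated_convergence[where w=G])
    show "integrable lborel G" unfolding G_def by (intro integrable_mult_right integrable_inverse_power_DIM)
    show "AE x in lborel. norm (cis (- (x \<bullet> \<xi>)) * ((f (x + t n *\<^sub>R v) - f x) / t n)) \<le> G x" for n
      using q[of _ n] t[of n] by (auto simp: norm_mult norm_divide divide_le_eq)
    show "AE x in lborel. (\<lambda>n. cis (- (x \<bullet> \<xi>)) * ((f (x + t n *\<^sub>R v) - f x) / t n)) \<longlonglongrightarrow> cis (- (x \<bullet> \<xi>)) * dirderiv v f x"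
    proof (intro AE_I2 tendsto_mult tendsto_const)
      fix x
      have "((\<lambda>h. norm (f (x + h *\<^sub>R v) - f x - h *\<^sub>R dirderiv v f x) / norm h) \<longlongrightarrow> 0) (at 0)"
        using D[of x 0 UNIV] by (simp add: has_vector_derivative_def has_derivative_iff_norm)
      from filterlim_compose[OF this t0']
      have "(\<lambda>n. norm (f (x + t n *\<^sub>R v) - f x - t n *\<^sub>R dirderiv v f x) / t n) \<longlonglongrightarrow> 0"
        using t(1) by (simp add: less_imp_le)
      moreover have "norm (f (x + t n *\<^sub>R v) - f x - t n *\<^sub>R dirderiv v f x) / t n
          = norm ((f (x + t n *\<^sub>R v) - f x) / t n - dirderiv v f x)" for n
      proof -
        have "(f (x + t n *\<^sub>R v) - f x) / t n - dirderiv v f x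
            = (f (x + t n *\<^sub>R v) - f x - t n *\<^sub>R dirderiv v f x) / t n"
          using t(1)[of n] by (simp add: field_simps scaleR_conv_of_real)
        then show ?thesis using t(1)[of n] by (simp add: norm_divide)
      qed
      ultimately have "(\<lambda>n. norm ((f (x + t n *\<^sub>R v) - f x) / t n - dirderiv v f x)) \<longlonglongrightarrow> 0" by simp
      then show "(\<lambda>n. (f (x + t n *\<^sub>R v) - f x) / t n) \<longlonglongrightarrow> dirderiv v f x"
        by (rule LIM_zero_cancel[where f="\<lambda>n. (f (x + t n *\<^sub>R v) - f x) / t n", OF tendsto_norm_zero_cancel])
    qed
  qed measurable
  have If: "integrable lborel (\<lambda>x. cis (- (x \<bullet> \<xi>)) * f x)"
    using moments_integrable[OF schwartz_moments[OF f], of \<xi>] by (simp add: inner_commute)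
  \<comment> \<open>Translation multiplies the transform by a phase, so the transform of a
    difference quotient is known exactly.\<close>
  have eq: "(LINT x|lborel. cis (- (x \<bullet> \<xi>)) * ((f (x + t n *\<^sub>R v) - f x) / t n))
     = (cis (t n * (v \<bullet> \<xi>)) - 1) / t n * fourier f \<xi>" for n
  proof -
    have "integrable lborel (\<lambda>x. cis (- (x \<bullet> \<xi>)) * f (x + t n *\<^sub>R v))"
    proof (rule Bochner_Integration.integrable_bound)
      show "integrable lborel (\<lambda>x. f (t n *\<^sub>R v + 1 *\<^sub>R x))"
        by (rule lborel_integrable_affine[OF _ schwartz_integrable[OF f]]) simp
    qed (auto simp: norm_mult add.commute)
    then have "(LINT x|lborel. (cis (- (x \<bullet> \<xi>)) * f (x + t n *\<^sub>R v) - cis (- (x \<bullet> \<xi>)) * f x) / t n)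
      = (fourier (\<lambda>x. f (x + t n *\<^sub>R v)) \<xi> - fourier f \<xi>) / t n"
      using If unfolding fourier_def by simp
    also have "\<dots> = (cis (t n * (v \<bullet> \<xi>)) - 1) / t n * fourier f \<xi>"
      by (simp add: fourier_translate diff_divide_distrib algebra_simps)
    finally show ?thesis by (simp add: algebra_simps diff_divide_distrib)
  qed
  have lim2: "(\<lambda>n. (cis (t n * (v \<bullet> \<xi>)) - 1) / t n * fourier f \<xi>) \<longlonglongrightarrow> \<i> * of_real (v \<bullet> \<xi>) * fourier f \<xi>"
  proof (intro tendsto_mult tendsto_const)
    have "(\<lambda>n. (cis (t n * (v \<bullet> \<xi>)) - 1) / t n - \<i> * of_real (v \<bullet> \<xi>)) \<longlonglongrightarrow> 0"
    proof (rule Lim_null_comparison)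
      have "norm ((cis (t n * (v \<bullet> \<xi>)) - 1) / t n - \<i> * of_real (v \<bullet> \<xi>)) \<le> t n * (2 * (v \<bullet> \<xi>)\<^sup>2)" for n
      proof -
        have "norm (cis (t n * (v \<bullet> \<xi>)) - 1 - \<i> * of_real (t n * (v \<bullet> \<xi>))) \<le> 2 * (t n * (v \<bullet> \<xi>))\<^sup>2"
          using norm_cis_approx[of 0 "t n * (v \<bullet> \<xi>)"] by simp
        moreover have "(cis (t n * (v \<bullet> \<xi>)) - 1) / t n - \<i> * of_real (v \<bullet> \<xi>)
            = (cis (t n * (v \<bullet> \<xi>)) - 1 - \<i> * of_real (t n * (v \<bullet> \<xi>))) / t n"
          using t(1)[of n] by (simp add: field_simps)
        ultimately show ?thesis
          using t(1)[of n] by (simp add: norm_divide divide_le_eq power2_eq_square mult_ac)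
      qed
      then show "\<forall>\<^sub>F n in sequentially. norm ((cis (t n * (v \<bullet> \<xi>)) - 1) / t n - \<i> * of_real (v \<bullet> \<xi>)) \<le> t n * (2 * (v \<bullet> \<xi>)\<^sup>2)"
        by simp
      show "(\<lambda>n. t n * (2 * (v \<bullet> \<xi>)\<^sup>2)) \<longlonglongrightarrow> 0" using tendsto_mult_left_zero[OF t0] by blast
    qed
    then show "(\<lambda>n. (cis (t n * (v \<bullet> \<xi>)) - 1) / t n) \<longlonglongrightarrow> \<i> * of_real (v \<bullet> \<xi>)" by (rule LIM_zero_cancel)
  qed
  show ?thesis using LIMSEQ_unique[OF lim1[unfolded eq] lim2] .
qed

text \<open>One power of |x| is traded for one derivative: |x| is at most the sum of the |x . b|,
  and (x . b) times the transform of f has the modulus of the transform of a derivative of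
  f.\<close>

lemma fourier_rapid:
  fixes f :: "'a::euclidean_space \<Rightarrow> complex"
  assumes "f \<in> schwartz" shows "rapid (\<lambda>x. norm (fourier f x))"
proof -
  have "\<exists>B. \<forall>x. norm x ^ k * norm (fourier f x) \<le> B" for k
    using assms
  proof (induction k arbitrary: f)
    case 0
    then show ?case using fourier_bound[OF schwartz_integrable] by auto
  next
    case (Suc k)
    have "\<exists>B. \<forall>b\<in>Basis. \<forall>x. norm x ^ k * norm (fourier (dirderiv b f) x) \<le> B b"
      using Suc.IH[OF schwartz_dirderiv[OF Suc.prems]] by metis
    then obtain B where B: "\<And>b x. b \<in> Basis \<Longrightarrow> norm x ^ k * norm (fourier (dirderiv b f) x) \<le> B b" by blast
    show ?case
    proof (intro exI allI)
      fix x :: 'a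
      have "norm x ^ Suc k * norm (fourier f x) \<le> norm x ^ k * ((\<Sum>b\<in>Basis. \<bar>x \<bullet> b\<bar>) * norm (fourier f x))"
        unfolding power_Suc2 mult.assoc by (intro mult_left_mono mult_right_mono norm_le_l1) auto
      also have "\<dots> = (\<Sum>b\<in>Basis. norm x ^ k * norm (fourier (dirderiv b f) x))"
        by (simp add: fourier_dirderiv[OF Suc.prems] norm_mult sum_distrib_left sum_distrib_right inner_commute)
      also have "\<dots> \<le> (\<Sum>b\<in>Basis. B b)" by (intro sum_mono B)
      finally show "norm x ^ Suc k * norm (fourier f x) \<le> (\<Sum>b\<in>Basis. B b)" .
    qed
  qed
  then show ?thesis by (simp add: rapid_iff)
qed

lemma schwartz_fourier:
  fixes f :: "'a::euclidean_space \<Rightarrow> complex"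
  assumes "f \<in> schwartz" shows "fourier f \<in> schwartz"
  unfolding schwartz_iff_ders
proof
  fix k
  have D: "(fourier f has_derivative (\<lambda>v. fourier (\<lambda>x. (v \<bullet> x) *\<^sub>R (- \<i> * f x)) z)) (at z)"
    if "f \<in> schwartz" for f :: "'a \<Rightarrow> complex" and z
    using osc_has_derivative[OF schwartz_moments[OF that], of z]
    unfolding fourier_eq_osc by (simp add: scaleR_conv_of_real mult_ac)
  have Q: "rapid (\<lambda>x. indicator UNIV x * norm (fourier f x))" if "f \<in> schwartz" for f :: "'a \<Rightarrow> complex"
    using fourier_rapid[OF that] by simp
  show "ders UNIV rapid k (fourier f)" using assms
  proof (induction k arbitrary: f)
    case 0
    show ?case by (rule ders_0I[where Q=rapid, OF Q[OF 0] D[OF 0]])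
  next
    case (Suc k)
    show ?case by (rule ders_SucI[where Q=rapid, OF open_UNIV Q[OF Suc.prems] D[OF Suc.prems]])
      (rule Suc.IH[OF schwartz_mult_inner[OF schwartz_mult_right[OF Suc.prems]]])
  qed
qed

text \<open>Fubini for the symmetric kernel exp (-i x . y). Inversion, the transforms of
  distributions and the test of the squared wave all rest on this identity.\<close>

lemma fourier_mult_formula:
  fixes f g :: "'a::euclidean_space \<Rightarrow> complex"
  assumes "integrable lborel f" "integrable lborel g"
  shows "(LINT x|lborel. fourier f x * g x) = (LINT x|lborel. f x * fourier g x)"
proof -
  have [measurable]: "f \<in> borel_measurable borel" "g \<in> borel_measurable borel" using assms by auto
  have "integrable (lborel \<Otimes>\<^sub>M lborel) (case_prod (\<lambda>x y. cis (- (y \<bullet> x)) * f y * g x))"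
  proof (rule lborel_pair.Fubini_integrable)
    show "integrable lborel (\<lambda>x. LINT y|lborel. norm (case (x, y) of (x, y) \<Rightarrow> cis (- (y \<bullet> x)) * f y * g x))"
      using assms by (simp add: norm_mult)
    show "AE x in lborel. integrable lborel (\<lambda>y. case (x, y) of (x, y) \<Rightarrow> cis (- (y \<bullet> x)) * f y * g x)"
    proof (rule AE_I2)
      fix x show "integrable lborel (\<lambda>y. case (x, y) of (x, y) \<Rightarrow> cis (- (y \<bullet> x)) * f y * g x)"
        by (rule Bochner_Integration.integrable_bound[OF integrable_mult_left[OF assms(1), of "g x"]])
          (auto simp: norm_mult)
    qed
  qed measurable
  from lborel_pair.Fubini_integral[OF this] show ?thesis
    unfolding fourier_def by (simp add: inner_commute mult_ac flip: integral_mult_right_zero integral_mult_left_zero)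
qed

text \<open>Regularise the outer integral by theta (t x) and let t tend to 0. By
  \<open>fourier_mult_formula\<close> and a dilation, the regularised integral equals the integral
  of a (t x - y) times the transform of theta. The two forms converge, by dominated convergence, to
  the two sides of the claim.\<close>

lemma fourier_inversion_aux:
  fixes a \<theta> :: "'a::euclidean_space \<Rightarrow> complex"
  assumes a: "a \<in> schwartz" and \<theta>: "\<theta> \<in> schwartz" and "\<theta> 0 = 1"
  shows "fourier (fourier a) y = (LINT x|lborel. fourier \<theta> x) * a (- y)"
proof -
  define t where "t n = 1 / real (Suc n)" for n
  have t: "0 < t n" "t n \<le> 1" for n by (auto simp: t_def)
  have t0: "t \<longlonglongrightarrow> 0" unfolding t_def using LIMSEQ_inverse_real_of_nat by (simp add: inverse_eq_divide)
  have [measurable]: "a \<in> borel_measurable borel" "\<theta> \<in> borel_measurable borel"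
    "fourier a \<in> borel_measurable borel" "fourier \<theta> \<in> borel_measurable borel"
    using assms by (auto intro: schwartz_measurable schwartz_fourier)
  have bd: "\<exists>B. \<forall>x. norm (f x) \<le> B" if "f \<in> schwartz" for f :: "'a \<Rightarrow> complex"
    using rapid_imp_bdd[OF schwartz_rapid[OF that]] by (simp add: bdd_def)
  obtain A where A: "\<And>x. norm (a x) \<le> A" using bd[OF a] by blast
  obtain Th where Th: "\<And>x. norm (\<theta> x) \<le> Th" using bd[OF \<theta>] by blast
  note cont = schwartz_continuous[OF a, of UNIV] schwartz_continuous[OF \<theta>, of UNIV]
  have I: "integrable lborel a" "integrable lborel (fourier a)" "integrable lborel \<theta>" "integrable lborel (fourier \<theta>)"
    using assms by (auto intro: schwartz_integrable schwartz_fourier)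
  have lim1: "(\<lambda>n. LINT x|lborel. fourier a x * (cis (- (x \<bullet> y)) * \<theta> (t n *\<^sub>R x))) \<longlonglongrightarrow> (LINT x|lborel. fourier a x * cis (- (x \<bullet> y)))"
  proof (rule integral_dominated_convergence[where w="\<lambda>x. norm (fourier a x) * Th"])
    show "integrable lborel (\<lambda>x. norm (fourier a x) * Th)" using I by simp
    show "AE x in lborel. (\<lambda>n. fourier a x * (cis (- (x \<bullet> y)) * \<theta> (t n *\<^sub>R x))) \<longlonglongrightarrow> fourier a x * cis (- (x \<bullet> y))"
    proof (rule AE_I2)
      fix x
      have "(\<lambda>n. \<theta> (t n *\<^sub>R x)) \<longlonglongrightarrow> \<theta> (0 *\<^sub>R x)"
        by (rule continuous_on_tendsto_compose[OF cont(2)]) (rule tendsto_scaleR[OF t0 tendsto_const], auto)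
      then have "(\<lambda>n. fourier a x * (cis (- (x \<bullet> y)) * \<theta> (t n *\<^sub>R x))) \<longlonglongrightarrow> fourier a x * (cis (- (x \<bullet> y)) * 1)"
        using assms(3) by (intro tendsto_mult tendsto_const) simp
      then show "(\<lambda>n. fourier a x * (cis (- (x \<bullet> y)) * \<theta> (t n *\<^sub>R x))) \<longlonglongrightarrow> fourier a x * cis (- (x \<bullet> y))" by simp
    qed
    show "AE x in lborel. norm (fourier a x * (cis (- (x \<bullet> y)) * \<theta> (t n *\<^sub>R x))) \<le> norm (fourier a x) * Th" for n
      using Th by (auto simp: norm_mult intro!: mult_left_mono)
  qed measurable
  have lim2: "(\<lambda>n. LINT x|lborel. a (t n *\<^sub>R x - y) * fourier \<theta> x) \<longlonglongrightarrow> (LINT x|lborel. a (- y) * fourier \<theta> x)"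
  proof (rule integral_dominated_convergence[where w="\<lambda>x. A * norm (fourier \<theta> x)"])
    show "integrable lborel (\<lambda>x. A * norm (fourier \<theta> x))" using I by simp
    show "AE x in lborel. (\<lambda>n. a (t n *\<^sub>R x - y) * fourier \<theta> x) \<longlonglongrightarrow> a (- y) * fourier \<theta> x"
    proof (rule AE_I2)
      fix x
      have "(\<lambda>n. a (t n *\<^sub>R x - y)) \<longlonglongrightarrow> a (0 *\<^sub>R x - y)"
        by (rule continuous_on_tendsto_compose[OF cont(1)])
          (rule tendsto_diff[OF tendsto_scaleR[OF t0 tendsto_const] tendsto_const], auto)
      then show "(\<lambda>n. a (t n *\<^sub>R x - y) * fourier \<theta> x) \<longlonglongrightarrow> a (- y) * fourier \<theta> x"
        by (intro tendsto_mult tendsto_const) simp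
    qed
    show "AE x in lborel. norm (a (t n *\<^sub>R x - y) * fourier \<theta> x) \<le> A * norm (fourier \<theta> x)" for n
      using A by (auto simp: norm_mult intro!: mult_right_mono)
  qed measurable
  \<comment> \<open>The Jacobian \<open>c\<close> of the substitution xi = - y + t x cancels the
    factor 1 / c in the transform of the dilated theta.\<close>
  have eq: "(LINT x|lborel. fourier a x * (cis (- (x \<bullet> y)) * \<theta> (t n *\<^sub>R x))) = (LINT x|lborel. a (t n *\<^sub>R x - y) * fourier \<theta> x)" for n
  proof -
    define c where "c = t n ^ DIM('a)"
    have c: "c > 0" using t(1)[of n] by (simp add: c_def)
    have "integrable lborel (\<lambda>x. \<theta> (t n *\<^sub>R x))"
      using lborel_integrable_affine[of "t n" \<theta> 0] I t(1)[of n] by simp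
    then have i: "integrable lborel (\<lambda>x. cis (- (x \<bullet> y)) * \<theta> (t n *\<^sub>R x))"
      by (rule Bochner_Integration.integrable_bound) (auto simp: norm_mult)
    have "c *\<^sub>R fourier (\<lambda>x. cis (- (x \<bullet> y)) * \<theta> (t n *\<^sub>R x)) \<xi> = fourier \<theta> ((1 / t n) *\<^sub>R (\<xi> + y))" for \<xi>
      unfolding fourier_def c_def
      using lborel_integral_affine[of "t n" "\<lambda>x. cis (- (x \<bullet> ((1 / t n) *\<^sub>R (\<xi> + y)))) * \<theta> x" 0] t(1)[of n]
      by (simp add: inner_add_right cis_mult mult.assoc[symmetric] distrib_left divide_inverse[symmetric])
    from arg_cong[OF this, of "scaleR (inverse c)"]
    have F: "fourier (\<lambda>x. cis (- (x \<bullet> y)) * \<theta> (t n *\<^sub>R x)) \<xi> = fourier \<theta> ((1 / t n) *\<^sub>R (\<xi> + y)) /\<^sub>R c" for \<xi>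
      using c by simp
    have "(LINT x|lborel. fourier a x * (cis (- (x \<bullet> y)) * \<theta> (t n *\<^sub>R x)))
      = (LINT \<xi>|lborel. a \<xi> * (fourier \<theta> ((1 / t n) *\<^sub>R (\<xi> + y)) /\<^sub>R c))"
      using fourier_mult_formula[OF I(1) i] by (simp add: F)
    also have "\<dots> = c *\<^sub>R (LINT \<xi>|lborel. a (- y + t n *\<^sub>R \<xi>) * (fourier \<theta> ((1 / t n) *\<^sub>R (- y + t n *\<^sub>R \<xi> + y)) /\<^sub>R c))"
      using lborel_integral_affine[of "t n" "\<lambda>\<xi>. a \<xi> * (fourier \<theta> ((1 / t n) *\<^sub>R (\<xi> + y)) /\<^sub>R c)" "- y"] t(1)[of n]
      by (simp add: c_def)
    also have "\<dots> = (LINT x|lborel. a (t n *\<^sub>R x - y) * fourier \<theta> x)"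
      using c t(1)[of n] by simp
    finally show ?thesis .
  qed
  have "(LINT x|lborel. fourier a x * cis (- (x \<bullet> y))) = (LINT x|lborel. a (- y) * fourier \<theta> x)"
    using LIMSEQ_unique[OF lim1[unfolded eq] lim2] .
  then show ?thesis unfolding fourier_def[of "fourier a"] by (simp add: mult.commute)
qed

text \<open>For a real even function, conjugating the transform amounts to reflecting the
  integration variable.\<close>

lemma fourier_real_even:
  fixes f :: "'a::euclidean_space \<Rightarrow> complex"
  assumes [measurable]: "f \<in> borel_measurable borel" and "\<And>x. f (- x) = f x" "\<And>x. f x \<in> \<real>"
  shows "fourier f x \<in> \<real>"
proof -
  have "cnj (fourier f x) = (LINT y|lborel. cis (y \<bullet> x) * f y)"
    unfolding fourier_def using assms(3)
    by (subst Bochner_Integration.integral_cnj[symmetric]) (simp add: cis_cnj Reals_cnj_iff)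
  also have "\<dots> = (LINT y|lborel. cis (- y \<bullet> x) * f (- y))"
    using lborel_integral_uminus[of "\<lambda>y. cis (y \<bullet> x) * f y"] by simp
  also have "\<dots> = fourier f x" unfolding fourier_def using assms(2) by simp
  finally show ?thesis by (simp add: Reals_cnj_iff)
qed

section \<open>Bump functions and their consequences\<close>

lemma flat_1: "flat 1 x = (if x > 0 then exp (- (1 / x)) else 0)"
  by (simp add: flat_def)

lemma flat_1_nonneg: "0 \<le> flat 1 x" and flat_1_le_1: "flat 1 x \<le> 1"
  and flat_1_pos: "x > 0 \<Longrightarrow> flat 1 x > 0"
  by (auto simp: flat_1)

lemma flat_1_mono: "x \<le> y \<Longrightarrow> flat 1 x \<le> flat 1 y"
  by (auto simp: flat_1 divide_left_mono)

text \<open>Radially nonincreasing and supported in the ball of radius r, but without a plateau.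
  Lower bounds for it are values of \<open>flat 1\<close> that depend on the ratio |x| / r only;
  this is where 3 / 4 and 5 / 9 come from later.\<close>

definition bump :: "real \<Rightarrow> 'a::euclidean_space \<Rightarrow> real"
  where "bump r x = flat 1 (1 - (norm x)\<^sup>2 * inverse (r\<^sup>2))"

lemma smooth_upto_bump: "smooth_upto UNIV k (bump r :: 'a::euclidean_space \<Rightarrow> real)"
proof -
  have 1: "smooth_upto UNIV k (\<lambda>x::'a. (norm x)\<^sup>2 * inverse (r\<^sup>2))"
    by (rule smooth_upto_mult[OF open_UNIV smooth_upto_norm_sq[OF open_UNIV] smooth_upto_const[OF open_UNIV]])
  have "smooth_upto UNIV k (\<lambda>x::'a. 1 + - ((norm x)\<^sup>2 * inverse (r\<^sup>2)))"
    by (rule smooth_upto_add[OF open_UNIV smooth_upto_const[OF open_UNIV] ders_uminus[OF open_UNIV decay_class_True 1]])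
  from smooth_upto_flat[OF open_UNIV this, of 1] show ?thesis by (simp add: bump_def[abs_def])
qed

lemma bump_eq_0: "norm x > r \<Longrightarrow> r > 0 \<Longrightarrow> bump r x = 0"
  using power_strict_mono[of r "norm x" 2] by (simp add: bump_def flat_1 field_simps)

lemma bump_ge: "norm x \<le> s \<Longrightarrow> bump r x \<ge> flat 1 (1 - s\<^sup>2 * inverse (r\<^sup>2))"
  unfolding bump_def by (intro flat_1_mono diff_left_mono mult_right_mono power_mono) auto

lemma bump_nonneg: "0 \<le> bump r x" and bump_le_1: "bump r x \<le> 1"
  by (auto simp: bump_def flat_1_nonneg flat_1_le_1)

lemma bump_minus: "bump r (- x) = bump r x"
  by (simp add: bump_def)

lemma schwartz_bump: "r > 0 \<Longrightarrow> bump r \<in> schwartz"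
  by (rule schwartz_compact_support[OF smooth_upto_bump bump_eq_0]) auto

text \<open>Every face of the box contributes a factor exp (-1 / (k d)) with k = n + 1 and d the
  signed distance to the face, replaced by 0 where d <= 0. Inside the box each factor tends to
  1.\<close>

lemma box_approximation:
  fixes l u :: "'a::euclidean_space"
  obtains \<psi> :: "nat \<Rightarrow> 'a \<Rightarrow> real" where "\<And>n. \<psi> n \<in> schwartz"
    "\<And>n x. \<bar>\<psi> n x\<bar> \<le> indicator (box l u) x" "\<And>x. (\<lambda>n. \<psi> n x) \<longlonglongrightarrow> indicator (box l u) x"
proof
  define \<psi> :: "nat \<Rightarrow> 'a \<Rightarrow> real" where
    "\<psi> n x = (\<Prod>b\<in>Basis. flat 1 (real (Suc n) * (x \<bullet> b - l \<bullet> b)) * flat 1 (real (Suc n) * (u \<bullet> b - x \<bullet> b)))" for n x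
  have lin: "smooth_upto UNIV k (\<lambda>x::'a. c * (x \<bullet> b) + d)" for k c b d
    by (intro smooth_upto_add smooth_upto_const smooth_upto_linear open_UNIV
        bounded_linear_mult_right bounded_linear_compose[OF bounded_linear_mult_right bounded_linear_inner_left])
  have sm1: "smooth_upto UNIV k (\<lambda>x::'a. flat 1 (real (Suc n) * (x \<bullet> b - l \<bullet> b)))"
    "smooth_upto UNIV k (\<lambda>x::'a. flat 1 (real (Suc n) * (u \<bullet> b - x \<bullet> b)))" for k n b
    using smooth_upto_flat[OF open_UNIV lin[of k "real (Suc n)" b "- real (Suc n) * (l \<bullet> b)"], of 1]
      smooth_upto_flat[OF open_UNIV lin[of k "- real (Suc n)" b "real (Suc n) * (u \<bullet> b)"], of 1]
    by (simp_all add: algebra_simps)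
  have sm2: "smooth_upto UNIV k (\<lambda>x::'a. \<Prod>b\<in>B. flat 1 (real (Suc n) * (x \<bullet> b - l \<bullet> b)) * flat 1 (real (Suc n) * (u \<bullet> b - x \<bullet> b)))"
    if "finite B" for B k n
    using that
  proof (induction B)
    case empty
    show ?case by (simp add: smooth_upto_const)
  next
    case (insert b B)
    show ?case
      using smooth_upto_mult[OF open_UNIV smooth_upto_mult[OF open_UNIV sm1] insert.IH] insert.hyps by simp
  qed
  have zero: "\<psi> n x = 0" if "x \<notin> box l u" for n x
  proof -
    from that obtain b where b: "b \<in> Basis" "x \<bullet> b \<le> l \<bullet> b \<or> u \<bullet> b \<le> x \<bullet> b" by (force simp: mem_box)
    then have "real (Suc n) * (x \<bullet> b - l \<bullet> b) \<le> 0 \<or> real (Suc n) * (u \<bullet> b - x \<bullet> b) \<le> 0"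
      by (auto simp: mult_le_0_iff)
    then have "flat 1 (real (Suc n) * (x \<bullet> b - l \<bullet> b)) * flat 1 (real (Suc n) * (u \<bullet> b - x \<bullet> b)) = 0"
      unfolding flat_1 by auto
    with b show ?thesis unfolding \<psi>_def by (intro prod_zero) auto
  qed
  obtain r where r: "\<And>x. x \<in> box l u \<Longrightarrow> norm x \<le> r" using bounded_box[of l u] unfolding bounded_iff by blast
  show "\<psi> n \<in> schwartz" for n
  proof (rule schwartz_compact_support)
    show "smooth_upto UNIV k (\<psi> n)" for k using sm2[OF finite_Basis] unfolding \<psi>_def[abs_def] .
    show "\<psi> n x = 0" if "norm x > r" for x using r[of x] that zero[of x n] by force
  qed
  show "\<bar>\<psi> n x\<bar> \<le> indicator (box l u) x" for n x
  proof (cases "x \<in> box l u")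
    case True
    have "\<bar>\<psi> n x\<bar> \<le> 1" unfolding \<psi>_def abs_prod
      by (intro prod_le_1) (auto simp: abs_mult flat_1_nonneg flat_1_le_1 intro!: mult_le_one)
    with True show ?thesis by simp
  qed (simp add: zero)
  show "(\<lambda>n. \<psi> n x) \<longlonglongrightarrow> indicator (box l u) x" for x
  proof (cases "x \<in> box l u")
    case True
    have f: "(\<lambda>n. flat 1 (real (Suc n) * c)) \<longlonglongrightarrow> 1" if "c > 0" for c
    proof -
      have "(\<lambda>n. exp (- (inverse (real (Suc n)) * (1 / c)))) \<longlonglongrightarrow> exp (- (0 * (1 / c)))"
        by (intro tendsto_intros LIMSEQ_inverse_real_of_nat)
      moreover have "flat 1 (real (Suc n) * c) = exp (- (inverse (real (Suc n)) * (1 / c)))" for n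
        using that by (simp add: flat_1 divide_inverse)
      ultimately show ?thesis by simp
    qed
    have "(\<lambda>n. \<psi> n x) \<longlonglongrightarrow> (\<Prod>b\<in>(Basis::'a set). 1 * 1)"
      unfolding \<psi>_def by (intro tendsto_prod tendsto_mult f) (use True in \<open>auto simp: mem_box\<close>)
    with True show ?thesis by simp
  qed (simp add: zero)
qed

text \<open>Boxes form an intersection-stable generator of the Borel sets, and the sets over which
  the integral vanishes form a Dynkin system. A function with vanishing integral over every Borel
  set is zero almost everywhere.\<close>

lemma integrable_eq_0_if_box_integrals_0:
  fixes f :: "'a::euclidean_space \<Rightarrow> complex"
  assumes f: "integrable lborel f" and box: "\<And>l u. (LINT x|lborel. indicator (box l u) x *\<^sub>R f x) = 0"
  shows "AE x in lborel. f x = 0"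
proof (rule sigma_finite_measure.density_zero[OF sigma_finite_lborel f])
  have [measurable]: "f \<in> borel_measurable borel" using f by auto
  have fi: "integrable lborel (\<lambda>x. indicator A x *\<^sub>R f x)" if "A \<in> sets borel" for A
    using integrable_mult_indicator[OF _ f, of A] that by simp
  \<comment> \<open>The whole space is no box, so its integral is obtained as a limit over growing
    boxes; complements in the Dynkin system refer to it.\<close>
  have univ: "(LINT x|lborel. f x) = 0"
  proof -
    have "(\<lambda>n. LINT x|lborel. indicator (box (- (real n *\<^sub>R One)) (real n *\<^sub>R One)) x *\<^sub>R f x) \<longlonglongrightarrow> (LINT x|lborel. f x)"
    proof (rule integral_dominated_convergence[where w="\<lambda>x. norm (f x)"])
      show "AE x in lborel. (\<lambda>n. indicator (box (- (real n *\<^sub>R One)) (real n *\<^sub>R One)) x *\<^sub>R f x) \<longlonglongrightarrow> f x"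
      proof (rule AE_I2)
        fix x :: 'a
        have "x \<in> (\<Union>n. box (- (real n *\<^sub>R One)) (real n *\<^sub>R One))" unfolding UN_box_eq_UNIV by simp
        then obtain N where N: "x \<in> box (- (real N *\<^sub>R One)) (real N *\<^sub>R One)" by blast
        have "x \<in> box (- (real n *\<^sub>R One)) (real n *\<^sub>R One)" if "n \<ge> N" for n
          using N that by (fastforce simp: mem_box)
        then have "\<forall>\<^sub>F n in sequentially. f x = indicator (box (- (real n *\<^sub>R One)) (real n *\<^sub>R One)) x *\<^sub>R f x"
          by (auto simp: eventually_sequentially indicator_def intro!: exI[of _ N])
        then show "(\<lambda>n. indicator (box (- (real n *\<^sub>R One)) (real n *\<^sub>R One)) x *\<^sub>R f x) \<longlonglongrightarrow> f x"
          by (rule Lim_transform_eventually[OF tendsto_const])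
      qed
    qed (use f in \<open>auto simp: indicator_def\<close>)
    then show ?thesis unfolding box by (simp add: LIMSEQ_const_iff)
  qed
  fix A :: "'a set"
  assume "A \<in> sets lborel"
  then have "A \<in> sets borel" by simp
  have S: "sets (borel :: 'a measure) = sigma_sets UNIV (range (\<lambda>(a, b). box a b))"
    by (simp add: borel_eq_box)
  have A: "A \<in> sigma_sets UNIV (range (\<lambda>(a, b). box a b))" using \<open>A \<in> sets borel\<close> unfolding S .
  have "(LINT x|lborel. indicator A x *\<^sub>R f x) = 0"
  proof (rule sigma_sets_induct_disjoint[OF _ _ A, where P="\<lambda>A. (LINT x|lborel. indicator A x *\<^sub>R f x) = 0"])
    show "Int_stable (range (\<lambda>(a, b). box a b :: 'a set))" by (auto simp: Int_stable_def box_Int_box)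
    show "range (\<lambda>(a, b). box a b) \<subseteq> Pow (UNIV :: 'a set)" by simp
    show "(LINT x|lborel. indicator B x *\<^sub>R f x) = 0" if "B \<in> range (\<lambda>(a, b). box a b)" for B using that box by auto
    show "(LINT x|lborel. indicator {} x *\<^sub>R f x) = 0" by simp
    show "(LINT x|lborel. indicator (UNIV - B) x *\<^sub>R f x) = 0"
      if "B \<in> sigma_sets UNIV (range (\<lambda>(a, b). box a b))" "(LINT x|lborel. indicator B x *\<^sub>R f x) = 0" for B
    proof -
      have "B \<in> sets borel" using that(1) unfolding S .
      have "(LINT x|lborel. indicator (UNIV - B) x *\<^sub>R f x) = (LINT x|lborel. f x - indicator B x *\<^sub>R f x)"
        by (rule Bochner_Integration.integral_cong) (auto simp: indicator_def)
      also have "\<dots> = 0" using fi[OF \<open>B \<in> sets borel\<close>] f univ that(2) by (subst Bochner_Integration.integral_diff) auto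
      finally show ?thesis .
    qed
    show "(LINT x|lborel. indicator (\<Union>i. B i) x *\<^sub>R f x) = 0"
      if "disjoint_family B" "range B \<subseteq> sigma_sets UNIV (range (\<lambda>(a, b). box a b))"
        "\<And>i::nat. (LINT x|lborel. indicator (B i) x *\<^sub>R f x) = 0" for B
    proof -
      have B: "B i \<in> sets borel" for i using that(2) unfolding S by blast
      have "set_integrable lborel (\<Union>i. B i) f" unfolding set_integrable_def using B by (intro fi) auto
      from lebesgue_integral_countable_add[OF _ _ this]
      show ?thesis using B that(1,3) unfolding set_lebesgue_integral_def disjoint_family_on_def by simp
    qed
  qed
  then show "set_lebesgue_integral lborel A f = 0" by (simp add: set_lebesgue_integral_def)
qed

text \<open>\<open>h\<close> is only known to be integrable against Schwartz functions. A bump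
  bounded below on a box yields local integrability; approximating the indicator of a box then makes
  the box integrals vanish, and the previous lemma applies to \<open>h\<close> restricted to large
  boxes.\<close>

lemma AE_0_if_test_integrals_0:
  fixes h :: "'a::euclidean_space \<Rightarrow> complex"
  assumes [measurable]: "h \<in> borel_measurable borel"
    and i: "\<And>\<psi>::'a \<Rightarrow> complex. \<psi> \<in> schwartz \<Longrightarrow> integrable lborel (\<lambda>x. \<psi> x * h x)"
    and z: "\<And>\<psi>::'a \<Rightarrow> complex. \<psi> \<in> schwartz \<Longrightarrow> (LINT x|lborel. \<psi> x * h x) = 0"
  shows "AE x in lborel. h x = 0"
proof -
  have loc: "integrable lborel (\<lambda>x. indicator (box l u) x *\<^sub>R h x)" for l u
  proof -
    obtain r where r: "\<And>x. x \<in> box l u \<Longrightarrow> norm x \<le> r" using bounded_box[of l u] unfolding bounded_iff by blast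
    \<comment> \<open>The maximum keeps the radius positive when the box is empty or degenerate. The
      bump has radius 2 s, so on the ball of radius s it is at least
      \<open>flat 1 (3 / 4)\<close>.\<close>
    define s where "s = max r 1"
    have s: "s > 0" "\<And>x. x \<in> box l u \<Longrightarrow> norm x \<le> s" using r by (force simp: s_def)+
    define c where "c = flat 1 (1 - s\<^sup>2 * inverse ((2 * s)\<^sup>2))"
    have "s\<^sup>2 * inverse ((2 * s)\<^sup>2) = 1 / 4" using s(1) by (simp add: power_mult_distrib field_simps)
    then have c: "c > 0" unfolding c_def by (intro flat_1_pos) simp
    have "integrable lborel (\<lambda>x. complex_of_real (bump (2 * s) x) * h x)"
      using s(1) by (intro i schwartz_of_real schwartz_bump) simp
    then have "integrable lborel (\<lambda>x. (1 / c) *\<^sub>R (complex_of_real (bump (2 * s) x) * h x))" by simp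
    then show ?thesis
    proof (rule Bochner_Integration.integrable_bound)
      have "norm (indicator (box l u) x *\<^sub>R h x) \<le> norm ((1 / c) *\<^sub>R (complex_of_real (bump (2 * s) x) * h x))" for x
      proof (cases "x \<in> box l u")
        case True
        then have "1 \<le> bump (2 * s) x / c"
          using bump_ge[OF s(2)[OF True], of "2 * s"] c by (simp add: c_def)
        then have "1 * norm (h x) \<le> bump (2 * s) x / c * norm (h x)" by (rule mult_right_mono) simp
        then show ?thesis using True c bump_nonneg[of "2 * s" x] by (simp add: norm_mult)
      qed simp
      then show "AE x in lborel. norm (indicator (box l u) x *\<^sub>R h x) \<le> norm ((1 / c) *\<^sub>R (complex_of_real (bump (2 * s) x) * h x))"
        by simp
    qed measurable
  qed
  have box: "(LINT x|lborel. indicator (box l u) x *\<^sub>R h x) = 0" for l u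
  proof -
    obtain \<psi> :: "nat \<Rightarrow> 'a \<Rightarrow> real" where \<psi>: "\<And>n. \<psi> n \<in> schwartz"
      "\<And>n x. \<bar>\<psi> n x\<bar> \<le> indicator (box l u) x" "\<And>x. (\<lambda>n. \<psi> n x) \<longlonglongrightarrow> indicator (box l u) x"
      by (rule box_approximation[of l u], rule that)
    note [measurable] = schwartz_measurable[OF \<psi>(1)]
    have "(\<lambda>n. LINT x|lborel. complex_of_real (\<psi> n x) * h x) \<longlonglongrightarrow> (LINT x|lborel. indicator (box l u) x *\<^sub>R h x)"
    proof (rule integral_dominated_convergence[where w="\<lambda>x. norm (indicator (box l u) x *\<^sub>R h x)"])
      show "AE x in lborel. (\<lambda>n. complex_of_real (\<psi> n x) * h x) \<longlonglongrightarrow> indicator (box l u) x *\<^sub>R h x"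
        unfolding scaleR_conv_of_real by (intro AE_I2 tendsto_mult tendsto_of_real \<psi>(3) tendsto_const)
      show "AE x in lborel. norm (complex_of_real (\<psi> n x) * h x) \<le> norm (indicator (box l u) x *\<^sub>R h x)" for n
        using \<psi>(2)[of n] by (auto simp: norm_mult intro!: mult_right_mono)
      show "integrable lborel (\<lambda>x. norm (indicator (box l u) x *\<^sub>R h x))" by (rule integrable_norm[OF loc])
    qed auto
    moreover have "(LINT x|lborel. complex_of_real (\<psi> n x) * h x) = 0" for n
      by (rule z[OF schwartz_of_real[OF \<psi>(1)]])
    ultimately have "(\<lambda>n::nat. 0) \<longlonglongrightarrow> (LINT x|lborel. indicator (box l u) x *\<^sub>R h x)" by simp
    then show ?thesis by (simp add: LIMSEQ_const_iff)
  qed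
  have "AE x in lborel. indicator (box (- (real n *\<^sub>R One)) (real n *\<^sub>R One)) x *\<^sub>R h x = 0" for n
  proof (rule integrable_eq_0_if_box_integrals_0[OF loc])
    fix l u :: 'a
    have "(LINT x|lborel. indicator (box l u) x *\<^sub>R indicator (box (- (real n *\<^sub>R One)) (real n *\<^sub>R One)) x *\<^sub>R h x)
      = (LINT x|lborel. indicator (box l u \<inter> box (- (real n *\<^sub>R One)) (real n *\<^sub>R One)) x *\<^sub>R h x)"
      by (rule Bochner_Integration.integral_cong) (auto simp: indicator_def)
    also have "\<dots> = 0" unfolding box_Int_box by (rule box)
    finally show "(LINT x|lborel. indicator (box l u) x *\<^sub>R indicator (box (- (real n *\<^sub>R One)) (real n *\<^sub>R One)) x *\<^sub>R h x) = 0" .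
  qed
  then have "AE x in lborel. \<forall>n. indicator (box (- (real n *\<^sub>R One)) (real n *\<^sub>R One)) x *\<^sub>R h x = 0"
    unfolding AE_all_countable by blast
  then show ?thesis
  proof eventually_elim
    case (elim x)
    have "x \<in> (\<Union>n. box (- (real n *\<^sub>R One)) (real n *\<^sub>R One))" unfolding UN_box_eq_UNIV by simp
    then obtain N where "x \<in> box (- (real N *\<^sub>R One)) (real N *\<^sub>R One)" by blast
    with elim[rule_format, of N] show ?case by simp
  qed
qed

lemma continuous_integral_0_imp_0:
  fixes f :: "'a::euclidean_space \<Rightarrow> real"
  assumes "continuous_on UNIV f" "integrable lborel f" "\<And>x. 0 \<le> f x" "(LINT x|lborel. f x) = 0"
  shows "f x = 0"
proof (rule ccontr)
  assume "f x \<noteq> 0"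
  have "AE x in lborel. f x = 0"
    using integral_nonneg_eq_0_iff_AE[OF assms(2)] assms(3,4) by simp
  then have "AE x in lborel. x \<notin> {x. f x \<noteq> 0}" by simp
  moreover have o: "open {x. f x \<noteq> 0}" using assms(1) by (intro open_Collect_neq) auto
  ultimately have "{x. f x \<noteq> 0} \<in> null_sets lborel"
    using AE_iff_null_sets[of "{x. f x \<noteq> 0}" lborel] by auto
  then have "negligible {x. f x \<noteq> 0}" unfolding negligible_iff_null_sets by (rule null_sets_completionI)
  then show False using open_not_negligible[OF o] \<open>f x \<noteq> 0\<close> by auto
qed

text \<open>\<open>C\<close> is the integral of the transform of a fixed even profile
  \<open>g\<close> with value 1 at the origin. If it were 0, then
  \<open>fourier_mult_formula\<close> would make the integral of the square of this real transform
  vanish. The transform would then be 0 at the origin, so the nonnegative \<open>g\<close> would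
  have integral 0 and vanish, against g(0) = 1. The estimates use only that \<open>C\<close> is
  nonzero.\<close>

lemma fourier_inversion:
  obtains C :: complex where "C \<noteq> 0"
    "\<And>(a :: 'a::euclidean_space \<Rightarrow> complex) y. a \<in> schwartz \<Longrightarrow> fourier (fourier a) y = C * a (- y)"
proof -
  define g :: "'a \<Rightarrow> real" where "g x = bump 1 x / bump 1 (0::'a)" for x
  define \<theta> where "\<theta> x = complex_of_real (g x)" for x
  have b0: "bump 1 (0::'a) > 0" by (simp add: bump_def flat_1)
  have g: "g \<in> schwartz"
    using schwartz_bounded_linear[OF bounded_linear_divide schwartz_bump[of 1]] by (simp add: g_def[abs_def])
  then have \<theta>: "\<theta> \<in> schwartz" unfolding \<theta>_def[abs_def] by (rule schwartz_of_real)
  have \<theta>0: "\<theta> 0 = 1" using b0 by (simp add: \<theta>_def g_def)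
  have even: "\<theta> (- x) = \<theta> x" for x by (simp add: \<theta>_def g_def bump_minus)
  define C where "C = (LINT x|lborel. fourier \<theta> x)"
  have inv: "fourier (fourier a) y = C * a (- y)" if "a \<in> schwartz" for a :: "'a \<Rightarrow> complex" and y
    unfolding C_def by (rule fourier_inversion_aux[OF that \<theta> \<theta>0])
  have "C \<noteq> 0"
  proof
    assume "C = 0"
    have re: "fourier \<theta> x = complex_of_real (Re (fourier \<theta> x))" for x
    proof -
      have "\<theta> y \<in> \<real>" for y by (simp add: \<theta>_def)
      from fourier_real_even[OF schwartz_measurable[OF \<theta>] even this, of x] show ?thesis
        by (simp add: of_real_Re)
    qed
    note F = schwartz_fourier[OF \<theta>]
    have "(LINT x|lborel. fourier \<theta> x * fourier \<theta> x) = (LINT x|lborel. \<theta> x * fourier (fourier \<theta>) x)"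
      by (rule fourier_mult_formula[OF schwartz_integrable[OF \<theta>] schwartz_integrable[OF F]])
    also have "\<dots> = 0" by (simp add: inv[OF \<theta>] \<open>C = 0\<close>)
    finally have "(LINT x|lborel. fourier \<theta> x * fourier \<theta> x) = 0" .
    moreover have "(\<lambda>x. fourier \<theta> x * fourier \<theta> x) = (\<lambda>x. complex_of_real ((Re (fourier \<theta> x))\<^sup>2))"
      using re by (metis of_real_mult power2_eq_square)
    ultimately have 0: "(LINT x|lborel. (Re (fourier \<theta> x))\<^sup>2) = 0"
      using integral_complex_of_real[of lborel "\<lambda>x. (Re (fourier \<theta> x))\<^sup>2"] by simp
    have S: "(\<lambda>x. (Re (fourier \<theta> x))\<^sup>2) \<in> schwartz"
      unfolding power2_eq_square by (rule schwartz_bilinear[OF bounded_bilinear_mult schwartz_Re[OF F] schwartz_Re[OF F]])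
    have "(Re (fourier \<theta> 0))\<^sup>2 = 0"
      by (rule continuous_integral_0_imp_0[OF schwartz_continuous[OF S] schwartz_integrable[OF S] _ 0]) simp
    then have "fourier \<theta> 0 = 0" using re[of 0] by simp
    then have "(LINT x|lborel. g x) = 0" by (simp add: fourier_def \<theta>_def)
    then have "g 0 = 0"
      by (rule continuous_integral_0_imp_0[OF schwartz_continuous[OF g] schwartz_integrable[OF g], rotated])
        (simp add: g_def bump_nonneg)
    then show False using b0 by (simp add: g_def)
  qed
  from that[OF this inv] show ?thesis .
qed

section \<open>Sobolev norms\<close>

lemma measurable_vec_nth_compose:
  fixes h :: "'a \<Rightarrow> complex^'m"
  assumes "h \<in> borel_measurable M" shows "(\<lambda>x. h x $ k) \<in> borel_measurable M"
  by (rule measurable_compose[OF assms borel_measurable_continuous_onI]) (intro continuous_intros)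

lemma has_fourier_unique:
  fixes u :: "('n::finite, 'm::finite) dist"
  assumes "has_fourier u h" "has_fourier u h'"
  shows "AE \<xi> in lborel. h \<xi> = h' \<xi>"
proof -
  have [measurable]: "h \<in> borel_measurable borel" "h' \<in> borel_measurable borel"
    using assms by (auto simp: has_fourier_def)
  note [measurable] = measurable_vec_nth_compose
  have "AE \<xi> in lborel. h \<xi> $ k - h' \<xi> $ k = 0" for k
  proof (rule AE_0_if_test_integrals_0)
    show "(\<lambda>\<xi>. h \<xi> $ k - h' \<xi> $ k) \<in> borel_measurable borel" by measurable
    fix \<psi> :: "real^'n \<Rightarrow> complex" assume "\<psi> \<in> schwartz"
    with assms have i: "integrable lborel (\<lambda>\<xi>. \<psi> \<xi> * h \<xi> $ k)" "integrable lborel (\<lambda>\<xi>. \<psi> \<xi> * h' \<xi> $ k)"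
      and e: "(LINT \<xi>|lborel. \<psi> \<xi> * h \<xi> $ k) = (LINT \<xi>|lborel. \<psi> \<xi> * h' \<xi> $ k)"
      by (auto simp: has_fourier_def)
    show "integrable lborel (\<lambda>\<xi>. \<psi> \<xi> * (h \<xi> $ k - h' \<xi> $ k))"
      using Bochner_Integration.integrable_diff[OF i] by (simp add: right_diff_distrib)
    show "(LINT \<xi>|lborel. \<psi> \<xi> * (h \<xi> $ k - h' \<xi> $ k)) = 0"
      using Bochner_Integration.integral_diff[OF i] e by (simp add: right_diff_distrib)
  qed
  then have "AE \<xi> in lborel. \<forall>k\<in>UNIV. h \<xi> $ k - h' \<xi> $ k = 0" by (intro AE_finite_allI) auto
  then show ?thesis by eventually_elim (simp add: vec_eq_iff)
qed

lemma sobolev_weight_measurable: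
  "h \<in> borel_measurable lborel \<Longrightarrow> sobolev_weight s h \<in> borel_measurable lborel"
  unfolding sobolev_weight_def[abs_def] by simp

lemma sobolev_weight_nonneg: "0 \<le> sobolev_weight s h \<xi>"
  by (simp add: sobolev_weight_def)

lemma sobolev_norm_eq:
  assumes "has_fourier u h"
  shows "snd (sobolev s) u = sqrt (LINT \<xi>|lborel. sobolev_weight s h \<xi>)"
proof -
  have s: "has_fourier u (SOME h. has_fourier u h)" by (rule someI[where P="has_fourier u", OF assms])
  have "AE \<xi> in lborel. sobolev_weight s (SOME h. has_fourier u h) \<xi> = sobolev_weight s h \<xi>"
    using has_fourier_unique[OF s assms] by eventually_elim (simp add: sobolev_weight_def)
  then have "(LINT \<xi>|lborel. sobolev_weight s (SOME h. has_fourier u h) \<xi>) = (LINT \<xi>|lborel. sobolev_weight s h \<xi>)"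
    using s assms by (intro integral_cong_AE sobolev_weight_measurable) (auto simp: has_fourier_def)
  then show ?thesis by (simp add: sobolev_def)
qed

lemma sobolevE:
  assumes "u \<in> fst (sobolev s)"
  obtains h where "has_fourier u h" "integrable lborel (sobolev_weight s h)"
    "snd (sobolev s) u = sqrt (LINT \<xi>|lborel. sobolev_weight s h \<xi>)"
  using assms sobolev_norm_eq by (auto simp: sobolev_def)

lemma sobolevI:
  "has_fourier u h \<Longrightarrow> integrable lborel (sobolev_weight s h) \<Longrightarrow> (\<And>\<psi>. \<psi> \<notin> schwartz \<Longrightarrow> u \<psi> = 0) \<Longrightarrow>
   u \<in> fst (sobolev s)"
  by (auto simp: sobolev_def)

lemma sobolev_norm_nonneg: "0 \<le> snd (sobolev s) u"
  by (auto simp: sobolev_def sobolev_weight_nonneg intro!: integral_nonneg_AE)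

lemma has_fourier_add_scaleR:
  fixes u w :: "('n::finite, 'm::finite) dist"
  assumes "has_fourier u h" "has_fourier w h'"
  shows "has_fourier (u + r *\<^sub>R w) (\<lambda>\<xi>. h \<xi> + r *\<^sub>R h' \<xi>)"
  unfolding has_fourier_def
proof (intro conjI allI impI)
  have [measurable]: "h \<in> borel_measurable borel" "h' \<in> borel_measurable borel"
    using assms by (auto simp: has_fourier_def)
  show "(\<lambda>\<xi>. h \<xi> + r *\<^sub>R h' \<xi>) \<in> borel_measurable lborel" by measurable
  fix \<psi> :: "real^'n \<Rightarrow> complex" and k :: 'm assume "\<psi> \<in> schwartz"
  with assms have i: "integrable lborel (\<lambda>\<xi>. \<psi> \<xi> * h \<xi> $ k)" "integrable lborel (\<lambda>\<xi>. \<psi> \<xi> * h' \<xi> $ k)"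
    and e: "(LINT \<xi>|lborel. \<psi> \<xi> * h \<xi> $ k) = Complex (u (\<lambda>x. Re (fourier \<psi> x)) $ k) (u (\<lambda>x. Im (fourier \<psi> x)) $ k)"
      "(LINT \<xi>|lborel. \<psi> \<xi> * h' \<xi> $ k) = Complex (w (\<lambda>x. Re (fourier \<psi> x)) $ k) (w (\<lambda>x. Im (fourier \<psi> x)) $ k)"
    by (auto simp: has_fourier_def)
  have eq: "(\<lambda>\<xi>. \<psi> \<xi> * (h \<xi> + r *\<^sub>R h' \<xi>) $ k) = (\<lambda>\<xi>. \<psi> \<xi> * h \<xi> $ k + r *\<^sub>R (\<psi> \<xi> * h' \<xi> $ k))"
    by (simp add: fun_eq_iff algebra_simps)
  have i': "integrable lborel (\<lambda>\<xi>. r *\<^sub>R (\<psi> \<xi> * h' \<xi> $ k))" using i(2) by (intro integrable_scaleR_right)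
  show "integrable lborel (\<lambda>\<xi>. \<psi> \<xi> * (h \<xi> + r *\<^sub>R h' \<xi>) $ k)"
    unfolding eq using i(1) i' by (rule Bochner_Integration.integrable_add)
  show "(LINT \<xi>|lborel. \<psi> \<xi> * (h \<xi> + r *\<^sub>R h' \<xi>) $ k) =
      Complex ((u + r *\<^sub>R w) (\<lambda>x. Re (fourier \<psi> x)) $ k) ((u + r *\<^sub>R w) (\<lambda>x. Im (fourier \<psi> x)) $ k)"
    unfolding eq Bochner_Integration.integral_add[OF i(1) i'] integral_scaleR_right e
    by (simp add: complex_eq_iff scaleR_fun_def)
qed

text \<open>The factor 2 comes from the pointwise inequality |a + b|^2 <= 2 |a|^2 + 2 |b|^2. A
  triangle inequality up to a constant suffices, as it only serves to show that certain linear maps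
  are bounded.\<close>

lemma sobolev_add_scaleR:
  fixes u w :: "('n::finite, 'm::finite) dist"
  assumes "u \<in> fst (sobolev s)" "w \<in> fst (sobolev s)"
  shows "u + r *\<^sub>R w \<in> fst (sobolev s)"
    "snd (sobolev s) (u + r *\<^sub>R w) \<le> 2 * (snd (sobolev s) u + \<bar>r\<bar> * snd (sobolev s) w)"
proof -
  obtain h where h: "has_fourier u h" "integrable lborel (sobolev_weight s h)"
    "snd (sobolev s) u = sqrt (LINT \<xi>|lborel. sobolev_weight s h \<xi>)" using assms(1) by (rule sobolevE)
  obtain h' where h': "has_fourier w h'" "integrable lborel (sobolev_weight s h')"
    "snd (sobolev s) w = sqrt (LINT \<xi>|lborel. sobolev_weight s h' \<xi>)" using assms(2) by (rule sobolevE)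
  let ?g = "\<lambda>\<xi>. h \<xi> + r *\<^sub>R h' \<xi>"
  note g = has_fourier_add_scaleR[OF h(1) h'(1), of r]
  have bound: "sobolev_weight s ?g \<xi> \<le> 2 * sobolev_weight s h \<xi> + 2 * r\<^sup>2 * sobolev_weight s h' \<xi>" for \<xi>
  proof -
    have "(norm (?g \<xi>))\<^sup>2 \<le> (norm (h \<xi>) + \<bar>r\<bar> * norm (h' \<xi>))\<^sup>2"
      by (intro power_mono order_trans[OF norm_triangle_ineq]) auto
    also have "\<dots> \<le> 2 * (norm (h \<xi>))\<^sup>2 + 2 * r\<^sup>2 * (norm (h' \<xi>))\<^sup>2"
      using zero_le_power2[of "norm (h \<xi>) - \<bar>r\<bar> * norm (h' \<xi>)"]
      by (simp add: power2_sum power2_diff power_mult_distrib)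
    finally have "(1 + (norm \<xi>)\<^sup>2) powr s * (norm (?g \<xi>))\<^sup>2
      \<le> (1 + (norm \<xi>)\<^sup>2) powr s * (2 * (norm (h \<xi>))\<^sup>2 + 2 * r\<^sup>2 * (norm (h' \<xi>))\<^sup>2)"
      by (rule mult_left_mono) simp
    then show ?thesis unfolding sobolev_weight_def by (simp add: algebra_simps)
  qed
  have bi: "integrable lborel (\<lambda>\<xi>. 2 * sobolev_weight s h \<xi> + 2 * r\<^sup>2 * sobolev_weight s h' \<xi>)"
    using h(2) h'(2) by (intro Bochner_Integration.integrable_add integrable_mult_right)
  have gm: "sobolev_weight s ?g \<in> borel_measurable lborel"
    using g by (intro sobolev_weight_measurable) (simp add: has_fourier_def)
  have gi: "integrable lborel (sobolev_weight s ?g)"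
    by (rule Bochner_Integration.integrable_bound[OF bi gm])
      (use bound sobolev_weight_nonneg[of s ?g] in \<open>auto intro: order_trans[OF _ abs_ge_self]\<close>)
  have "u \<psi> = 0" "w \<psi> = 0" if "\<psi> \<notin> schwartz" for \<psi> using assms that by (auto simp: sobolev_def)
  then show "u + r *\<^sub>R w \<in> fst (sobolev s)"
    by (intro sobolevI[OF g gi]) (simp add: scaleR_fun_def)
  let ?A = "LINT \<xi>|lborel. sobolev_weight s h \<xi>" and ?B = "LINT \<xi>|lborel. sobolev_weight s h' \<xi>"
  have AB: "0 \<le> ?A" "0 \<le> ?B" by (auto intro!: integral_nonneg_AE simp: sobolev_weight_nonneg)
  have "(LINT \<xi>|lborel. sobolev_weight s ?g \<xi>) \<le> (LINT \<xi>|lborel. 2 * sobolev_weight s h \<xi> + 2 * r\<^sup>2 * sobolev_weight s h' \<xi>)"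
    using gi bi bound by (rule integral_mono)
  also have "\<dots> = 2 * ?A + 2 * r\<^sup>2 * ?B" using h(2) h'(2) by simp
  also have "\<dots> \<le> (2 * (sqrt ?A + \<bar>r\<bar> * sqrt ?B))\<^sup>2"
  proof -
    have "(2 * (sqrt ?A + \<bar>r\<bar> * sqrt ?B))\<^sup>2 = 4 * ?A + 4 * r\<^sup>2 * ?B + 8 * (sqrt ?A * (\<bar>r\<bar> * sqrt ?B))"
      using AB by (simp add: power2_sum power_mult_distrib algebra_simps)
    moreover have "0 \<le> 8 * (sqrt ?A * (\<bar>r\<bar> * sqrt ?B))" using AB by simp
    moreover have "0 \<le> r\<^sup>2 * ?B" using AB by simp
    ultimately show ?thesis using AB(1) by linarith
  qed
  finally have "sqrt (LINT \<xi>|lborel. sobolev_weight s ?g \<xi>) \<le> 2 * (sqrt ?A + \<bar>r\<bar> * sqrt ?B)"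
    using AB by (intro real_le_lsqrt) auto
  then show "snd (sobolev s) (u + r *\<^sub>R w) \<le> 2 * (snd (sobolev s) u + \<bar>r\<bar> * snd (sobolev s) w)"
    unfolding sobolev_norm_eq[OF g] h(3) h'(3) .
qed

lemma has_fourier_0: "has_fourier (0 :: ('n::finite, 'm::finite) dist) (\<lambda>_. 0)"
  by (simp add: has_fourier_def complex_eq_iff)

lemma sobolev_0: "(0 :: ('n::finite, 'm::finite) dist) \<in> fst (sobolev s)"
  by (rule sobolevI[OF has_fourier_0]) (simp_all add: sobolev_weight_def[abs_def])

lemma sobolev_norm_0: "snd (sobolev s) (0 :: ('n::finite, 'm::finite) dist) = 0"
  unfolding sobolev_norm_eq[OF has_fourier_0] by (simp add: sobolev_weight_def[abs_def])

lemma sobolev_scaleR: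
  fixes u :: "('n::finite, 'm::finite) dist"
  assumes "u \<in> fst (sobolev s)"
  shows "r *\<^sub>R u \<in> fst (sobolev s)" "snd (sobolev s) (r *\<^sub>R u) = \<bar>r\<bar> * snd (sobolev s) u"
proof -
  show "r *\<^sub>R u \<in> fst (sobolev s)" using sobolev_add_scaleR(1)[OF sobolev_0 assms, of r] by simp
  obtain h where h: "has_fourier u h" "snd (sobolev s) u = sqrt (LINT \<xi>|lborel. sobolev_weight s h \<xi>)"
    using assms by (rule sobolevE)
  have "has_fourier (r *\<^sub>R u) (\<lambda>\<xi>. r *\<^sub>R h \<xi>)" using has_fourier_add_scaleR[OF has_fourier_0 h(1), of r] by simp
  from sobolev_norm_eq[OF this, of s]
  have "snd (sobolev s) (r *\<^sub>R u) = sqrt (LINT \<xi>|lborel. r\<^sup>2 * sobolev_weight s h \<xi>)"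
    by (simp add: sobolev_weight_def power_mult_distrib mult_ac)
  then show "snd (sobolev s) (r *\<^sub>R u) = \<bar>r\<bar> * snd (sobolev s) u"
    by (simp add: h(2) real_sqrt_mult)
qed

lemma sobolev_diff:
  fixes u w :: "('n::finite, 'm::finite) dist"
  assumes "u \<in> fst (sobolev s)" "w \<in> fst (sobolev s)"
  shows "u - w \<in> fst (sobolev s)" "snd (sobolev s) (u - w) \<le> 2 * (snd (sobolev s) u + snd (sobolev s) w)"
  using sobolev_add_scaleR[OF assms, of "-1"] by simp_all

section \<open>Weighted Cauchy-Schwarz and the pairing with test functions\<close>

lemma integral_Cauchy_Schwarz:
  fixes f g :: "'a \<Rightarrow> real"
  assumes f: "integrable M (\<lambda>x. (f x)\<^sup>2)" and g: "integrable M (\<lambda>x. (g x)\<^sup>2)"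
    and [measurable]: "f \<in> borel_measurable M" "g \<in> borel_measurable M"
  shows "integrable M (\<lambda>x. f x * g x)"
    "(LINT x|M. f x * g x) \<le> sqrt (LINT x|M. (f x)\<^sup>2) * sqrt (LINT x|M. (g x)\<^sup>2)"
proof -
  show i: "integrable M (\<lambda>x. f x * g x)"
  proof (rule Bochner_Integration.integrable_bound[OF Bochner_Integration.integrable_add[OF f g]])
    have "\<bar>f x * g x\<bar> \<le> (f x)\<^sup>2 + (g x)\<^sup>2" for x
    proof -
      have "2 * (\<bar>f x\<bar> * \<bar>g x\<bar>) \<le> (f x)\<^sup>2 + (g x)\<^sup>2"
        using sum_squares_bound[of "\<bar>f x\<bar>" "\<bar>g x\<bar>"] by (simp add: mult.assoc)
      moreover have "0 \<le> \<bar>f x\<bar> * \<bar>g x\<bar>" by simp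
      ultimately show ?thesis unfolding abs_mult by linarith
    qed
    then show "AE x in M. norm (f x * g x) \<le> norm ((f x)\<^sup>2 + (g x)\<^sup>2)" by simp
  qed simp
  define F G H where "F = (LINT x|M. (f x)\<^sup>2)" and "G = (LINT x|M. (g x)\<^sup>2)" and "H = (LINT x|M. f x * g x)"
  have q: "0 \<le> t\<^sup>2 * F - 2 * t * H + G" for t
  proof -
    have "0 \<le> (LINT x|M. (t * f x - g x)\<^sup>2)" by (intro integral_nonneg_AE) simp
    also have "\<dots> = (LINT x|M. t\<^sup>2 * (f x)\<^sup>2 - 2 * t * (f x * g x) + (g x)\<^sup>2)"
      by (intro Bochner_Integration.integral_cong) (simp_all add: power2_diff power_mult_distrib mult_ac)
    also have "\<dots> = t\<^sup>2 * F - 2 * t * H + G" using f g i by (simp add: F_def G_def H_def)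
    finally show ?thesis .
  qed
  have FG: "0 \<le> F" "0 \<le> G" by (auto simp: F_def G_def intro!: integral_nonneg_AE)
  have "H\<^sup>2 \<le> F * G"
  proof (cases "F = 0")
    case True
    have "H = 0"
    proof (rule ccontr)
      assume "H \<noteq> 0"
      \<comment> \<open>With F = 0 the quadratic is linear in t, and this t gives it the value
        -1.\<close>
      with q[of "(G + 1) / (2 * H)"] True show False by (simp add: field_simps)
    qed
    with FG show ?thesis by simp
  next
    case False
    then have "F > 0" using FG by simp
    then show ?thesis using q[of "H / F"] by (simp add: power2_eq_square field_simps)
  qed
  then have "\<bar>H\<bar> \<le> sqrt (F * G)" by (simp add: real_le_rsqrt)
  then show "(LINT x|M. f x * g x) \<le> sqrt (LINT x|M. (f x)\<^sup>2) * sqrt (LINT x|M. (g x)\<^sup>2)"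
    by (simp add: F_def G_def H_def real_sqrt_mult)
qed

lemma slow_growth_weight: "slow_growth (\<lambda>x::'a::real_normed_vector. (1 + (norm x)\<^sup>2) powr s)"
proof -
  obtain N :: nat where N: "s \<le> real N" using real_arch_simple by blast
  have "\<bar>(1 + (norm x)\<^sup>2) powr s\<bar> \<le> 1 * (1 + norm x) ^ (2 * N)" for x :: 'a
  proof -
    have "(1 + (norm x)\<^sup>2) powr s \<le> (1 + (norm x)\<^sup>2) powr (real N)"
      using N by (intro powr_mono) auto
    also have "\<dots> = (1 + (norm x)\<^sup>2) ^ N" by (intro powr_realpow) (auto intro: add_pos_nonneg)
    also have "\<dots> \<le> ((1 + norm x)\<^sup>2) ^ N" by (intro power_mono) (auto simp: power2_eq_square algebra_simps)
    finally show ?thesis by (simp add: power_mult)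
  qed
  then show ?thesis unfolding slow_growth_def by blast
qed

lemma schwartz_weight_integrable:
  fixes f :: "'a::euclidean_space \<Rightarrow> 'b::{banach, second_countable_topology}"
  assumes "f \<in> schwartz"
  shows "integrable lborel (\<lambda>x. (1 + (norm x)\<^sup>2) powr s * (norm (f x))\<^sup>2)"
proof (rule rapid_integrable)
  have [measurable]: "f \<in> borel_measurable borel" by (rule schwartz_measurable[OF assms])
  show "(\<lambda>x. (1 + (norm x)\<^sup>2) powr s * (norm (f x))\<^sup>2) \<in> borel_measurable borel" by measurable
  have r: "rapid (\<lambda>x. norm (f x))" by (rule schwartz_rapid[OF assms])
  then have "rapid (\<lambda>x. norm (f x) * norm (f x))"
    using decay_product_bdd_rapid rapid_imp_bdd unfolding decay_product_def by blast
  then have "rapid (\<lambda>x. (1 + (norm x)\<^sup>2) powr s * (norm (f x) * norm (f x)))"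
    using decay_product_slow_rapid slow_growth_weight unfolding decay_product_def by blast
  then show "rapid (\<lambda>x. norm ((1 + (norm x)\<^sup>2) powr s * (norm (f x))\<^sup>2))"
    by (simp add: power2_eq_square abs_mult)
qed

text \<open>The H^(-s) norm read on the Fourier side: \<open>\<psi>\<close> is a function of the
  frequency, and the test function paired with a distribution is the real part of
  \<open>fourier \<psi>\<close>.\<close>

definition dual_norm :: "real \<Rightarrow> (real^'n \<Rightarrow> complex) \<Rightarrow> real"
  where "dual_norm s \<psi> = sqrt (LINT \<xi>|lborel. (1 + (norm \<xi>)\<^sup>2) powr (- s) * (norm (\<psi> \<xi>))\<^sup>2)"

lemma dual_norm_nonneg: "0 \<le> dual_norm s \<psi>"
  by (auto simp: dual_norm_def intro!: integral_nonneg_AE)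

text \<open>Duality of H^s and H^(-s): Cauchy-Schwarz after splitting the weight into the powers s/2
  and -s/2. The factor \<open>CARD('m)\<close> comes from summing over the components.\<close>

lemma sobolev_test_bound:
  fixes u :: "('n::finite, 'm::finite) dist"
  assumes u: "u \<in> fst (sobolev s)" and \<psi>: "\<psi> \<in> schwartz"
  shows "norm (u (\<lambda>x. Re (fourier \<psi> x))) \<le> real CARD('m) * dual_norm s \<psi> * snd (sobolev s) u"
proof -
  obtain h where h: "has_fourier u h" "integrable lborel (sobolev_weight s h)"
    "snd (sobolev s) u = sqrt (LINT \<xi>|lborel. sobolev_weight s h \<xi>)" using u by (rule sobolevE)
  have [measurable]: "h \<in> borel_measurable borel" "\<psi> \<in> borel_measurable borel"
    using h(1) schwartz_measurable[OF \<psi>] by (auto simp: has_fourier_def)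
  define w where "w \<xi> = (1 + (norm \<xi>)\<^sup>2) powr (s / 2)" for \<xi> :: "real^'n"
  define w' where "w' \<xi> = (1 + (norm \<xi>)\<^sup>2) powr (- s / 2)" for \<xi> :: "real^'n"
  have pos: "1 + (norm \<xi>)\<^sup>2 > 0" for \<xi> :: "real^'n" by (auto intro: add_pos_nonneg)
  have [measurable]: "w \<in> borel_measurable borel" "w' \<in> borel_measurable borel"
    unfolding w_def[abs_def] w'_def[abs_def] by measurable
  have ww: "w' \<xi> * w \<xi> = 1" "(w \<xi>)\<^sup>2 = (1 + (norm \<xi>)\<^sup>2) powr s" "(w' \<xi>)\<^sup>2 = (1 + (norm \<xi>)\<^sup>2) powr (- s)" for \<xi>
    using pos[of \<xi>] by (simp_all add: w_def w'_def powr_add[symmetric] power2_eq_square)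
  have 1: "integrable lborel (\<lambda>\<xi>. (w' \<xi> * norm (\<psi> \<xi>))\<^sup>2)"
    using schwartz_weight_integrable[OF \<psi>, of "- s"] by (simp add: power_mult_distrib ww)
  have 2: "integrable lborel (\<lambda>\<xi>. (w \<xi> * norm (h \<xi>))\<^sup>2)"
    using h(2) by (simp add: power_mult_distrib ww sobolev_weight_def[abs_def])
  have eq: "(w' \<xi> * norm (\<psi> \<xi>)) * (w \<xi> * norm (h \<xi>)) = norm (\<psi> \<xi>) * norm (h \<xi>)" for \<xi>
    using ww(1)[of \<xi>] by (metis (no_types, opaque_lifting) mult.assoc mult.commute mult_1)
  have CS: "integrable lborel (\<lambda>\<xi>. norm (\<psi> \<xi>) * norm (h \<xi>))"
    "(LINT \<xi>|lborel. norm (\<psi> \<xi>) * norm (h \<xi>)) \<le> dual_norm s \<psi> * snd (sobolev s) u"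
    using integral_Cauchy_Schwarz[OF 1 2] unfolding eq
    by (simp_all add: dual_norm_def h(3) power_mult_distrib ww sobolev_weight_def)
  have k: "\<bar>u (\<lambda>x. Re (fourier \<psi> x)) $ k\<bar> \<le> dual_norm s \<psi> * snd (sobolev s) u" for k
  proof -
    have i: "integrable lborel (\<lambda>\<xi>. \<psi> \<xi> * h \<xi> $ k)"
      and e: "(LINT \<xi>|lborel. \<psi> \<xi> * h \<xi> $ k) = Complex (u (\<lambda>x. Re (fourier \<psi> x)) $ k) (u (\<lambda>x. Im (fourier \<psi> x)) $ k)"
      using h(1) \<psi> by (auto simp: has_fourier_def)
    have "\<bar>u (\<lambda>x. Re (fourier \<psi> x)) $ k\<bar> \<le> norm (LINT \<xi>|lborel. \<psi> \<xi> * h \<xi> $ k)"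
      unfolding e using abs_Re_le_cmod[of "Complex (u (\<lambda>x. Re (fourier \<psi> x)) $ k) (u (\<lambda>x. Im (fourier \<psi> x)) $ k)"] by simp
    also have "\<dots> \<le> (LINT \<xi>|lborel. norm (\<psi> \<xi>) * norm (h \<xi>))"
      by (rule Bochner_Integration.integral_norm_bound_integral[OF i CS(1)])
        (simp only: norm_mult, intro mult_left_mono Finite_Cartesian_Product.norm_nth_le norm_ge_zero)
    finally show ?thesis using CS(2) by linarith
  qed
  have "norm (u (\<lambda>x. Re (fourier \<psi> x))) \<le> (\<Sum>k\<in>UNIV. \<bar>u (\<lambda>x. Re (fourier \<psi> x)) $ k\<bar>)" by (rule norm_le_l1_cart)
  also have "\<dots> \<le> (\<Sum>k\<in>(UNIV::'m set). dual_norm s \<psi> * snd (sobolev s) u)" by (intro sum_mono k)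
  finally show ?thesis by simp
qed

lemma schwartz_vec_nth: "f \<in> schwartz \<Longrightarrow> (\<lambda>x. f x $ k) \<in> schwartz"
  by (rule schwartz_bounded_linear[OF bounded_linear_vec_nth])

text \<open>For a Schwartz function the distributional transform is the pointwise one, by
  \<open>fourier_mult_formula\<close>; real and imaginary parts of the test function separate
  because \<open>f\<close> is real.\<close>

lemma has_fourier_dist_of:
  fixes f :: "real^'n::finite \<Rightarrow> real^'m::finite"
  assumes f: "f \<in> schwartz"
  shows "has_fourier (dist_of f) (\<lambda>\<xi>. \<chi> k. fourier (\<lambda>x. complex_of_real (f x $ k)) \<xi>)"
  unfolding has_fourier_def
proof (intro conjI allI impI)
  have fk: "(\<lambda>x. complex_of_real (f x $ k)) \<in> schwartz" for k by (intro schwartz_of_real schwartz_vec_nth f)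
  note F = schwartz_fourier[OF fk]
  have "continuous_on UNIV (\<lambda>\<xi>. \<chi> k. fourier (\<lambda>x. complex_of_real (f x $ k)) \<xi>)"
    by (intro continuous_intros schwartz_continuous F)
  then show "(\<lambda>\<xi>. \<chi> k. fourier (\<lambda>x. complex_of_real (f x $ k)) \<xi>) \<in> borel_measurable lborel"
    by (simp add: borel_measurable_continuous_onI)
  fix \<psi> :: "real^'n \<Rightarrow> complex" and k :: 'm assume \<psi>: "\<psi> \<in> schwartz"
  note P = schwartz_fourier[OF \<psi>]
  have "(\<lambda>\<xi>. \<psi> \<xi> * fourier (\<lambda>x. complex_of_real (f x $ k)) \<xi>) \<in> schwartz"
    by (rule schwartz_bilinear[OF bounded_bilinear_mult \<psi> F])
  then show "integrable lborel (\<lambda>\<xi>. \<psi> \<xi> * (\<chi> k. fourier (\<lambda>x. complex_of_real (f x $ k)) \<xi>) $ k)"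
    by (simp add: schwartz_integrable)
  have R: "(\<lambda>x. Re (fourier \<psi> x)) \<in> schwartz" "(\<lambda>x. Im (fourier \<psi> x)) \<in> schwartz"
    by (rule schwartz_Re[OF P], rule schwartz_Im[OF P])
  have nth: "dist_of f \<theta> $ k = (LINT x|lborel. \<theta> x * f x $ k)" if "\<theta> \<in> schwartz" for \<theta>
  proof -
    have "integrable lborel (\<lambda>x. \<theta> x *\<^sub>R f x)"
      by (rule schwartz_integrable[OF schwartz_bilinear[OF bounded_bilinear_scaleR that f]])
    from integral_bounded_linear[OF bounded_linear_vec_nth this, of k] show ?thesis
      using that by (simp add: dist_of_def)
  qed
  have i: "integrable lborel (\<lambda>x. fourier \<psi> x * complex_of_real (f x $ k))"
    by (rule schwartz_integrable[OF schwartz_bilinear[OF bounded_bilinear_mult P fk]])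
  have "(LINT \<xi>|lborel. \<psi> \<xi> * fourier (\<lambda>x. complex_of_real (f x $ k)) \<xi>) = (LINT x|lborel. fourier \<psi> x * complex_of_real (f x $ k))"
    by (rule fourier_mult_formula[symmetric, OF schwartz_integrable[OF \<psi>] schwartz_integrable[OF fk]])
  also have "\<dots> = Complex (dist_of f (\<lambda>x. Re (fourier \<psi> x)) $ k) (dist_of f (\<lambda>x. Im (fourier \<psi> x)) $ k)"
    using i by (simp add: nth[OF R(1)] nth[OF R(2)] complex_eq_iff integral_Re[symmetric] integral_Im[symmetric] del: integral_Re integral_Im)
  finally show "(LINT \<xi>|lborel. \<psi> \<xi> * (\<chi> k. fourier (\<lambda>x. complex_of_real (f x $ k)) \<xi>) $ k) =
      Complex (dist_of f (\<lambda>x. Re (fourier \<psi> x)) $ k) (dist_of f (\<lambda>x. Im (fourier \<psi> x)) $ k)" by simp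
qed

lemma sobolev_dist_of:
  fixes f :: "real^'n::finite \<Rightarrow> real^'m::finite"
  assumes f: "f \<in> schwartz" shows "dist_of f \<in> fst (sobolev s)"
proof (rule sobolevI[OF has_fourier_dist_of[OF f]])
  have fk: "fourier (\<lambda>x. complex_of_real (f x $ k)) \<in> schwartz" for k
    by (intro schwartz_fourier schwartz_of_real schwartz_vec_nth f)
  have "sobolev_weight s (\<lambda>\<xi>. \<chi> k. fourier (\<lambda>x. complex_of_real (f x $ k)) \<xi>)
     = (\<lambda>\<xi>. \<Sum>k\<in>UNIV. (1 + (norm \<xi>)\<^sup>2) powr s * (norm (fourier (\<lambda>x. complex_of_real (f x $ k)) \<xi>))\<^sup>2)"
    by (simp add: sobolev_weight_def fun_eq_iff norm_vec_def L2_set_def sum_nonneg sum_distrib_left)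
  then show "integrable lborel (sobolev_weight s (\<lambda>\<xi>. \<chi> k. fourier (\<lambda>x. complex_of_real (f x $ k)) \<xi>))"
    by (simp add: schwartz_weight_integrable[OF fk])
qed (simp add: dist_of_def)

section \<open>Second derivatives along a line of data\<close>

text \<open>The operator norm is an infimum of admissible constants. Once some \<open>K\<close> is
  known, the infimum is over a nonempty set and is itself admissible.\<close>

lemma operator_norm_bound:
  assumes L: "\<And>x. x \<in> fst X \<Longrightarrow> snd Y (L x) \<le> K * snd X x"
    and nn: "\<And>x. 0 \<le> snd X x" and x: "x \<in> fst X"
  shows "snd Y (L x) \<le> snd (bounded_linear_maps X Y) L * snd X x"
proof (cases "snd X x = 0")
  case True
  then show ?thesis using L[OF x] by simp
next
  case False
  then have pos: "snd X x > 0" using nn[of x] by simp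
  let ?S = "{K. 0 \<le> K \<and> (\<forall>x\<in>fst X. snd Y (L x) \<le> K * snd X x)}"
  \<comment> \<open>\<open>K\<close> may be negative, while the set admits nonnegative constants
    only.\<close>
  have "snd Y (L y) \<le> \<bar>K\<bar> * snd X y" if "y \<in> fst X" for y
    using L[OF that] mult_right_mono[OF abs_ge_self[of K] nn[of y]] by linarith
  then have "\<bar>K\<bar> \<in> ?S" by simp
  then have "snd Y (L x) / snd X x \<le> Inf ?S"
  proof (intro cInf_greatest)
    show "?S \<noteq> {}" using \<open>\<bar>K\<bar> \<in> ?S\<close> by blast
  qed (use x pos in \<open>auto simp: divide_le_eq\<close>)
  then show ?thesis using pos by (simp add: bounded_linear_maps_def divide_le_eq)
qed

lemma has_derivative_from_estimate:
  fixes f :: "real \<Rightarrow> real"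
  assumes "\<And>e. e > 0 \<Longrightarrow> \<exists>d>0. \<forall>h. \<bar>h\<bar> < d \<longrightarrow> \<bar>f (x + h) - f x - h * m\<bar> \<le> e * (\<bar>h\<bar> * B)"
  shows "(f has_real_derivative m) (at x)"
  unfolding DERIV_def
proof (rule LIM_I)
  fix e :: real assume "e > 0"
  \<comment> \<open>The 2 produces the strict inequality required of a limit; the + 1 keeps the
    denominator positive when \<open>B\<close> is 0.\<close>
  define e' where "e' = e / (2 * (\<bar>B\<bar> + 1))"
  have e': "e' > 0" using \<open>e > 0\<close> unfolding e'_def by (intro divide_pos_pos) auto
  then obtain d where d: "d > 0" "\<And>h. \<bar>h\<bar> < d \<Longrightarrow> \<bar>f (x + h) - f x - h * m\<bar> \<le> e' * (\<bar>h\<bar> * B)"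
    using assms by blast
  have "\<bar>(f (x + h) - f x) / h - m\<bar> < e" if "h \<noteq> 0" "\<bar>h\<bar> < d" for h
  proof -
    have "\<bar>(f (x + h) - f x) / h - m\<bar> = \<bar>f (x + h) - f x - h * m\<bar> / \<bar>h\<bar>"
      using that by (simp add: field_simps flip: abs_divide)
    also have "\<dots> \<le> e' * B" using d(2)[OF that(2)] that(1) by (simp add: divide_le_eq mult_ac)
    also have "\<dots> \<le> e' * (\<bar>B\<bar> + 1)" using e' by (intro mult_left_mono) auto
    also have "\<dots> = e / 2"
    proof -
      have q: "e / (2 * b) * b = e / 2" if "b > 0" for b :: real using that by simp
      show ?thesis unfolding e'_def by (rule q) linarith
    qed
    also have "\<dots> < e" using \<open>e > 0\<close> by simp
    finally show ?thesis .
  qed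
  then show "\<exists>s>0. \<forall>h. h \<noteq> 0 \<and> norm (h - 0) < s \<longrightarrow> norm ((f (x + h) - f x) / h - m) < e"
    using d(1) by auto
qed

lemma sobolev_pair_scaleR:
  fixes w :: "('n::finite, 'm::finite) dist \<times> ('n, 'm) dist"
  assumes "w \<in> fst (sobolev_pair s)"
  shows "r *\<^sub>R w \<in> fst (sobolev_pair s)" "snd (sobolev_pair s) (r *\<^sub>R w) = \<bar>r\<bar> * snd (sobolev_pair s) w"
  using assms sobolev_scaleR[of "fst w" s r] sobolev_scaleR[of "snd w" "s - 1" r]
  by (auto simp: sobolev_pair_def split_beta algebra_simps mem_Times_iff)

lemma sobolev_pair_norm_nonneg: "0 \<le> snd (sobolev_pair s) w"
  by (auto simp: sobolev_pair_def split_beta intro!: add_nonneg_nonneg sobolev_norm_nonneg)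

text \<open>Evaluation at a test function followed by the inner product with c is continuous on
  \<open>Y\<close>, so composing it with \<open>F\<close> along the line gives an ordinary function
  \<open>J\<close>. Although \<open>F'\<close> and \<open>F2\<close> need not be unique, their
  values in the direction of the line are then forced to be the derivatives of \<open>J\<close>. The
  first derivative has to be identified at every point of the line, since it is differentiated
  again.\<close>

lemma second_derivative_along_line:
  fixes F :: "('n::finite, 'm::finite) dist \<times> ('n, 'm) dist \<Rightarrow> ('n, 'm) dist"
    and s :: real
  defines "X \<equiv> sobolev_pair s :: (('n, 'm) dist \<times> ('n, 'm) dist) normed_space"
    and "Y \<equiv> sobolev s :: (('n, 'm) dist) normed_space"
  assumes d1: "\<And>p. p \<in> D \<Longrightarrow> frechet_deriv_within X Y F (F' p) p D"
    and d2: "frechet_deriv_within X (bounded_linear_maps X Y) F' F2 (p 0) D"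
    and path: "\<And>e. p e \<in> D" "\<And>e e'. p e - p e' = (e - e') *\<^sub>R w" "w \<in> fst X"
    and \<psi>: "\<psi> \<in> schwartz"
    and J: "\<And>e. J e = F (p e) (\<lambda>x. Re (fourier \<psi> x)) \<bullet> c"
    and J': "\<And>e. (J has_real_derivative J' e) (at e)"
    and J'': "(J' has_real_derivative j) (at 0)"
  shows "F2 w w (\<lambda>x. Re (fourier \<psi> x)) \<bullet> c = j"
proof -
  define \<theta> where "\<theta> = (\<lambda>x. Re (fourier \<psi> x))"
  define A where "A = real CARD('m) * dual_norm s \<psi> * norm c"
  define W where "W = snd X w"
  have A0: "A \<ge> 0" by (auto simp: A_def dual_norm_nonneg)
  have W0: "W \<ge> 0" by (simp add: W_def X_def sobolev_pair_norm_nonneg)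
  have test: "\<bar>y \<theta> \<bullet> c\<bar> \<le> A * snd Y y" if "y \<in> fst Y" for y
  proof -
    have "\<bar>y \<theta> \<bullet> c\<bar> \<le> norm (y \<theta>) * norm c" by (rule Cauchy_Schwarz_ineq2)
    also have "\<dots> \<le> (real CARD('m) * dual_norm s \<psi> * snd Y y) * norm c"
      using sobolev_test_bound[OF _ \<psi>, of y s] that by (intro mult_right_mono) (auto simp: Y_def \<theta>_def)
    finally show ?thesis by (simp add: A_def mult_ac)
  qed
  have Yc: "a - r *\<^sub>R b \<in> fst Y" if "a \<in> fst Y" "b \<in> fst Y" for a b r
    using sobolev_add_scaleR(1)[of a s b "- r"] that by (simp add: Y_def)
  have Xw: "snd X (r *\<^sub>R w) = \<bar>r\<bar> * W" "r *\<^sub>R w \<in> fst X" for r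
    using sobolev_pair_scaleR[of w s r] path(3) by (auto simp: X_def W_def)
  have BL: "L (r *\<^sub>R x) = r *\<^sub>R L x" "L x \<in> fst Z" if "L \<in> fst (bounded_linear_maps X Z)" "x \<in> fst X"
    for L x r and Z :: "'w::real_vector normed_space"
    using that by (auto simp: bounded_linear_maps_def)
  have ev: "(a - b - r *\<^sub>R d) \<theta> \<bullet> c = a \<theta> \<bullet> c - b \<theta> \<bullet> c - r * (d \<theta> \<bullet> c)" for a b d :: "('n, 'm) dist" and r
    by (simp add: scaleR_fun_def inner_diff_left)
  have L: "F' (p e) \<in> fst (bounded_linear_maps X Y)" for e
    using d1[OF path(1)] by (auto simp: frechet_deriv_within_def)
  have L2: "F2 \<in> fst (bounded_linear_maps X (bounded_linear_maps X Y))"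
    using d2 by (auto simp: frechet_deriv_within_def)
  have F2w: "F2 (r *\<^sub>R w) = r *\<^sub>R F2 w" "F2 w \<in> fst (bounded_linear_maps X Y)" for r
    using BL[OF L2 path(3)] by auto
  have p0: "p (e + h) - p e = h *\<^sub>R w" for e h using path(2)[of "e + h" e] by simp
  have first: "F' (p e) w \<theta> \<bullet> c = J' e" for e
  proof -
    have "(J has_real_derivative F' (p e) w \<theta> \<bullet> c) (at e)"
    proof (rule has_derivative_from_estimate[where B="A * W"])
      fix r :: real assume "r > 0"
      then obtain d where d: "d > 0" "\<And>q. q \<in> D \<Longrightarrow> snd X (q - p e) < d \<Longrightarrow>
          snd Y (F q - F (p e) - F' (p e) (q - p e)) \<le> r * snd X (q - p e)"
        using d1[OF path(1)[of e]] unfolding frechet_deriv_within_def by blast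
      show "\<exists>d>0. \<forall>h. \<bar>h\<bar> < d \<longrightarrow> \<bar>J (e + h) - J e - h * (F' (p e) w \<theta> \<bullet> c)\<bar> \<le> r * (\<bar>h\<bar> * (A * W))"
      proof (intro exI conjI allI impI)
        \<comment> \<open>The denominator is W + 1 because the norm \<open>W\<close> of the
          direction may be 0.\<close>
        show "d / (W + 1) > 0" using d(1) W0 by simp
        fix h assume h: "\<bar>h\<bar> < d / (W + 1)"
        have "\<bar>h\<bar> * W \<le> \<bar>h\<bar> * (W + 1)" by (intro mult_left_mono) auto
        also have "\<dots> < d" using h W0 by (simp add: pos_less_divide_eq)
        finally have s: "snd X (p (e + h) - p e) < d" by (simp add: p0 Xw)
        have m: "F (p (e + h)) - F (p e) \<in> fst Y"
          using d1[OF path(1)[of e]] path(1) unfolding frechet_deriv_within_def by blast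
        have "J (e + h) - J e - h * (F' (p e) w \<theta> \<bullet> c) = (F (p (e + h)) - F (p e) - h *\<^sub>R F' (p e) w) \<theta> \<bullet> c"
          unfolding ev by (simp add: J \<theta>_def)
        also have "\<bar>\<dots>\<bar> \<le> A * snd Y (F (p (e + h)) - F (p e) - h *\<^sub>R F' (p e) w)"
          using m BL(2)[OF L path(3)] by (intro test Yc)
        also have "\<dots> \<le> A * (r * (\<bar>h\<bar> * W))"
          using d(2)[OF path(1) s] BL(1)[OF L path(3)] A0 by (intro mult_left_mono) (auto simp: p0 Xw)
        finally show "\<bar>J (e + h) - J e - h * (F' (p e) w \<theta> \<bullet> c)\<bar> \<le> r * (\<bar>h\<bar> * (A * W))"
          by (simp add: mult_ac)
      qed
    qed
    then show ?thesis using J' DERIV_unique by blast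
  qed
  have bd: "\<exists>K. \<forall>x\<in>fst X. snd Y (N x) \<le> K * snd X x" if "N \<in> fst (bounded_linear_maps X Y)" for N
    using that unfolding bounded_linear_maps_def fst_conv mem_Collect_eq by blast
  \<comment> \<open>The estimate for the second derivative holds in operator norm. Applied to w and
    tested, it differentiates e |-> \<open>F' (p e) w \<theta> \<bullet> c\<close>, which is
    \<open>J'\<close> by the identity \<open>first\<close>.\<close>
  have "(J' has_real_derivative F2 w w \<theta> \<bullet> c) (at 0)"
  proof (rule has_derivative_from_estimate[where B="A * W * W"])
    fix r :: real assume "r > 0"
    then obtain d where d: "d > 0" "\<And>q. q \<in> D \<Longrightarrow> snd X (q - p 0) < d \<Longrightarrow>
        snd (bounded_linear_maps X Y) (F' q - F' (p 0) - F2 (q - p 0)) \<le> r * snd X (q - p 0)"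
      using d2 unfolding frechet_deriv_within_def by blast
    show "\<exists>d>0. \<forall>h. \<bar>h\<bar> < d \<longrightarrow> \<bar>J' (0 + h) - J' 0 - h * (F2 w w \<theta> \<bullet> c)\<bar> \<le> r * (\<bar>h\<bar> * (A * W * W))"
    proof (intro exI conjI allI impI)
      show "d / (W + 1) > 0" using d(1) W0 by simp
      fix h assume h: "\<bar>h\<bar> < d / (W + 1)"
      have "\<bar>h\<bar> * W \<le> \<bar>h\<bar> * (W + 1)" by (intro mult_left_mono) auto
      also have "\<dots> < d" using h W0 by (simp add: pos_less_divide_eq)
      finally have s: "snd X (p h - p 0) < d" using p0[of 0 h] by (simp add: Xw)
      define N where "N = F' (p h) - F' (p 0) - h *\<^sub>R F2 w"
      have Ns: "snd (bounded_linear_maps X Y) N \<le> r * (\<bar>h\<bar> * W)"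
        using d(2)[OF path(1) s] p0[of 0 h] by (simp add: N_def F2w Xw)
      \<comment> \<open>Any bound for \<open>N\<close> will do: it only makes
        \<open>operator_norm_bound\<close> applicable, while the small constant comes from
        \<open>Ns\<close>.\<close>
      obtain K1 K2 K3 where K: "\<And>x. x \<in> fst X \<Longrightarrow> snd Y (F' (p h) x) \<le> K1 * snd X x"
        "\<And>x. x \<in> fst X \<Longrightarrow> snd Y (F' (p 0) x) \<le> K2 * snd X x"
        "\<And>x. x \<in> fst X \<Longrightarrow> snd Y (F2 w x) \<le> K3 * snd X x"
        using bd[OF L[of h]] bd[OF L[of 0]] bd[OF F2w(2)] by blast
      have Nx: "N x = F' (p h) x - F' (p 0) x - h *\<^sub>R F2 w x" for x by (simp add: N_def scaleR_fun_def)
      have NY: "N x \<in> fst Y" if "x \<in> fst X" for x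
        unfolding Nx using BL(2)[OF L that] BL(2)[OF F2w(2) that] Yc[of _ _ 1] by (intro Yc) auto
      have "snd Y (N x) \<le> (4 * (K1 + K2) + 2 * \<bar>h\<bar> * K3) * snd X x" if x: "x \<in> fst X" for x
      proof -
        have m: "F' (p h) x \<in> fst Y" "F' (p 0) x \<in> fst Y" "F2 w x \<in> fst Y"
          using BL(2)[OF L x] BL(2)[OF F2w(2) x] by auto
        have "snd Y (N x) \<le> 2 * (snd Y (F' (p h) x - F' (p 0) x) + \<bar>h\<bar> * snd Y (F2 w x))"
          using sobolev_add_scaleR(2)[of "F' (p h) x - F' (p 0) x" s "F2 w x" "- h"] m Yc[of _ _ 1]
          by (simp add: Nx Y_def)
        also have "snd Y (F' (p h) x - F' (p 0) x) \<le> 2 * (snd Y (F' (p h) x) + snd Y (F' (p 0) x))"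
          using sobolev_diff(2) m by (simp add: Y_def)
        finally have "snd Y (N x) \<le> 4 * (snd Y (F' (p h) x) + snd Y (F' (p 0) x)) + 2 * (\<bar>h\<bar> * snd Y (F2 w x))"
          by simp
        moreover have "\<bar>h\<bar> * snd Y (F2 w x) \<le> \<bar>h\<bar> * (K3 * snd X x)" by (intro mult_left_mono K x) simp
        ultimately show ?thesis using K(1)[OF x] K(2)[OF x] by (simp add: algebra_simps)
      qed
      from operator_norm_bound[OF this _ path(3)]
      have "snd Y (N w) \<le> snd (bounded_linear_maps X Y) N * W"
        by (simp add: X_def sobolev_pair_norm_nonneg W_def)
      also have "\<dots> \<le> r * (\<bar>h\<bar> * W) * W" using Ns W0 by (rule mult_right_mono)
      finally have NW: "snd Y (N w) \<le> r * (\<bar>h\<bar> * W) * W" .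
      have "J' (0 + h) - J' 0 - h * (F2 w w \<theta> \<bullet> c) = N w \<theta> \<bullet> c"
        unfolding Nx ev by (simp add: first)
      also have "\<bar>\<dots>\<bar> \<le> A * snd Y (N w)" by (intro test NY path)
      also have "\<dots> \<le> A * (r * (\<bar>h\<bar> * W) * W)" using NW A0 by (rule mult_left_mono)
      finally show "\<bar>J' (0 + h) - J' 0 - h * (F2 w w \<theta> \<bullet> c)\<bar> \<le> r * (\<bar>h\<bar> * (A * W * W))"
        by (simp add: mult_ac)
    qed
  qed
  then show ?thesis using J'' DERIV_unique unfolding \<theta>_def by blast
qed

text \<open>The norm inequality for operators is used twice, once for \<open>F2\<close> and once for
  \<open>F2 w\<close>, with both arguments equal to w.\<close>

lemma second_derivative_bounded:
  fixes s :: real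
  defines "X \<equiv> sobolev_pair s :: (('n::finite, 'm::finite) dist \<times> ('n, 'm) dist) normed_space"
    and "Y \<equiv> sobolev s :: (('n, 'm) dist) normed_space"
  assumes "F2 \<in> fst (bounded_linear_maps X (bounded_linear_maps X Y))"
  obtains K where "\<And>w. w \<in> fst X \<Longrightarrow> F2 w w \<in> fst Y" "\<And>w. w \<in> fst X \<Longrightarrow> snd Y (F2 w w) \<le> K * (snd X w)\<^sup>2"
proof -
  obtain K where K: "\<And>x. x \<in> fst X \<Longrightarrow> snd (bounded_linear_maps X Y) (F2 x) \<le> K * snd X x"
    and L: "\<And>x. x \<in> fst X \<Longrightarrow> F2 x \<in> fst (bounded_linear_maps X Y)"
    using assms(3) unfolding bounded_linear_maps_def[of X "bounded_linear_maps X Y"] fst_conv mem_Collect_eq by blast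
  have "snd Y (F2 w w) \<le> K * (snd X w)\<^sup>2" if w: "w \<in> fst X" for w
  proof -
    obtain K' where "\<And>x. x \<in> fst X \<Longrightarrow> snd Y (F2 w x) \<le> K' * snd X x"
      using L[OF w] unfolding bounded_linear_maps_def fst_conv mem_Collect_eq by blast
    then have "snd Y (F2 w w) \<le> snd (bounded_linear_maps X Y) (F2 w) * snd X w"
      by (rule operator_norm_bound[OF _ _ w]) (auto simp: X_def sobolev_pair_norm_nonneg)
    also have "\<dots> \<le> (K * snd X w) * snd X w"
      by (intro mult_right_mono K w) (simp add: X_def sobolev_pair_norm_nonneg)
    finally show ?thesis by (simp add: power2_eq_square mult_ac)
  qed
  moreover have "F2 w w \<in> fst Y" if "w \<in> fst X" for w
    using L[OF that] that by (auto simp: bounded_linear_maps_def)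
  ultimately show ?thesis using that by blast
qed

section \<open>Logarithmic estimates\<close>

text \<open>It vanishes on the closed unit ball, away from which |xi| and its inverse powers are
  smooth, and outside the ball of radius R.\<close>

definition cutoff :: "real \<Rightarrow> 'a::euclidean_space \<Rightarrow> real"
  where "cutoff R \<xi> = flat 1 ((norm \<xi>)\<^sup>2 - 1) * bump R \<xi>"

text \<open>The sine is the adjoint factor at the observation time: it is paired with the sin (t
  |xi|) of the evolution and makes the transform nonnegative at t = T.\<close>

definition amp :: "real \<Rightarrow> real \<Rightarrow> 'a::euclidean_space \<Rightarrow> real"
  where "amp R T \<xi> = cutoff R \<xi> * (inverse (norm \<xi>) ^ DIM('a) * sin (T * norm \<xi>))"

lemma cutoff_bounds: "0 \<le> cutoff R \<xi>" "cutoff R \<xi> \<le> 1"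
  by (auto simp: cutoff_def flat_1_nonneg flat_1_le_1 bump_nonneg bump_le_1 intro!: mult_le_one)

lemma cutoff_eq_0: "norm \<xi> \<le> 1 \<Longrightarrow> cutoff R \<xi> = 0"
  using power_mono[of "norm \<xi>" 1 2] by (simp add: cutoff_def flat_1)

text \<open>Off the origin the product is smooth by assumption, on the open unit ball it is
  identically 0, and these two open sets cover the space.\<close>

lemma cutoff_schwartz:
  fixes k :: "'a::euclidean_space \<Rightarrow> complex"
  assumes k: "\<And>j. smooth_upto (- {0}) j k" and R: "R > 0"
  shows "(\<lambda>\<xi>. of_real (cutoff R \<xi>) * k \<xi>) \<in> schwartz"
proof (rule schwartz_compact_support)
  fix j
  have o: "open (- {0::'a})" by auto
  have "smooth_upto (- {0}) j (\<lambda>\<xi>::'a. (norm \<xi>)\<^sup>2 + (- 1))"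
    by (rule smooth_upto_add[OF o smooth_upto_norm_sq[OF o] smooth_upto_const[OF o]])
  from smooth_upto_flat[OF o this, of 1]
  have 1: "smooth_upto (- {0}) j (\<lambda>\<xi>::'a. flat 1 ((norm \<xi>)\<^sup>2 - 1))" by simp
  have 2: "smooth_upto (- {0}) j (bump R :: 'a \<Rightarrow> real)"
    by (rule smooth_upto_subset[OF smooth_upto_bump]) auto
  have 3: "smooth_upto (- {0}) j (\<lambda>\<xi>::'a. complex_of_real (cutoff R \<xi>))"
    unfolding cutoff_def by (rule smooth_upto_bounded_linear[OF o bounded_linear_of_real smooth_upto_mult[OF o 1 2]])
  have A: "smooth_upto (- {0}) j (\<lambda>\<xi>. of_real (cutoff R \<xi>) * k \<xi>)"
    by (rule smooth_upto_mult[OF o 3 k])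
  have B: "smooth_upto (ball 0 1) j (\<lambda>\<xi>. of_real (cutoff R \<xi>) * k \<xi>)"
    by (rule ders_cong[OF open_ball _ smooth_upto_const[OF open_ball, of _ _ _ 0]]) (simp add: cutoff_eq_0)
  have "- {0} \<union> ball 0 1 = (UNIV :: 'a set)" by auto
  with smooth_upto_Un[OF A B] show "smooth_upto UNIV j (\<lambda>\<xi>. of_real (cutoff R \<xi>) * k \<xi>)" by simp
next
  show "of_real (cutoff R \<xi>) * k \<xi> = 0" if "norm \<xi> > R" for \<xi>
    using R that by (simp add: cutoff_def bump_eq_0)
qed

text \<open>Each doubling of the radius adds at most a fixed amount: beyond 2^J the weight is at
  most 2^(-J n), while the ball of radius 2^(J+1) has 2^((J+1) n) times the volume of the unit ball.
  So the integral grows at most logarithmically in the radius.\<close>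

lemma integral_weight_cball_le:
  "integrable lborel (\<lambda>\<xi>::'a::euclidean_space. (1 + (norm \<xi>)\<^sup>2) powr (- (DIM('a) / 2)) * indicator (cball 0 (2 ^ J)) \<xi>) \<and>
   (LINT \<xi>::'a|lborel. (1 + (norm \<xi>)\<^sup>2) powr (- (DIM('a) / 2)) * indicator (cball 0 (2 ^ J)) \<xi>)
     \<le> unit_ball_vol (real DIM('a)) * (1 + real J * 2 ^ DIM('a))"
proof -
  let ?w = "\<lambda>\<xi>::'a. (1 + (norm \<xi>)\<^sup>2) powr (- (DIM('a) / 2))"
  let ?i = "\<lambda>J \<xi>::'a. indicat_real (cball 0 (2 ^ J)) \<xi>"
  have w1: "?w \<xi> \<le> 1" for \<xi> :: 'a
    using powr_mono2'[of "- (DIM('a) / 2)" 1 "1 + (norm \<xi>)\<^sup>2"] by simp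
  have wm: "?w \<in> borel_measurable borel" by measurable
  have ii: "integrable lborel (?i J)" for J
    by (rule integrable_real_indicator) (use emeasure_lborel_cball_finite[of "0::'a" "2 ^ J"] in auto)
  have im: "(LINT \<xi>|lborel. ?i J \<xi>) = unit_ball_vol (real DIM('a)) * (2 ^ J) ^ DIM('a)" for J
    by (simp add: content_cball)
  have wi: "integrable lborel (\<lambda>\<xi>. ?w \<xi> * ?i J \<xi>)" for J
    by (rule Bochner_Integration.integrable_bound[OF ii[of J]]) (use w1 in \<open>auto simp: indicator_def\<close>)
  have "(LINT \<xi>|lborel. ?w \<xi> * ?i J \<xi>) \<le> unit_ball_vol (real DIM('a)) * (1 + real J * 2 ^ DIM('a))"
  proof (induction J)
    case 0
    have "(LINT \<xi>|lborel. ?w \<xi> * ?i 0 \<xi>) \<le> (LINT \<xi>|lborel. ?i 0 \<xi>)"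
      using w1 by (intro integral_mono wi ii) (auto simp: indicator_def)
    then show ?case using im[of 0] by simp
  next
    case (Suc J)
    have le: "?w \<xi> * ?i (Suc J) \<xi> \<le> ?w \<xi> * ?i J \<xi> + inverse ((2 ^ J) ^ DIM('a)) * ?i (Suc J) \<xi>" for \<xi>
    proof (cases "norm \<xi> \<le> 2 ^ J")
      case True
      then show ?thesis by (auto simp: indicator_def)
    next
      case False
      then have "(2 ^ J)\<^sup>2 \<le> (norm \<xi>)\<^sup>2" by (intro power_mono) auto
      then have "?w \<xi> \<le> ((2 ^ J)\<^sup>2) powr (- (DIM('a) / 2))"
        by (intro powr_mono2') (auto intro: add_increasing)
      also have "\<dots> = (2 ^ J) powr (- real DIM('a))"
        by (simp add: powr_realpow[symmetric] powr_powr)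
      also have "\<dots> = inverse ((2 ^ J) ^ DIM('a))" by (simp add: powr_minus powr_realpow)
      finally show ?thesis using False by (auto simp: indicator_def)
    qed
    have "(LINT \<xi>|lborel. ?w \<xi> * ?i (Suc J) \<xi>) \<le> (LINT \<xi>|lborel. ?w \<xi> * ?i J \<xi> + inverse ((2 ^ J) ^ DIM('a)) * ?i (Suc J) \<xi>)"
      by (intro integral_mono wi le Bochner_Integration.integrable_add integrable_mult_right ii)
    also have "\<dots> = (LINT \<xi>|lborel. ?w \<xi> * ?i J \<xi>) + inverse ((2 ^ J) ^ DIM('a)) * (unit_ball_vol (real DIM('a)) * (2 ^ Suc J) ^ DIM('a))"
      using wi[of J] ii[of "Suc J"] im[of "Suc J"] by simp
    also have "inverse ((2 ^ J) ^ DIM('a)) * (unit_ball_vol (real DIM('a)) * (2 ^ Suc J) ^ DIM('a)) = unit_ball_vol (real DIM('a)) * 2 ^ DIM('a)"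
      by (simp add: power_mult_distrib)
    finally show ?case using Suc by (simp add: algebra_simps)
  qed
  with wi show ?thesis by blast
qed

lemma dual_norm_bump_le:
  fixes r :: real
  assumes "0 < r" "r \<le> 2 ^ J"
  shows "dual_norm (real CARD('n::finite) / 2) (\<lambda>\<xi>::real^'n. complex_of_real (bump r \<xi>))
     \<le> sqrt (unit_ball_vol (real CARD('n)) * (1 + real J * 2 ^ CARD('n)))"
  unfolding dual_norm_def
proof (rule real_sqrt_le_mono)
  have B: "complex_of_real \<circ> bump r \<in> (schwartz :: (real^'n \<Rightarrow> complex) set)"
    using schwartz_of_real[OF schwartz_bump[OF assms(1)]] by (simp add: o_def)
  have "(LINT \<xi>::real^'n|lborel. (1 + (norm \<xi>)\<^sup>2) powr - (real CARD('n) / 2) * (norm (complex_of_real (bump r \<xi>)))\<^sup>2)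
    \<le> (LINT \<xi>::real^'n|lborel. (1 + (norm \<xi>)\<^sup>2) powr (- (DIM(real^'n) / 2)) * indicator (cball 0 (2 ^ J)) \<xi>)"
  proof (rule integral_mono)
    show "integrable lborel (\<lambda>\<xi>::real^'n. (1 + (norm \<xi>)\<^sup>2) powr - (real CARD('n) / 2) * (norm (complex_of_real (bump r \<xi>)))\<^sup>2)"
      using schwartz_weight_integrable[OF B] by simp
    show "integrable lborel (\<lambda>\<xi>::real^'n. (1 + (norm \<xi>)\<^sup>2) powr (- (DIM(real^'n) / 2)) * indicator (cball 0 (2 ^ J)) \<xi>)"
      using integral_weight_cball_le by blast
    fix \<xi> :: "real^'n"
    have "(bump r \<xi>)\<^sup>2 \<le> indicator (cball 0 (2 ^ J)) \<xi>"
      using bump_eq_0[of r \<xi>] assms bump_nonneg[of r \<xi>] bump_le_1[of r \<xi>]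
      by (cases "norm \<xi> \<le> 2 ^ J") (auto simp: power_le_one)
    then show "(1 + (norm \<xi>)\<^sup>2) powr - (real CARD('n) / 2) * (norm (complex_of_real (bump r \<xi>)))\<^sup>2
        \<le> (1 + (norm \<xi>)\<^sup>2) powr (- (DIM(real^'n) / 2)) * indicator (cball 0 (2 ^ J)) \<xi>"
      by (simp add: mult_left_mono)
  qed
  also have "\<dots> \<le> unit_ball_vol (real DIM(real^'n)) * (1 + real J * 2 ^ DIM(real^'n))"
    using integral_weight_cball_le by blast
  finally show "(LINT \<xi>::real^'n|lborel. (1 + (norm \<xi>)\<^sup>2) powr - (real CARD('n) / 2) * (norm (complex_of_real (bump r \<xi>)))\<^sup>2)
    \<le> unit_ball_vol (real CARD('n)) * (1 + real J * 2 ^ CARD('n))" by simp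
qed

text \<open>The region where T |xi| stays at distance at least pi/4 from the multiples of pi, within
  the k-th period of the squared sine.\<close>

definition annulus :: "real \<Rightarrow> nat \<Rightarrow> 'a::euclidean_space set"
  where "annulus T k = ball 0 ((real k + 3 / 4) * pi / T) - ball 0 ((real k + 1 / 4) * pi / T)"

lemma in_annulus:
  "\<xi> \<in> annulus T k \<longleftrightarrow> (real k + 1 / 4) * pi / T \<le> norm \<xi> \<and> norm \<xi> < (real k + 3 / 4) * pi / T"
  by (auto simp: annulus_def)

lemma sin_squared_annulus:
  assumes "T > 0" "\<xi> \<in> annulus T k" shows "1 / 2 \<le> (sin (T * norm \<xi>))\<^sup>2"
proof -
  \<comment> \<open>Doubling the angle and centring it at the middle of the period puts y into
    [-pi/2, pi/2], where the cosine is nonnegative; cos (2 T |xi|) = - cos y then bounds the squared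
    sine below by 1/2.\<close>
  define y where "y = 2 * (T * norm \<xi>) - 2 * pi * real k - pi"
  have "(real k + 1 / 4) * pi \<le> T * norm \<xi>" "T * norm \<xi> < (real k + 3 / 4) * pi"
    using assms by (auto simp: in_annulus field_simps)
  then have "- (pi / 2) \<le> y" "y \<le> pi / 2" by (auto simp: y_def algebra_simps)
  then have "0 \<le> cos y" by (rule cos_ge_zero)
  moreover have "cos (2 * (T * norm \<xi>)) = - cos y"
  proof -
    have "2 * (T * norm \<xi>) = (y + pi) + 2 * pi * real k" by (simp add: y_def)
    moreover have "cos ((y + pi) + 2 * pi * real k) = cos (y + pi)"
      using cos_add[of "y + pi" "2 * pi * real k"] cos_2npi[of k] sin_2npi[of k] by (simp add: mult_ac)
    ultimately show ?thesis by simp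
  qed
  moreover have "cos (2 * (T * norm \<xi>)) = 1 - 2 * (sin (T * norm \<xi>))\<^sup>2" by (rule cos_double_sin)
  ultimately show ?thesis by linarith
qed

text \<open>With n the dimension, s^n - r^n >= (s - r) r^(n-1) for the outer radius s and the inner
  radius r. Here s - r = pi / (2 T), and r is at least k pi / T.\<close>

lemma measure_annulus_ge:
  assumes "T > 0"
  shows "measure lborel (annulus T k :: 'a::euclidean_space set)
    \<ge> unit_ball_vol (real DIM('a)) * (pi / (2 * T)) * (real k * pi / T) ^ (DIM('a) - 1)"
    and "(annulus T k :: 'a set) \<in> sets lborel" "emeasure lborel (annulus T k :: 'a set) < \<infinity>"
proof -
  define r where "r = (real k + 1 / 4) * pi / T"
  define s where "s = (real k + 3 / 4) * pi / T"
  obtain d where d: "DIM('a) = Suc d" using DIM_positive[where 'a='a] gr0_implies_Suc by blast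
  have rs: "0 \<le> real k * pi / T" "real k * pi / T \<le> r" "r \<le> s" "s - r = pi / (2 * T)" "0 \<le> r"
    using assms by (auto simp: r_def s_def field_simps)
  show "(annulus T k :: 'a set) \<in> sets lborel" by (simp add: annulus_def)
  have "emeasure lborel (annulus T k :: 'a set) \<le> emeasure lborel (ball (0::'a) s)"
    by (rule emeasure_mono) (auto simp: annulus_def s_def)
  also have "\<dots> < \<infinity>" by (rule emeasure_lborel_ball_finite)
  finally show "emeasure lborel (annulus T k :: 'a set) < \<infinity>" .
  have "measure lborel (annulus T k :: 'a set) = measure lborel (ball (0::'a) s) - measure lborel (ball (0::'a) r)"
    unfolding annulus_def s_def[symmetric] r_def[symmetric]
    by (rule measure_Diff) (use rs emeasure_lborel_ball_finite[of "0::'a" s] in \<open>auto simp: less_top subset_ball\<close>)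
  also have "\<dots> = unit_ball_vol (real DIM('a)) * (s ^ DIM('a) - r ^ DIM('a))"
    using rs content_ball[of s "0::'a"] content_ball[of r "0::'a"] by (simp add: algebra_simps)
  also have "\<dots> \<ge> unit_ball_vol (real DIM('a)) * ((pi / (2 * T)) * (real k * pi / T) ^ (DIM('a) - 1))"
  proof (rule mult_left_mono)
    have "(s - r) * (real k * pi / T) ^ d \<le> (s - r) * r ^ d" using rs by (intro mult_left_mono power_mono) auto
    also have "\<dots> \<le> s * s ^ d - r * r ^ d"
      using mult_left_mono[OF power_mono[OF rs(3), of d], of s] rs by (simp add: algebra_simps)
    finally show "(pi / (2 * T)) * (real k * pi / T) ^ (DIM('a) - 1) \<le> s ^ DIM('a) - r ^ DIM('a)"
      using rs(4) by (simp add: d)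
  qed (simp add: unit_ball_vol_nonneg)
  finally show "measure lborel (annulus T k :: 'a set)
    \<ge> unit_ball_vol (real DIM('a)) * (pi / (2 * T)) * (real k * pi / T) ^ (DIM('a) - 1)" by (simp add: mult.assoc)
qed

lemma schwartz_amp:
  fixes T t R :: real
  assumes R: "R > 0"
  shows "(\<lambda>\<xi>::'a::euclidean_space. cis (t * norm \<xi>) * complex_of_real (amp R T \<xi>)) \<in> schwartz" (is ?A)
    and "(\<lambda>\<xi>::'a. complex_of_real (norm \<xi>) * (cis (t * norm \<xi>) * complex_of_real (amp R T \<xi>))) \<in> schwartz" (is ?B)
proof -
  have o: "open (- {0::'a})" by auto
  have n: "smooth_upto (- {0}) j (\<lambda>\<xi>::'a. t * norm \<xi>)" for j t
    by (rule smooth_upto_mult[OF o smooth_upto_const[OF o] smooth_upto_norm])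
  note OR = smooth_upto_bounded_linear[OF o bounded_linear_of_real]
  have c: "smooth_upto (- {0}) j (\<lambda>\<xi>::'a. cis (t * norm \<xi>))" for j
  proof -
    have "smooth_upto (- {0}) j (\<lambda>\<xi>::'a. complex_of_real (cos (t * norm \<xi>)) + \<i> * complex_of_real (sin (t * norm \<xi>)))"
      by (rule smooth_upto_add[OF o OR[OF smooth_upto_cos_sin(1)[OF o n]]
            smooth_upto_mult[OF o smooth_upto_const[OF o] OR[OF smooth_upto_cos_sin(2)[OF o n]]]])
    moreover have "(\<lambda>\<xi>::'a. complex_of_real (cos (t * norm \<xi>)) + \<i> * complex_of_real (sin (t * norm \<xi>))) = (\<lambda>\<xi>. cis (t * norm \<xi>))"
      by (simp add: fun_eq_iff complex_eq_iff)
    ultimately show ?thesis by simp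
  qed
  have m: "smooth_upto (- {0}) j (\<lambda>\<xi>::'a. complex_of_real (inverse (norm \<xi>) ^ DIM('a) * sin (T * norm \<xi>)))" for j
    by (rule OR[OF smooth_upto_mult[OF o smooth_upto_power[OF o smooth_upto_inverse_norm] smooth_upto_cos_sin(2)[OF o n]]])
  note k = smooth_upto_mult[OF o c m]
  have "?A \<longleftrightarrow> (\<lambda>\<xi>::'a. of_real (cutoff R \<xi>) * (cis (t * norm \<xi>) * complex_of_real (inverse (norm \<xi>) ^ DIM('a) * sin (T * norm \<xi>)))) \<in> schwartz"
    by (simp add: amp_def mult_ac)
  then show ?A using cutoff_schwartz[OF k R] by simp
  have "?B \<longleftrightarrow> (\<lambda>\<xi>::'a. of_real (cutoff R \<xi>) * (complex_of_real (norm \<xi>) * (cis (t * norm \<xi>) * complex_of_real (inverse (norm \<xi>) ^ DIM('a) * sin (T * norm \<xi>))))) \<in> schwartz"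
    by (simp add: amp_def mult_ac)
  then show ?B using cutoff_schwartz[OF smooth_upto_mult[OF o OR[OF smooth_upto_norm] k] R] by simp
qed

lemma schwartz_sin_amp:
  assumes "R > 0"
  shows "(\<lambda>\<xi>::'a::euclidean_space. sin (T * norm \<xi>) * amp R T \<xi>) \<in> schwartz"
  using schwartz_Im[OF schwartz_amp(1)[OF assms, of T T]] by simp

lemma sin_amp_nonneg: "0 \<le> sin (T * norm \<xi>) * amp R T \<xi>"
proof -
  have "sin (T * norm \<xi>) * amp R T \<xi> = cutoff R \<xi> * inverse (norm \<xi>) ^ DIM('a) * (sin (T * norm \<xi>))\<^sup>2"
    by (simp add: amp_def power2_eq_square)
  then show ?thesis using cutoff_bounds(1)[of R \<xi>] by simp
qed

text \<open>The integral I of the overview. The type argument fixes the space of frequencies, which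
  R and T do not determine.\<close>

definition mass :: "'a::euclidean_space itself \<Rightarrow> real \<Rightarrow> real \<Rightarrow> real"
  where "mass _ R T = (LINT \<xi>::'a|lborel. sin (T * norm \<xi>) * amp R T \<xi>)"

text \<open>Let n be the dimension. On the k-th annulus the integrand is at least a multiple of
  ((k+1) pi/T)^(-n), and its measure is at least a multiple of (pi/T)^n k^(n-1), so it contributes a
  multiple of 1/(k+1). The choice of \<open>k0\<close> ensures |xi| >= 2 and yields
  \<open>flat 1 3\<close>; the choice of R ensures |xi| <= R/2 and yields
  \<open>flat 1 (3 / 4)\<close>. The denominator 2 * 2^n collects 1/2 from the squared sine, 1/2
  from the width, and (k/(k+1))^(n-1) >= 2^(-(n-1)).\<close>

lemma mass_lower_bound:
  assumes T: "T > 0" and k0: "k0 \<ge> 1" "real k0 * pi / T \<ge> 2" and M: "k0 < M"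
  defines "c \<equiv> flat 1 3 * flat 1 (3 / 4) * unit_ball_vol (real DIM('a)) / (2 * 2 ^ DIM('a))"
  shows "mass TYPE('a::euclidean_space) (2 * (real M * pi / T)) T \<ge> c * (\<Sum>k\<in>{k0..<M}. inverse (real (Suc k)))"
proof -
  define R where "R = 2 * (real M * pi / T)"
  define \<rho> where "\<rho> k = real (Suc k) * pi / T" for k
  define \<kappa> where "\<kappa> = flat 1 3 * flat 1 (3 / 4)"
  have \<kappa>: "0 \<le> \<kappa>" by (simp add: \<kappa>_def flat_1_nonneg)
  have R: "R > 0" using T M by (simp add: R_def)
  have \<rho>: "\<rho> k > 0" for k using T by (simp add: \<rho>_def)
  obtain d where d: "DIM('a) = Suc d" using DIM_positive[where 'a='a] gr0_implies_Suc by blast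
  let ?b = "\<lambda>k \<xi>::'a. (\<kappa> / 2 * inverse (\<rho> k ^ DIM('a))) * indicat_real (annulus T k) \<xi>"
  have pw: "(\<Sum>k\<in>{k0..<M}. ?b k \<xi>) \<le> sin (T * norm \<xi>) * amp R T \<xi>" for \<xi> :: 'a
  proof (cases "\<exists>k\<in>{k0..<M}. \<xi> \<in> annulus T k")
    case False
    then show ?thesis using sin_amp_nonneg[of T \<xi> R] by (simp add: indicator_def)
  next
    case True
    then obtain k where k: "k0 \<le> k" "k < M" "\<xi> \<in> annulus T k" by auto
    \<comment> \<open>The annuli are disjoint, so at most one term of the sum is nonzero at a given
      frequency.\<close>
    have other: "\<xi> \<notin> annulus T j" if "j \<noteq> k" for j
    proof
      assume j: "\<xi> \<in> annulus T j"
      have "(real k + 1 / 4) * pi \<le> T * norm \<xi>" "T * norm \<xi> < (real k + 3 / 4) * pi"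
        "(real j + 1 / 4) * pi \<le> T * norm \<xi>" "T * norm \<xi> < (real j + 3 / 4) * pi"
        using T k(3) j by (auto simp: in_annulus field_simps)
      then have "(real k + 1 / 4) * pi < (real j + 3 / 4) * pi" "(real j + 1 / 4) * pi < (real k + 3 / 4) * pi" by linarith+
      then show False using that by auto
    qed
    have "(\<Sum>k\<in>{k0..<M}. ?b k \<xi>) = ?b k \<xi>"
      using k other by (subst sum.remove[of _ k]) (auto simp: indicator_def intro!: sum.neutral)
    also have "\<dots> = \<kappa> * inverse (\<rho> k ^ DIM('a)) * (1 / 2)" using k(3) by simp
    also have "\<dots> \<le> cutoff R \<xi> * inverse (norm \<xi>) ^ DIM('a) * (sin (T * norm \<xi>))\<^sup>2"
    proof (intro mult_mono)
      have lo: "(real k + 1 / 4) * pi / T \<le> norm \<xi>" and hi: "norm \<xi> < (real k + 3 / 4) * pi / T"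
        using k(3) by (auto simp: in_annulus)
      have "real k0 * pi / T \<le> (real k + 1 / 4) * pi / T"
        using k(1) T by (intro divide_right_mono mult_right_mono) auto
      with lo k0(2) have n2: "2 \<le> norm \<xi>" by linarith
      have "(real k + 3 / 4) * pi / T \<le> \<rho> k" "\<rho> k \<le> real M * pi / T"
        unfolding \<rho>_def using k(2) T by (intro divide_right_mono mult_right_mono; auto)+
      with hi have n\<rho>: "norm \<xi> \<le> \<rho> k" and nR: "norm \<xi> \<le> R / 2" by (auto simp: R_def)
      have "flat 1 3 \<le> flat 1 ((norm \<xi>)\<^sup>2 - 1)"
        using power_mono[OF n2, of 2] by (intro flat_1_mono) simp
      moreover have "flat 1 (3 / 4) \<le> bump R \<xi>"
      proof -
        have "1 - (R / 2)\<^sup>2 * inverse (R\<^sup>2) = 3 / 4" using R by (simp add: power_divide)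
        with bump_ge[OF nR, of R] show ?thesis by simp
      qed
      ultimately show "\<kappa> \<le> cutoff R \<xi>"
        unfolding \<kappa>_def cutoff_def by (intro mult_mono) (auto simp: flat_1_nonneg)
      show "inverse (\<rho> k ^ DIM('a)) \<le> inverse (norm \<xi>) ^ DIM('a)"
        unfolding power_inverse[symmetric] using n\<rho> n2 by (intro power_mono le_imp_inverse_le) (auto simp: \<rho> less_imp_le)
      show "1 / 2 \<le> (sin (T * norm \<xi>))\<^sup>2" by (rule sin_squared_annulus[OF T k(3)])
    qed (use \<kappa> \<rho>[of k] cutoff_bounds(1)[of R \<xi>] in \<open>auto simp: less_imp_le\<close>)
    also have "\<dots> = sin (T * norm \<xi>) * amp R T \<xi>" by (simp add: amp_def power2_eq_square)
    finally show ?thesis .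
  qed
  note meas = measure_annulus_ge[OF T, where 'a='a]
  have ib: "integrable lborel (?b k)" for k
    using meas(2,3)[of k] by (intro integrable_mult_right integrable_real_indicator)
  have "c * (\<Sum>k\<in>{k0..<M}. inverse (real (Suc k))) \<le> (\<Sum>k\<in>{k0..<M}. LINT \<xi>|lborel. ?b k \<xi>)"
    unfolding sum_distrib_left
  proof (rule sum_mono)
    fix k assume k: "k \<in> {k0..<M}"
    then have k1: "real k \<ge> 1" using k0 by auto
    have e1: "(\<rho> k) ^ Suc d = (real (Suc k)) ^ Suc d * (pi / T) ^ Suc d"
      unfolding \<rho>_def by (simp add: power_mult_distrib power_divide)
    have e2: "(real k * pi / T) ^ d = real k ^ d * (pi / T) ^ d" by (simp add: power_mult_distrib power_divide)
    \<comment> \<open>From k >= 1 one has k + 1 <= 2 k, which costs 2^d and leaves exactly one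
      inverse power of k + 1.\<close>
    have "(real (Suc k)) ^ d \<le> (2 * real k) ^ d" using k1 by (intro power_mono) auto
    then have q: "inverse (2 ^ d) \<le> real k ^ d * inverse (real (Suc k) ^ d)"
      by (simp add: power_mult_distrib field_simps)
    have "c * inverse (real (Suc k)) = \<kappa> * unit_ball_vol (real DIM('a)) / 4 * inverse (real (Suc k)) * inverse (2 ^ d)"
      by (simp add: c_def \<kappa>_def d field_simps)
    also have "\<dots> \<le> \<kappa> * unit_ball_vol (real DIM('a)) / 4 * inverse (real (Suc k)) * (real k ^ d * inverse (real (Suc k) ^ d))"
      using \<kappa> q by (intro mult_left_mono) (auto simp: unit_ball_vol_nonneg)
    also have "\<dots> = (\<kappa> / 2 * inverse (\<rho> k ^ DIM('a))) * (unit_ball_vol (real DIM('a)) * (pi / (2 * T)) * (real k * pi / T) ^ (DIM('a) - 1))"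
    proof -
      have q: "\<kappa> * V / 4 * inverse S * (y * inverse Sd) = (\<kappa> / 2 * inverse ((S * Sd) * (P * Pd))) * (V * (P / 2) * (y * Pd))"
        if "P \<noteq> 0" "Pd \<noteq> 0" for V S Sd P Pd y :: real using that by (simp add: field_simps)
      have h: "pi / (2 * T) = pi / T / 2" by simp
      show ?thesis unfolding d e1 e2 diff_Suc_1 unfolding power_Suc h by (rule q) (use T in auto)
    qed
    also have "\<dots> \<le> (\<kappa> / 2 * inverse (\<rho> k ^ DIM('a))) * measure lborel (annulus T k :: 'a set)"
      using \<kappa> \<rho>[of k] by (intro mult_left_mono meas(1)) (auto simp: less_imp_le)
    also have "\<dots> = (LINT \<xi>|lborel. ?b k \<xi>)" using meas(2)[of k] by simp
    finally show "c * inverse (real (Suc k)) \<le> (LINT \<xi>|lborel. ?b k \<xi>)" .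
  qed
  also have "\<dots> = (LINT \<xi>|lborel. (\<Sum>k\<in>{k0..<M}. ?b k \<xi>))"
    by (rule Bochner_Integration.integral_sum[symmetric]) (rule ib)
  also have "\<dots> \<le> (LINT \<xi>::'a|lborel. sin (T * norm \<xi>) * amp R T \<xi>)"
    by (intro integral_mono Bochner_Integration.integrable_sum ib pw schwartz_integrable[OF schwartz_sin_amp[OF R]])
  finally show ?thesis by (simp add: mass_def R_def)
qed

text \<open>The mass grows like \<open>log R\<close>, the dual norm like its square root.\<close>

lemma mass_not_bounded_by_dual_norm:
  assumes T: "T > 0"
  shows "\<not> (\<forall>R>0. mass TYPE(real^'n::finite) R T
    \<le> K * dual_norm (real CARD('n) / 2) (\<lambda>\<xi>::real^'n. complex_of_real (bump (3 * R) \<xi>)))"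
proof
  assume A: "\<forall>R>0. mass TYPE(real^'n) R T
    \<le> K * dual_norm (real CARD('n) / 2) (\<lambda>\<xi>::real^'n. complex_of_real (bump (3 * R) \<xi>))"
  define \<omega> where "\<omega> = unit_ball_vol (real CARD('n))"
  have \<omega>: "\<omega> > 0" by (simp add: \<omega>_def)
  define c where "c = flat 1 3 * flat 1 (3 / 4) * \<omega> / (2 * 2 ^ CARD('n))"
  have c: "c > 0" using \<omega> by (simp add: c_def flat_1_pos)
  obtain k0 :: nat where k0: "real k0 \<ge> 2 * T / pi" "k0 \<ge> 1"
  proof -
    obtain k :: nat where "2 * T / pi \<le> real k" using real_arch_simple by blast
    then show ?thesis using that[of "max k 1"] by simp
  qed
  have k0': "real k0 * pi / T \<ge> 2" using k0(1) T by (simp add: field_simps)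
  \<comment> \<open>With R = 2 * 2^J * pi / T the bump radius 3 R is 2^J * (6 pi / T);
    \<open>L\<close> absorbs the factor independent of J.\<close>
  obtain L :: nat where L: "6 * pi / T \<le> 2 ^ L"
    using real_arch_pow[of 2 "6 * pi / T"] by (auto intro: less_imp_le)
  define H where "H = (\<Sum>k<k0. inverse (real (Suc k)))"
  define n2 where "n2 = (2::real) ^ CARD('n)"
  have main: "c * (real J * ln 2 - H) \<le> \<bar>K\<bar> * sqrt (\<omega> * (1 + (real J + real L) * n2))" if J: "k0 < 2 ^ J" for J
  proof -
    define M :: nat where "M = 2 ^ J"
    define R where "R = 2 * (real M * pi / T)"
    have R: "R > 0" using T by (simp add: R_def M_def)
    have "(\<Sum>k<M. inverse (real (Suc k))) = H + (\<Sum>k\<in>{k0..<M}. inverse (real (Suc k)))"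
      unfolding H_def using J by (simp add: M_def lessThan_atLeast0 sum.atLeastLessThan_concat)
    moreover have "(\<Sum>k<M. inverse (real (Suc k))) = harm M" by (simp add: harm_altdef)
    moreover have "ln (real M + 1) \<le> harm M" by (rule ln_le_harm)
    moreover have "real J * ln 2 \<le> ln (real M + 1)"
    proof -
      have "real J * ln 2 = ln (real M)" by (simp add: M_def ln_realpow)
      also have "\<dots> \<le> ln (real M + 1)" by (subst ln_le_cancel_iff) (auto simp: M_def add_pos_nonneg)
      finally show ?thesis .
    qed
    ultimately have "real J * ln 2 - H \<le> (\<Sum>k\<in>{k0..<M}. inverse (real (Suc k)))" by linarith
    then have "c * (real J * ln 2 - H) \<le> c * (\<Sum>k\<in>{k0..<M}. inverse (real (Suc k)))" using c by (intro mult_left_mono) auto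
    also have "\<dots> \<le> mass TYPE(real^'n) R T"
      using mass_lower_bound[OF T k0(2) k0', of M, where 'a="real^'n"] J by (simp add: M_def R_def c_def \<omega>_def)
    also have "\<dots> \<le> K * dual_norm (real CARD('n) / 2) (\<lambda>\<xi>::real^'n. complex_of_real (bump (3 * R) \<xi>))"
      using A R by blast
    also have "\<dots> \<le> \<bar>K\<bar> * dual_norm (real CARD('n) / 2) (\<lambda>\<xi>::real^'n. complex_of_real (bump (3 * R) \<xi>))"
      by (intro mult_right_mono dual_norm_nonneg) auto
    also have "\<dots> \<le> \<bar>K\<bar> * sqrt (\<omega> * (1 + real (J + L) * n2))"
    proof (intro mult_left_mono)
      have "3 * R = 2 ^ J * (6 * pi / T)" by (simp add: R_def M_def)
      also have "\<dots> \<le> 2 ^ J * 2 ^ L" using L by (intro mult_left_mono) auto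
      finally have "3 * R \<le> 2 ^ (J + L)" by (simp add: power_add)
      then show "dual_norm (real CARD('n) / 2) (\<lambda>\<xi>::real^'n. complex_of_real (bump (3 * R) \<xi>)) \<le> sqrt (\<omega> * (1 + real (J + L) * n2))"
        using R unfolding \<omega>_def n2_def by (intro dual_norm_bump_le) auto
    qed simp
    finally show ?thesis by simp
  qed
  define \<alpha> where "\<alpha> = c * ln 2"
  have \<alpha>: "\<alpha> > 0" using c by (simp add: \<alpha>_def)
  define \<gamma> where "\<gamma> = K\<^sup>2 * \<omega> * (1 + real L * n2)"
  define \<delta> where "\<delta> = K\<^sup>2 * \<omega> * n2"
  have \<delta>: "\<delta> \<ge> 0" using \<omega> by (simp add: \<delta>_def n2_def)
  \<comment> \<open>The square root is linearised by sqrt y <= (tau y + 1/tau) / 2. This slope gives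
    tau delta <= alpha, so the right side grows at most half as fast in J as the left. The + 1
    covers delta = 0.\<close>
  define \<tau> where "\<tau> = \<alpha> / (\<delta> + 1)"
  have \<tau>: "\<tau> > 0" using \<alpha> \<delta> by (simp add: \<tau>_def)
  have "real J * (\<alpha> / 2) \<le> c * H + (\<tau> * \<gamma> + 1 / \<tau>) / 2" if J: "k0 < 2 ^ J" for J
  proof -
    define y where "y = \<gamma> + \<delta> * real J"
    have y: "y \<ge> 0" using \<omega> by (simp add: y_def \<gamma>_def \<delta>_def n2_def)
    have "\<bar>K\<bar> * sqrt (\<omega> * (1 + (real J + real L) * n2)) = sqrt y"
      by (simp add: y_def \<gamma>_def \<delta>_def algebra_simps flip: real_sqrt_mult real_sqrt_abs)
    with main[OF J] have "real J * \<alpha> - c * H \<le> sqrt y" by (simp add: \<alpha>_def algebra_simps)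
    also have "sqrt y \<le> (\<tau> * y + 1 / \<tau>) / 2"
    proof -
      have "sqrt y = sqrt (\<tau> * y * (1 / \<tau>))" using \<tau> by simp
      also have "\<dots> \<le> (\<tau> * y + 1 / \<tau>) / 2" using \<tau> y by (intro arith_geo_mean_sqrt) auto
      finally show ?thesis .
    qed
    also have "\<tau> * y \<le> \<tau> * \<gamma> + \<alpha> * real J"
    proof -
      have "\<tau> * \<delta> \<le> \<alpha>" using \<alpha> \<delta> by (simp add: \<tau>_def field_simps)
      then have "\<tau> * \<delta> * real J \<le> \<alpha> * real J" by (rule mult_right_mono) simp
      then show ?thesis by (simp add: y_def algebra_simps)
    qed
    finally show ?thesis by (simp add: algebra_simps add_divide_distrib)
  qed
  moreover obtain J1 :: nat where J1: "c * H + (\<tau> * \<gamma> + 1 / \<tau>) / 2 < real J1 * (\<alpha> / 2)"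
    using reals_Archimedean3[OF half_gt_zero[OF \<alpha>]] by blast
  \<comment> \<open>The maximum with \<open>k0\<close> guarantees k0 < 2^J as well.\<close>
  moreover have "real J1 * (\<alpha> / 2) \<le> real (max J1 k0) * (\<alpha> / 2)" using \<alpha> by (intro mult_right_mono) auto
  moreover have "k0 < 2 ^ max J1 k0"
    by (meson less_exp less_le_trans max.cobounded2 one_le_numeral power_increasing)
  ultimately show False by (meson linorder_not_le order_trans)
qed

section \<open>Free waves\<close>

text \<open>A parametrisation of the forward light cone; the minus sign matches the sign in the
  phase of \<open>fourier\<close>.\<close>

definition freq :: "real^'n::finite \<Rightarrow> (real^'n) \<times> real"
  where "freq \<xi> = (- \<xi>, norm \<xi>)"

text \<open>As \<open>amp\<close> is even, this is the free wave with spatial Fourier transform \<open>sin (t \<bar>\<xi>\<bar>) amp R T \<xi>\<close>,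
  up to the normalisation of \<open>fourier\<close>.\<close>

definition wave :: "real \<Rightarrow> real \<Rightarrow> (real^'n::finite) \<times> real \<Rightarrow> real"
  where "wave R T z = Im (osc lborel freq (\<lambda>\<xi>. complex_of_real (amp R T \<xi>)) z)"

lemma schwartz_complex_amp:
  "R > 0 \<Longrightarrow> (\<lambda>\<xi>::'a::euclidean_space. complex_of_real (amp R T \<xi>)) \<in> schwartz"
  using schwartz_amp(1)[of R 0 T, where 'a='a] by simp

lemma moments_amp:
  assumes "R > 0" shows "moments lborel freq (\<lambda>\<xi>::real^'n::finite. complex_of_real (amp R T \<xi>))"
proof -
  let ?a = "\<lambda>\<xi>::real^'n. complex_of_real (amp R T \<xi>)"
  have [measurable]: "?a \<in> borel_measurable borel" by (rule schwartz_measurable[OF schwartz_complex_amp[OF assms]])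
  have "continuous_on UNIV (freq :: real^'n \<Rightarrow> _)" unfolding freq_def[abs_def] by (intro continuous_intros)
  then have [measurable]: "(freq :: real^'n \<Rightarrow> _) \<in> borel_measurable borel" by (rule borel_measurable_continuous_onI)
  have "integrable lborel (\<lambda>\<xi>. norm (freq \<xi>) ^ j * norm (?a \<xi>))" for j
  proof (rule Bochner_Integration.integrable_bound)
    show "integrable lborel (\<lambda>\<xi>. 2 ^ j * (norm (- \<xi>) ^ j * norm (?a \<xi>)))"
      using schwartz_moments[OF schwartz_complex_amp[OF assms]] unfolding moments_def
      by (intro integrable_mult_right) blast
    have "norm (freq \<xi>) \<le> 2 * norm \<xi>" for \<xi> :: "real^'n"
      using norm_Pair_le[of "- \<xi>" "norm \<xi>"] by (simp add: freq_def)
    then have "norm (freq \<xi>) ^ j \<le> 2 ^ j * norm \<xi> ^ j" for \<xi> :: "real^'n"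
      unfolding power_mult_distrib[symmetric] by (intro power_mono) auto
    then have "norm (freq \<xi>) ^ j * norm (?a \<xi>) \<le> 2 ^ j * norm \<xi> ^ j * norm (?a \<xi>)" for \<xi>
      by (intro mult_right_mono) auto
    then show "AE \<xi> in lborel. norm (norm (freq \<xi>) ^ j * norm (?a \<xi>)) \<le> norm (2 ^ j * (norm (- \<xi>) ^ j * norm (?a \<xi>)))"
      by (simp add: mult.assoc abs_mult)
  qed measurable
  then show ?thesis by (simp add: moments_def)
qed

lemma osc_freq_eq_fourier:
  "osc lborel freq h (x, t) = fourier (\<lambda>\<xi>. cis (t * norm \<xi>) * h \<xi>) x"
  unfolding osc_def fourier_def freq_def
  by (simp add: inner_commute mult.assoc[symmetric] cis_mult)

lemma Im_osc_has_derivative: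
  assumes "moments M \<zeta> h"
  shows "((\<lambda>z. Im (osc M \<zeta> h z)) has_derivative (\<lambda>v. Im (osc M \<zeta> (\<lambda>w. \<i> * of_real (v \<bullet> \<zeta> w) * h w) z))) (at z)"
  by (rule bounded_linear.has_derivative[OF bounded_linear_Im osc_has_derivative[OF assms]])

lemma dirderiv_Im_osc:
  "moments M \<zeta> h \<Longrightarrow> dirderiv v (\<lambda>z. Im (osc M \<zeta> h z)) = (\<lambda>z. Im (osc M \<zeta> (\<lambda>w. \<i> * of_real (v \<bullet> \<zeta> w) * h w) z))"
  by (rule ext) (rule dirderiv_eqI[OF Im_osc_has_derivative])

lemma smooth_upto_wave: "R > 0 \<Longrightarrow> smooth_upto UNIV k (wave R T)"
  unfolding wave_def[abs_def]
  by (rule smooth_upto_bounded_linear[OF open_UNIV bounded_linear_Im smooth_upto_osc[OF moments_amp]])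

text \<open>Each second derivative multiplies the density by -(v . freq)^2. Since the frequencies
  lie on the light cone, the spatial squares add up to the temporal one.\<close>

lemma wave_equation:
  fixes z :: "(real^'n::finite) \<times> real"
  assumes "R > 0"
  shows "(\<Sum>i\<in>UNIV. dx i (dx i (wave R T)) z) = dt (dt (wave R T)) z"
proof -
  let ?a = "\<lambda>\<xi>::real^'n. complex_of_real (amp R T \<xi>)"
  let ?h = "\<lambda>v \<xi>. \<i> * of_real (v \<bullet> freq \<xi>) * (\<i> * of_real (v \<bullet> freq \<xi>) * ?a \<xi>)"
  note m = moments_amp[OF assms, where T=T and 'n='n]
  note m2 = moments_dirderiv[OF moments_dirderiv[OF m]]
  have 2: "dirderiv v (dirderiv v (wave R T)) z = Im (osc lborel freq (?h v) z)" for v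
    unfolding wave_def[abs_def] dirderiv_Im_osc[OF m] dirderiv_Im_osc[OF moments_dirderiv[OF m]] ..
  have h: "(\<Sum>i\<in>UNIV. ?h (axis i 1, 0) \<xi>) = ?h (0, 1) \<xi>" for \<xi>
  proof -
    have "(\<Sum>i\<in>UNIV. complex_of_real ((\<xi> $ i)\<^sup>2)) = complex_of_real ((norm \<xi>)\<^sup>2)"
      unfolding of_real_sum[symmetric] power2_norm_eq_inner by (simp add: inner_vec_def power2_eq_square)
    then have "(\<Sum>i\<in>UNIV. - complex_of_real ((\<xi> $ i)\<^sup>2) * ?a \<xi>) = - complex_of_real ((norm \<xi>)\<^sup>2) * ?a \<xi>"
      unfolding sum_distrib_right[symmetric] sum_negf by simp
    then show ?thesis by (simp add: freq_def inner_axis' inner_axis power2_eq_square algebra_simps)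
  qed
  have "(\<Sum>i\<in>UNIV. osc lborel freq (?h (axis i 1, 0)) z) = osc lborel freq (?h (0, 1)) z"
    unfolding osc_def h[symmetric] sum_distrib_left
    by (rule Bochner_Integration.integral_sum[symmetric]) (rule moments_integrable[OF m2])
  then show ?thesis unfolding 2 Im_sum[symmetric] by simp
qed

lemma schwartz_wave: "R > 0 \<Longrightarrow> (\<lambda>x. wave R T (x, t)) \<in> schwartz"
  unfolding wave_def osc_freq_eq_fourier by (rule schwartz_Im[OF schwartz_fourier[OF schwartz_amp(1)]])

lemma dt_wave:
  assumes "R > 0"
  shows "dt (wave R T) (x, t) = Im (fourier (\<lambda>\<xi>::real^'n::finite. \<i> * (complex_of_real (norm \<xi>) * (cis (t * norm \<xi>) * complex_of_real (amp R T \<xi>)))) x)"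
  unfolding wave_def[abs_def] dirderiv_Im_osc[OF moments_amp[OF assms]] osc_freq_eq_fourier
  by (simp add: freq_def mult_ac)

lemma schwartz_dt_wave: "R > 0 \<Longrightarrow> (\<lambda>x. dt (wave R T) (x, t)) \<in> schwartz"
  unfolding dt_wave by (rule schwartz_Im[OF schwartz_fourier[OF schwartz_mult_right[OF schwartz_amp(2)]]])

lemma amp_minus: "amp R T (- \<xi>) = amp R T \<xi>"
  by (simp add: amp_def cutoff_def bump_minus)

lemma fourier_mult_i: "fourier (\<lambda>\<xi>. \<i> * f \<xi>) x = \<i> * fourier f x"
  unfolding fourier_def by (simp add: mult.left_commute)

text \<open>The amplitude is real and even, so its transform is real and has no imaginary
  part.\<close>

lemma wave_0: "R > 0 \<Longrightarrow> wave R T (x, 0) = 0"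
proof -
  assume R: "R > 0"
  have "fourier (\<lambda>\<xi>. complex_of_real (amp R T \<xi>)) x \<in> \<real>"
    by (rule fourier_real_even[OF schwartz_measurable[OF schwartz_complex_amp[OF R]]]) (auto simp: amp_minus)
  then show ?thesis by (simp add: wave_def osc_freq_eq_fourier complex_is_Real_iff)
qed

lemma dt_wave_0:
  assumes R: "R > 0"
  shows "complex_of_real (dt (wave R T) (x, 0)) = fourier (\<lambda>\<xi>::real^'n::finite. complex_of_real (norm \<xi> * amp R T \<xi>)) x"
proof -
  have s: "(\<lambda>\<xi>::real^'n. complex_of_real (norm \<xi> * amp R T \<xi>)) \<in> schwartz"
    using schwartz_amp(2)[OF R, of 0 T, where 'a="real^'n"] by simp
  have "fourier (\<lambda>\<xi>::real^'n. complex_of_real (norm \<xi> * amp R T \<xi>)) x \<in> \<real>"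
    by (rule fourier_real_even[OF schwartz_measurable[OF s]]) (auto simp: amp_minus)
  then show ?thesis using fourier_mult_i[of "\<lambda>\<xi>::real^'n. complex_of_real (norm \<xi> * amp R T \<xi>)" x]
    by (simp add: dt_wave[OF R] of_real_Re)
qed

text \<open>Splitting the phase factor into cosine and sine gives two real transforms, by evenness;
  the imaginary part taken in \<open>wave\<close> selects the sine.\<close>

lemma wave_T:
  assumes R: "R > 0"
  shows "complex_of_real (wave R T (x, T)) = fourier (\<lambda>\<xi>::real^'n::finite. complex_of_real (sin (T * norm \<xi>) * amp R T \<xi>)) x"
proof -
  have s: "(\<lambda>\<xi>::real^'n. complex_of_real (sin (T * norm \<xi>) * amp R T \<xi>)) \<in> schwartz"
    "(\<lambda>\<xi>::real^'n. complex_of_real (cos (T * norm \<xi>) * amp R T \<xi>)) \<in> schwartz"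
    using schwartz_of_real[OF schwartz_Im[OF schwartz_amp(1)[OF R, of T T, where 'a="real^'n"]]]
      schwartz_of_real[OF schwartz_Re[OF schwartz_amp(1)[OF R, of T T, where 'a="real^'n"]]] by simp_all
  have r1: "fourier (\<lambda>\<xi>::real^'n. complex_of_real (sin (T * norm \<xi>) * amp R T \<xi>)) x \<in> \<real>"
    by (rule fourier_real_even[OF schwartz_measurable[OF s(1)]]) (auto simp: amp_minus)
  have r2: "fourier (\<lambda>\<xi>::real^'n. complex_of_real (cos (T * norm \<xi>) * amp R T \<xi>)) x \<in> \<real>"
    by (rule fourier_real_even[OF schwartz_measurable[OF s(2)]]) (auto simp: amp_minus)
  have i: "integrable lborel (\<lambda>\<xi>. cis (- (\<xi> \<bullet> x)) * complex_of_real (sin (T * norm \<xi>) * amp R T \<xi>))"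
    "integrable lborel (\<lambda>\<xi>. cis (- (\<xi> \<bullet> x)) * complex_of_real (cos (T * norm \<xi>) * amp R T \<xi>))"
    using moments_integrable[OF schwartz_moments[OF s(1)], of x] moments_integrable[OF schwartz_moments[OF s(2)], of x]
    by (simp_all add: inner_commute)
  have "fourier (\<lambda>\<xi>::real^'n. cis (T * norm \<xi>) * complex_of_real (amp R T \<xi>)) x
    = (LINT \<xi>|lborel. cis (- (\<xi> \<bullet> x)) * complex_of_real (cos (T * norm \<xi>) * amp R T \<xi>)
       + \<i> * (cis (- (\<xi> \<bullet> x)) * complex_of_real (sin (T * norm \<xi>) * amp R T \<xi>)))"
    unfolding fourier_def by (intro Bochner_Integration.integral_cong) (auto simp: complex_eq_iff algebra_simps)
  also have "\<dots> = fourier (\<lambda>\<xi>::real^'n. complex_of_real (cos (T * norm \<xi>) * amp R T \<xi>)) x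
     + \<i> * fourier (\<lambda>\<xi>::real^'n. complex_of_real (sin (T * norm \<xi>) * amp R T \<xi>)) x"
    unfolding fourier_def using Bochner_Integration.integral_add[OF i(2) integrable_mult_right[OF i(1), of \<i>]] by simp
  finally show ?thesis using r1 r2
    by (simp add: wave_def osc_freq_eq_fourier of_real_Re complex_is_Real_iff)
qed

section \<open>The sphere in extrinsic coordinates\<close>

definition sphere_christoffel :: "'m::finite christoffel"
  where "sphere_christoffel y k \<alpha> \<beta> = (if \<alpha> = \<beta> then y $ k else 0)"

lemma dirderiv_ident: "dirderiv v (\<lambda>x. x) = (\<lambda>x. v)"
  by (rule ext) (rule dirderiv_eqI[OF has_derivative_ident])

lemma sum_christoffel:
  "(\<Sum>\<alpha>\<in>UNIV. \<Sum>\<beta>\<in>UNIV. sphere_christoffel y k \<alpha> \<beta> * q \<alpha> \<beta>) = y $ k * (\<Sum>\<alpha>\<in>UNIV. q \<alpha> \<alpha>)"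
  by (simp add: sphere_christoffel_def sum_distrib_left if_distrib[of "\<lambda>x. x * _"] cong: if_cong)

text \<open>Differentiating Y(q) . q = 0 along the sphere gives D_X Y . p = - X . Y(p). The
  tangential projection therefore adds (X . Y(p)) p to D_X Y, and this is the Christoffel
  term.\<close>

lemma sphere_coordinates_ident:
  "sphere_coordinates (sphere 0 1 :: (real^'m::finite) set) (\<lambda>x. x) sphere_christoffel"
  unfolding sphere_coordinates_def
proof (intro conjI)
  have sm: "smooth_on UNIV (\<lambda>x::real^'m. x)"
    unfolding smooth_on_iff_ders by (simp add: smooth_upto_linear bounded_linear_ident)
  show "sphere 0 1 \<noteq> ({} :: (real^'m) set)" by simp
  show "openin (top_of_set (sphere 0 1)) (sphere 0 1 :: (real^'m) set)" by simp
  show "\<exists>W. sphere 0 1 \<subseteq> W \<and> smooth_on W (\<lambda>x::real^'m. x)" using sm by blast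
  show "\<exists>\<Theta> W. (\<lambda>x::real^'m. x) ` sphere 0 1 \<subseteq> W \<and> smooth_on W \<Theta> \<and> (\<forall>p\<in>sphere 0 1. \<Theta> p = p)"
    using sm by (intro exI[of _ "\<lambda>x. x"] exI[of _ UNIV]) auto
  show "christoffel_symbols (sphere 0 1 :: (real^'m) set) (\<lambda>x. x) sphere_christoffel"
    unfolding christoffel_symbols_def
  proof (intro ballI allI impI)
    fix p X :: "real^'m" and Y :: "real^'m \<Rightarrow> real^'m" and k
    assume p: "p \<in> sphere 0 1"
    assume A: "X \<bullet> p = 0 \<and> (\<exists>W. sphere 0 1 \<subseteq> W \<and> smooth_on W Y) \<and> (\<forall>q\<in>sphere 0 1. Y q \<bullet> q = 0)"
    then obtain W where W: "sphere 0 1 \<subseteq> W" "smooth_on W Y" by blast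
    have p1: "p \<bullet> p = 1" using p by (simp add: norm_eq_1)
    have DY: "(Y has_derivative (\<lambda>v. dirderiv v Y p)) (at p)"
      using W p by (intro ders_has_derivative[of W "\<lambda>_. True" 0]) (auto simp: smooth_on_iff_ders)
    have key: "dirderiv X Y p \<bullet> p = - (X \<bullet> Y p)"
    proof (cases "X = 0")
      case True
      then show ?thesis using linear_0[OF has_derivative_linear[OF DY]] by simp
    next
      case False
      \<comment> \<open>Tangency of \<open>Y\<close> is known on the sphere only, so one
        differentiates along a curve inside it: the great circle through p with velocity X.
        Normalising X is why X = 0 is treated separately.\<close>
      define r where "r = norm X"
      define E where "E = X /\<^sub>R r"
      have r: "r > 0" using False by (simp add: r_def)
      have E: "E \<bullet> E = 1" "E \<bullet> p = 0" "r *\<^sub>R E = X"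
        using r A by (auto simp: E_def r_def dot_square_norm power2_eq_square)
      define g where "g s = cos (s * r) *\<^sub>R p + sin (s * r) *\<^sub>R E" for s
      have g0: "g 0 = p" by (simp add: g_def)
      have "g s \<bullet> g s = 1" for s
        using E p1 sin_cos_squared_add3[of "s * r"]
        by (simp add: g_def inner_add_left inner_add_right inner_commute[of p E] algebra_simps)
      then have gs: "g s \<in> sphere 0 1" for s by (simp add: norm_eq_1)
      have g': "(g has_derivative (\<lambda>h. h *\<^sub>R X)) (at 0)"
        unfolding g_def by (auto intro!: derivative_eq_intros simp: E(3)[symmetric] fun_eq_iff mult.commute)
      have Yg: "((\<lambda>s. Y (g s)) has_derivative (\<lambda>h. dirderiv (h *\<^sub>R X) Y p)) (at 0)"
        using has_derivative_compose[OF g'] DY g0 by simp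
      have "((\<lambda>s. Y (g s) \<bullet> g s) has_derivative (\<lambda>h. Y p \<bullet> (h *\<^sub>R X) + dirderiv (h *\<^sub>R X) Y p \<bullet> p)) (at 0)"
        using has_derivative_inner[OF Yg g'] by (simp add: g0)
      moreover have "(\<lambda>s. Y (g s) \<bullet> g s) = (\<lambda>_. 0)" using A gs by auto
      ultimately have "((\<lambda>_::real. 0::real) has_derivative (\<lambda>h. Y p \<bullet> (h *\<^sub>R X) + dirderiv (h *\<^sub>R X) Y p \<bullet> p)) (at 0)"
        by simp
      then have "(\<lambda>h::real. Y p \<bullet> (h *\<^sub>R X) + dirderiv (h *\<^sub>R X) Y p \<bullet> p) = (\<lambda>_. 0)"
        by (rule has_derivative_unique) (rule has_derivative_const)
      from fun_cong[OF this, of 1] show ?thesis by (simp add: inner_commute)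
    qed
    show "dirderiv (tangential_part p (dirderiv X Y p)) (\<lambda>x. x) p $ k =
        dirderiv X (\<lambda>q. dirderiv (Y q) (\<lambda>x. x) q) p $ k +
        (\<Sum>\<alpha>\<in>UNIV. \<Sum>\<beta>\<in>UNIV. sphere_christoffel p k \<alpha> \<beta> * dirderiv X (\<lambda>x. x) p $ \<alpha> * dirderiv (Y p) (\<lambda>x. x) p $ \<beta>)"
      unfolding dirderiv_ident mult.assoc sum_christoffel
      using inner_vec_def[of X "Y p"] by (simp add: tangential_part_def key)
  qed
qed

section \<open>Wave maps along a geodesic\<close>

definition geodesic_map :: "real^'m \<Rightarrow> real^'m \<Rightarrow> real \<Rightarrow> ('z \<Rightarrow> real) \<Rightarrow> 'z \<Rightarrow> real^'m::finite"
  where "geodesic_map c v e u z = cos (e * u z) *\<^sub>R c + sin (e * u z) *\<^sub>R v"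

context
  fixes c v :: "real^'m::finite"
  assumes cv: "norm c = 1" "norm v = 1" "c \<bullet> v = 0"
begin

lemma inner_cv: "c \<bullet> c = 1" "v \<bullet> v = 1" "c \<bullet> v = 0" "v \<bullet> c = 0"
  using cv by (auto simp: norm_eq_1 inner_commute)

lemma norm_geodesic_map: "norm (geodesic_map c v e u z) = 1"
  unfolding norm_eq_1 geodesic_map_def
  using sin_cos_squared_add3[of "e * u z"] by (simp add: inner_add_left inner_add_right inner_cv)

text \<open>Turning the frame (c, v) into (v, -c) sends the map to the unit tangent \<open>N\<close>
  of the great circle; turning it twice gives minus the map, which produces the normal term of the
  second derivative.\<close>

lemma geodesic_map_derivatives:
  fixes u :: "'z::euclidean_space \<Rightarrow> real" and e :: real
  assumes u: "\<And>k. smooth_upto UNIV k u"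
  defines "N \<equiv> geodesic_map v (- c) e u"
  shows "dirderiv w (geodesic_map c v e u) z = (e * dirderiv w u z) *\<^sub>R N z"
    and "dirderiv w (dirderiv w (geodesic_map c v e u)) z
      = (e * dirderiv w (dirderiv w u) z) *\<^sub>R N z - (e * dirderiv w u z)\<^sup>2 *\<^sub>R geodesic_map c v e u z"
proof -
  have u1: "(u has_derivative (\<lambda>w. dirderiv w u z)) (at z)" for z by (rule ders_has_derivative[OF u]) simp
  have u2: "(dirderiv w u has_derivative (\<lambda>w'. dirderiv w' (dirderiv w u) z)) (at z)" for z w
    by (rule ders_has_derivative[OF ders_dirderiv[OF u]]) simp
  have G: "(geodesic_map a b e u has_derivative (\<lambda>w. (e * dirderiv w u z) *\<^sub>R geodesic_map b (- a) e u z)) (at z)"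
    for a b :: "real^'m" and z
    unfolding geodesic_map_def
    by (auto intro!: derivative_eq_intros u1 simp: fun_eq_iff algebra_simps)
  show 1: "dirderiv w (geodesic_map c v e u) z = (e * dirderiv w u z) *\<^sub>R N z" for w z
    unfolding N_def by (rule dirderiv_eqI[OF G])
  have "((\<lambda>z. (e * dirderiv w u z) *\<^sub>R N z) has_derivative
    (\<lambda>w'. (e * dirderiv w u z) *\<^sub>R ((e * dirderiv w' u z) *\<^sub>R geodesic_map (- c) (- v) e u z) + (e * dirderiv w' (dirderiv w u) z) *\<^sub>R N z)) (at z)"
    unfolding N_def by (intro has_derivative_scaleR G has_derivative_mult_right u2)
  from dirderiv_eqI[OF this, of w]
  have "dirderiv w (\<lambda>z. (e * dirderiv w u z) *\<^sub>R N z) z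
    = (e * dirderiv w u z) *\<^sub>R ((e * dirderiv w u z) *\<^sub>R geodesic_map (- c) (- v) e u z) + (e * dirderiv w (dirderiv w u) z) *\<^sub>R N z" .
  moreover have "geodesic_map (- c) (- v) e u z = - geodesic_map c v e u z" by (simp add: geodesic_map_def)
  moreover have "dirderiv w (geodesic_map c v e u) = (\<lambda>z. (e * dirderiv w u z) *\<^sub>R N z)" by (rule ext) (rule 1)
  ultimately show "dirderiv w (dirderiv w (geodesic_map c v e u)) z
      = (e * dirderiv w (dirderiv w u) z) *\<^sub>R N z - (e * dirderiv w u z)\<^sup>2 *\<^sub>R geodesic_map c v e u z"
    by (simp add: power2_eq_square)
qed

lemma smooth_upto_geodesic_map:
  assumes u: "\<And>k. smooth_upto UNIV k u"
  shows "smooth_upto UNIV k (geodesic_map c v e u)"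
proof -
  have eu: "smooth_upto UNIV k (\<lambda>z. e * u z)" by (rule smooth_upto_mult[OF open_UNIV smooth_upto_const[OF open_UNIV] u])
  show ?thesis unfolding geodesic_map_def[abs_def]
    by (rule smooth_upto_add[OF open_UNIV
        smooth_upto_bounded_linear[OF open_UNIV bounded_linear_scaleR_left smooth_upto_cos_sin(1)[OF open_UNIV eu]]
        smooth_upto_bounded_linear[OF open_UNIV bounded_linear_scaleR_left smooth_upto_cos_sin(2)[OF open_UNIV eu]]])
qed

text \<open>The wave operator of the map is e (Box u) N - e^2 E phi, where E is the Minkowski square
  of the gradient of u. The first term vanishes as u is a free wave; the Christoffel term is e^2 E
  phi, because N has length 1, and cancels the second.\<close>

lemma geodesic_wave_map_equation:
  fixes z :: "(real^'n::finite) \<times> real"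
  assumes u: "\<And>k. smooth_upto UNIV k u" and eq: "(\<Sum>i\<in>UNIV. dx i (dx i u) z) = dt (dt u) z"
  shows "wave_map_equation sphere_christoffel (geodesic_map c v e u) z"
  unfolding wave_map_equation_def sum_christoffel
proof
  fix k
  let ?\<phi> = "geodesic_map c v e u" and ?N = "geodesic_map v (- c) e u"
  define E where "E = (\<Sum>i\<in>UNIV. (dx i u z)\<^sup>2) - (dt u z)\<^sup>2"
  have N1: "(\<Sum>\<alpha>\<in>UNIV. ?N z $ \<alpha> * ?N z $ \<alpha>) = 1"
  proof -
    have "?N z \<bullet> ?N z = 1" unfolding geodesic_map_def
      using sin_cos_squared_add3[of "e * u z"] by (simp add: inner_add_left inner_add_right inner_diff_left inner_diff_right inner_cv)
    then show ?thesis by (simp add: inner_vec_def)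
  qed
  note D = geodesic_map_derivatives[OF u]
  have "box_op ?\<phi> z = (e * ((\<Sum>i\<in>UNIV. dx i (dx i u) z) - dt (dt u) z)) *\<^sub>R ?N z - (e\<^sup>2 * E) *\<^sub>R ?\<phi> z"
    unfolding box_op_def D E_def
    by (simp add: sum_subtractf scaleR_sum_left[symmetric] sum_distrib_left[symmetric] power_mult_distrib algebra_simps)
  then have b: "box_op ?\<phi> z $ k = - (e\<^sup>2 * E) * ?\<phi> z $ k" using eq by simp
  have "(\<Sum>\<alpha>\<in>UNIV. (\<Sum>i\<in>UNIV. dx i ?\<phi> z $ \<alpha> * dx i ?\<phi> z $ \<alpha>) - dt ?\<phi> z $ \<alpha> * dt ?\<phi> z $ \<alpha>)
    = (\<Sum>\<alpha>\<in>UNIV. e\<^sup>2 * E * (?N z $ \<alpha> * ?N z $ \<alpha>))"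
    unfolding D E_def
    by (intro sum.cong refl) (simp add: power2_eq_square sum_distrib_left sum_distrib_right algebra_simps)
  also have "\<dots> = e\<^sup>2 * E" unfolding sum_distrib_left[symmetric] N1 by simp
  finally show "box_op ?\<phi> z $ k + ?\<phi> z $ k * (\<Sum>\<alpha>\<in>UNIV. (\<Sum>i\<in>UNIV. dx i ?\<phi> z $ \<alpha> * dx i ?\<phi> z $ \<alpha>) - dt ?\<phi> z $ \<alpha> * dt ?\<phi> z $ \<alpha>) = 0"
    using b by simp
qed

lemma schwartz_geodesic_map:
  assumes "u \<in> schwartz"
  shows "(\<lambda>x. geodesic_map c v e u x - c) \<in> schwartz"
proof -
  have eu: "(\<lambda>x. e * u x) \<in> schwartz" by (rule schwartz_bounded_linear[OF bounded_linear_mult_right assms])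
  have "(\<lambda>x. (cos (e * u x) - 1) *\<^sub>R c + sin (e * u x) *\<^sub>R v) \<in> schwartz"
    by (rule schwartz_add[OF schwartz_bounded_linear[OF bounded_linear_scaleR_left schwartz_sin_cos(4)[OF eu]]
          schwartz_bounded_linear[OF bounded_linear_scaleR_left schwartz_sin_cos(3)[OF eu]]])
  then show ?thesis by (simp add: geodesic_map_def algebra_simps)
qed

lemma target_position_geodesic_map:
  fixes u :: "real^'n::finite \<Rightarrow> real"
  assumes "u \<in> schwartz"
  shows "target_position (sphere 0 1) c (geodesic_map c v e u)"
  unfolding target_position_def
proof (intro conjI)
  note S = schwartz_geodesic_map[OF assms, of e]
  show "dist_of (\<lambda>x. geodesic_map c v e u x - c) \<in> fst (sobolev (real CARD('n) / 2))" by (rule sobolev_dist_of[OF S])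
  have "(\<lambda>x. (geodesic_map c v e u x - c) + c) \<in> borel_measurable borel"
    using schwartz_measurable[OF S] by measurable
  then show "geodesic_map c v e u \<in> borel_measurable lborel" by simp
  show "AE x in lborel. geodesic_map c v e u x \<in> sphere 0 1" by (simp add: norm_geodesic_map)
  have "1 + (norm x)\<^sup>2 \<noteq> 0" for x :: "real^'n" by (metis add_pos_nonneg less_irrefl zero_le_power2 zero_less_one)
  with schwartz_weight_integrable[OF S, of 0] show "integrable lborel (\<lambda>x. (norm (geodesic_map c v e u x - c))\<^sup>2)" by simp
qed

lemma schwartz_slow_fun:
  fixes f :: "real^'n::finite \<Rightarrow> real^'k::finite"
  assumes "f \<in> schwartz" shows "slow_fun f"
  unfolding slow_fun_def
  using schwartz_measurable[OF assms] schwartz_integrable[OF schwartz_bilinear[OF bounded_bilinear_scaleR _ assms]]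
  by simp

lemma classical_geodesic_wave:
  fixes T e :: real
  assumes R: "R > 0"
  shows "classical_wave_map (sphere 0 1) (\<lambda>x. x) sphere_christoffel c T
    (geodesic_map c v e (wave R T) :: (real^'n::finite) \<times> real \<Rightarrow> real^'m)"
  unfolding classical_wave_map_def
proof (intro conjI allI ballI)
  let ?\<phi> = "geodesic_map c v e (wave R T) :: (real^'n) \<times> real \<Rightarrow> real^'m"
  have u: "smooth_upto UNIV k (wave R T :: (real^'n) \<times> real \<Rightarrow> real)" for k by (rule smooth_upto_wave[OF R])
  show "\<exists>W. UNIV \<times> {0..T} \<subseteq> W \<and> smooth_on W ?\<phi>"
    by (rule exI[of _ UNIV]) (simp add: smooth_on_iff_ders smooth_upto_geodesic_map[OF u])
  show "?\<phi> (x, t) \<in> (\<lambda>x. x) ` sphere 0 1" for x t by (simp add: norm_geodesic_map)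
  show "wave_map_equation sphere_christoffel ?\<phi> (x, t)" for x t
    by (rule geodesic_wave_map_equation[OF u wave_equation[OF R]])
  fix t
  have e: "geodesic_map c v e (wave R T) (x, t) = geodesic_map c v e (\<lambda>x. wave R T (x, t)) x" for x :: "real^'n"
    by (simp add: geodesic_map_def)
  have "target_position (sphere 0 1) c (geodesic_map c v e (\<lambda>x::real^'n. wave R T (x, t)))"
    by (rule target_position_geodesic_map[OF schwartz_wave[OF R]])
  then show "target_position ((\<lambda>x. x) ` sphere 0 1) c (\<lambda>x. ?\<phi> (x, t))"
    unfolding e by simp
  have eu: "(\<lambda>x::real^'n. e * wave R T (x, t)) \<in> schwartz"
    by (rule schwartz_bounded_linear[OF bounded_linear_mult_right schwartz_wave[OF R]])
  have ed: "(\<lambda>x::real^'n. e * dt (wave R T) (x, t)) \<in> schwartz"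
    by (rule schwartz_bounded_linear[OF bounded_linear_mult_right schwartz_dt_wave[OF R]])
  have "(\<lambda>x::real^'n. (cos (e * wave R T (x, t)) * (e * dt (wave R T) (x, t))) *\<^sub>R v
      + (sin (e * wave R T (x, t)) * (e * dt (wave R T) (x, t))) *\<^sub>R (- c)) \<in> schwartz"
    by (intro schwartz_add schwartz_bounded_linear[OF bounded_linear_scaleR_left]
        schwartz_bilinear_bdd[OF bounded_bilinear_mult schwartz_sin_cos(1)[OF eu] ed]
        schwartz_bilinear_bdd[OF bounded_bilinear_mult schwartz_sin_cos(2)[OF eu] ed])
  moreover have "dt ?\<phi> (x, t) = (cos (e * wave R T (x, t)) * (e * dt (wave R T) (x, t))) *\<^sub>R v
      + (sin (e * wave R T (x, t)) * (e * dt (wave R T) (x, t))) *\<^sub>R (- c)" for x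
    unfolding geodesic_map_derivatives(1)[OF u] by (simp add: geodesic_map_def algebra_simps)
  ultimately have S: "(\<lambda>x. dt ?\<phi> (x, t)) \<in> schwartz" by simp
  show "slow_fun (\<lambda>x. dt ?\<phi> (x, t))" by (rule schwartz_slow_fun[OF S])
  show "dist_of (\<lambda>x. dt ?\<phi> (x, t)) \<in> fst (sobolev (real CARD('n) / 2 - 1))" by (rule sobolev_dist_of[OF S])
qed

end

section \<open>Failure of the second derivative\<close>

lemma dist_of_scaleR:
  fixes f :: "real^'n::finite \<Rightarrow> real^'m::finite"
  shows "dist_of (\<lambda>x. e *\<^sub>R f x) = e *\<^sub>R dist_of f"
proof
  fix \<psi> :: "real^'n \<Rightarrow> real"
  have eq: "(\<lambda>x. \<psi> x *\<^sub>R e *\<^sub>R f x) = (\<lambda>x. e *\<^sub>R (\<psi> x *\<^sub>R f x))"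
    by (rule ext) (rule scaleR_left_commute)
  show "dist_of (\<lambda>x. e *\<^sub>R f x) \<psi> = (e *\<^sub>R dist_of f) \<psi>"
    unfolding dist_of_def scaleR_fun_def eq integral_scaleR_right by (cases "\<psi> \<in> schwartz") simp_all
qed

text \<open>By inversion the velocity has transform C |xi| \<open>amp\<close>. For |xi| > 1 the
  weight satisfies (1 + |xi|^2)^(n/2-1) |xi|^2 <= 2^(n/2) |xi|^n, and the two inverse powers in
  \<open>amp\<close>^2 leave |xi|^(-n) sin^2 times the squared cutoff.\<close>

lemma wave_velocity_norm:
  fixes v :: "real^'m::finite" and C :: complex
  assumes R: "R > 0" and v: "norm v = 1"
    and inv: "\<And>(a :: real^'n::finite \<Rightarrow> complex) y. a \<in> schwartz \<Longrightarrow> fourier (fourier a) y = C * a (- y)"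
  shows "(snd (sobolev (real CARD('n) / 2 - 1)) (dist_of (\<lambda>x::real^'n. dt (wave R T) (x, 0) *\<^sub>R v)))\<^sup>2
    \<le> (cmod C)\<^sup>2 * 2 powr (real CARD('n) / 2) * mass TYPE(real^'n) R T"
proof -
  define s where "s = real CARD('n) / 2 - 1"
  let ?b = "\<lambda>\<xi>::real^'n. complex_of_real (norm \<xi> * amp R T \<xi>)"
  have b: "?b \<in> schwartz" using schwartz_amp(2)[OF R, of 0 T, where 'a="real^'n"] by simp
  have G: "(\<lambda>x::real^'n. dt (wave R T) (x, 0) *\<^sub>R v) \<in> schwartz"
    by (rule schwartz_bounded_linear[OF bounded_linear_scaleR_left schwartz_dt_wave[OF R]])
  let ?h = "\<lambda>\<xi>::real^'n. \<chi> k. complex_of_real (v $ k) * (C * ?b \<xi>)"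
  have "fourier (\<lambda>x::real^'n. complex_of_real ((dt (wave R T) (x, 0) *\<^sub>R v) $ k)) \<xi> = complex_of_real (v $ k) * (C * ?b \<xi>)" for k \<xi>
  proof -
    have "fourier (\<lambda>x::real^'n. complex_of_real ((dt (wave R T) (x, 0) *\<^sub>R v) $ k)) \<xi>
      = fourier (\<lambda>x. complex_of_real (v $ k) * fourier ?b x) \<xi>"
      by (simp add: dt_wave_0[OF R] mult.commute)
    also have "\<dots> = complex_of_real (v $ k) * fourier (fourier ?b) \<xi>"
      unfolding fourier_def[of "\<lambda>x. complex_of_real (v $ k) * fourier ?b x"] fourier_def[of "fourier ?b"]
      by (simp add: mult.left_commute)
    also have "\<dots> = complex_of_real (v $ k) * (C * ?b \<xi>)" unfolding inv[OF b] by (simp add: amp_minus)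
    finally show ?thesis .
  qed
  note eq = this
  have F: "has_fourier (dist_of (\<lambda>x::real^'n. dt (wave R T) (x, 0) *\<^sub>R v)) ?h"
    using has_fourier_dist_of[OF G] unfolding eq .
  have nh: "(norm (?h \<xi>))\<^sup>2 = (cmod C)\<^sup>2 * (norm \<xi>)\<^sup>2 * (amp R T \<xi>)\<^sup>2" for \<xi>
  proof -
    have "(norm v)\<^sup>2 = (\<Sum>k\<in>UNIV. (v $ k)\<^sup>2)" unfolding power2_norm_eq_inner by (simp add: inner_vec_def power2_eq_square)
    then have "(\<Sum>k\<in>UNIV. (v $ k)\<^sup>2 * (cmod (C * ?b \<xi>))\<^sup>2) = (cmod (C * ?b \<xi>))\<^sup>2"
      unfolding sum_distrib_right[symmetric] by (simp add: v)
    moreover have "(norm (?h \<xi>))\<^sup>2 = (\<Sum>k\<in>UNIV. (v $ k)\<^sup>2 * (cmod (C * ?b \<xi>))\<^sup>2)"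
      unfolding norm_vec_def L2_set_def by (simp add: sum_nonneg norm_mult power_mult_distrib)
    ultimately show ?thesis by (simp add: norm_mult power_mult_distrib)
  qed
  have bound: "sobolev_weight s ?h \<xi> \<le> (cmod C)\<^sup>2 * 2 powr (real CARD('n) / 2) * (sin (T * norm \<xi>) * amp R T \<xi>)" for \<xi>
  proof (cases "norm \<xi> \<le> 1")
    case True
    then have "amp R T \<xi> = 0" by (simp add: amp_def cutoff_eq_0)
    then show ?thesis unfolding sobolev_weight_def nh by simp
  next
    case False
    define y where "y = norm \<xi>"
    define q where "q = inverse y ^ CARD('n) * (sin (T * y))\<^sup>2"
    have y: "y > 1" using False by (simp add: y_def)
    have pos: "1 + y\<^sup>2 > 0" by (auto intro: add_pos_nonneg)
    have "(1 + y\<^sup>2) powr s * y\<^sup>2 \<le> (1 + y\<^sup>2) powr s * (1 + y\<^sup>2)" by (intro mult_left_mono) auto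
    also have "\<dots> = (1 + y\<^sup>2) powr (real CARD('n) / 2)"
      using pos powr_add[of "1 + y\<^sup>2" s 1] by (simp add: s_def)
    also have "\<dots> \<le> (2 * y\<^sup>2) powr (real CARD('n) / 2)"
      using y pos power_mono[of 1 y 2] by (intro powr_mono2) auto
    also have "\<dots> = 2 powr (real CARD('n) / 2) * (y powr 2) powr (real CARD('n) / 2)"
      using y by (simp add: powr_mult)
    also have "(y powr 2) powr (real CARD('n) / 2) = y ^ CARD('n)"
      unfolding powr_powr using y by (simp add: powr_realpow)
    finally have w: "(1 + y\<^sup>2) powr s * y\<^sup>2 \<le> 2 powr (real CARD('n) / 2) * y ^ CARD('n)" .
    have yi: "y ^ CARD('n) * (inverse y ^ CARD('n) * inverse y ^ CARD('n)) = inverse y ^ CARD('n)"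
      using y by (simp add: power_mult_distrib[symmetric] mult.assoc[symmetric])
    have q0: "0 \<le> q" using y by (simp add: q_def)
    \<comment> \<open>The integrand of \<open>mass\<close> contains the cutoff to the first power
      only; as it lies between 0 and 1, its square may be replaced by itself.\<close>
    have c2: "(cutoff R \<xi>)\<^sup>2 \<le> cutoff R \<xi>"
      using mult_left_mono[OF cutoff_bounds(2) cutoff_bounds(1), of R \<xi> R \<xi>] by (simp add: power2_eq_square)
    have "((1 + y\<^sup>2) powr s * y\<^sup>2) * (amp R T \<xi>)\<^sup>2 \<le> (2 powr (real CARD('n) / 2) * y ^ CARD('n)) * (amp R T \<xi>)\<^sup>2"
      using w by (rule mult_right_mono) simp
    also have "(2 powr (real CARD('n) / 2) * y ^ CARD('n)) * (amp R T \<xi>)\<^sup>2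
      = 2 powr (real CARD('n) / 2) * (cutoff R \<xi>)\<^sup>2 * ((y ^ CARD('n) * (inverse y ^ CARD('n) * inverse y ^ CARD('n))) * (sin (T * y))\<^sup>2)"
      by (simp add: amp_def y_def power2_eq_square mult_ac)
    also have "\<dots> = 2 powr (real CARD('n) / 2) * (cutoff R \<xi>)\<^sup>2 * q" unfolding yi q_def ..
    also have "\<dots> \<le> 2 powr (real CARD('n) / 2) * cutoff R \<xi> * q"
      using q0 by (intro mult_right_mono mult_left_mono c2) auto
    also have "\<dots> = 2 powr (real CARD('n) / 2) * (sin (T * norm \<xi>) * amp R T \<xi>)"
      by (simp add: amp_def q_def y_def power2_eq_square mult_ac)
    finally have "(cmod C)\<^sup>2 * (((1 + y\<^sup>2) powr s * y\<^sup>2) * (amp R T \<xi>)\<^sup>2)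
      \<le> (cmod C)\<^sup>2 * (2 powr (real CARD('n) / 2) * (sin (T * norm \<xi>) * amp R T \<xi>))"
      by (rule mult_left_mono) simp
    then show ?thesis unfolding sobolev_weight_def nh y_def by (simp only: mult_ac)
  qed
  have ia: "integrable lborel (\<lambda>\<xi>::real^'n. (cmod C)\<^sup>2 * 2 powr (real CARD('n) / 2) * (sin (T * norm \<xi>) * amp R T \<xi>))"
    by (intro integrable_mult_right schwartz_integrable schwartz_sin_amp R)
  have nn: "0 \<le> (LINT \<xi>|lborel. sobolev_weight s ?h \<xi>)"
    by (intro integral_nonneg_AE) (simp add: sobolev_weight_nonneg)
  have "(snd (sobolev s) (dist_of (\<lambda>x::real^'n. dt (wave R T) (x, 0) *\<^sub>R v)))\<^sup>2 = (LINT \<xi>|lborel. sobolev_weight s ?h \<xi>)"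
    unfolding sobolev_norm_eq[OF F] using nn by simp
  also have "\<dots> \<le> (LINT \<xi>::real^'n|lborel. (cmod C)\<^sup>2 * 2 powr (real CARD('n) / 2) * (sin (T * norm \<xi>) * amp R T \<xi>))"
  proof (rule integral_mono')
    show "0 \<le> (cmod C)\<^sup>2 * 2 powr (real CARD('n) / 2) * (sin (T * norm \<xi>) * amp R T \<xi>)" for \<xi> :: "real^'n"
      using sin_amp_nonneg[of T \<xi> R] by simp
  qed (rule ia, rule bound)
  finally show ?thesis unfolding s_def mass_def by (simp only: integral_mult_right_zero)
qed

lemma fourier_bump_real:
  assumes "r > 0"
  shows "fourier (\<lambda>\<xi>::'a::euclidean_space. complex_of_real (bump r \<xi>)) x
    = complex_of_real (Re (fourier (\<lambda>\<xi>::'a. complex_of_real (bump r \<xi>)) x))"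
proof -
  have "fourier (\<lambda>\<xi>::'a. complex_of_real (bump r \<xi>)) x \<in> \<real>"
    by (rule fourier_real_even[OF schwartz_measurable[OF schwartz_of_real[OF schwartz_bump[OF assms]]]])
      (auto simp: bump_minus)
  then show ?thesis by (simp add: of_real_Re)
qed

text \<open>On the Fourier side, testing the square of the wave against the bump integrates the
  convolution of its nonnegative Fourier transform with itself over a set containing its support.\<close>

lemma wave_square_test:
  fixes C :: complex
  assumes R: "R > 0"
    and inv: "\<And>(a :: real^'n::finite \<Rightarrow> complex) y. a \<in> schwartz \<Longrightarrow> fourier (fourier a) y = C * a (- y)"
  defines "\<theta> \<equiv> \<lambda>x::real^'n. Re (fourier (\<lambda>\<xi>. complex_of_real (bump (3 * R) \<xi>)) x)"
  shows "cmod C * flat 1 (5 / 9) * (mass TYPE(real^'n) R T)\<^sup>2 \<le> \<bar>LINT x|lborel. (wave R T (x, T))\<^sup>2 * \<theta> x\<bar>"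
proof -
  let ?a = "\<lambda>\<xi>::real^'n. sin (T * norm \<xi>) * amp R T \<xi>"
  let ?A = "\<lambda>\<xi>::real^'n. complex_of_real (?a \<xi>)"
  let ?p = "\<lambda>\<xi>::real^'n. complex_of_real (bump (3 * R) \<xi>)"
  have a: "?a \<in> schwartz" by (rule schwartz_sin_amp[OF R])
  have A: "?A \<in> schwartz" by (rule schwartz_of_real[OF a])
  have p: "?p \<in> schwartz" using R by (intro schwartz_of_real schwartz_bump) simp
  note FA = schwartz_fourier[OF A] and Fp = schwartz_fourier[OF p]
  have "(bump (3 * R) :: real^'n \<Rightarrow> real) \<in> schwartz" using R by (intro schwartz_bump) simp
  note [measurable] = schwartz_measurable[OF this] schwartz_measurable[OF a] schwartz_measurable[OF p] schwartz_measurable[OF Fp]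
  \<comment> \<open>Integrating \<open>b\<close> against the transform of the wave gives the double
    integral of the two transforms at xi and eta times the bump at xi + eta: the pairing of the
    convolution square with the bump.\<close>
  define b where "b \<xi> = (LINT \<eta>|lborel. ?a \<eta> * bump (3 * R) (\<eta> + \<xi>))" for \<xi> :: "real^'n"
  have bi: "integrable lborel (\<lambda>\<eta>. ?a \<eta> * bump (3 * R) (\<eta> + \<xi>))" for \<xi>
    by (rule Bochner_Integration.integrable_bound[OF schwartz_integrable[OF a]])
      (auto simp: abs_mult bump_nonneg bump_le_1 intro!: mult_left_le)
  have prod: "(\<lambda>x. fourier ?A x * fourier ?p x) \<in> schwartz"
    by (rule schwartz_bilinear[OF bounded_bilinear_mult FA Fp])
  have inner: "fourier (\<lambda>x. fourier ?A x * fourier ?p x) \<xi> = C * complex_of_real (b \<xi>)" for \<xi>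
  proof -
    have i: "integrable lborel (\<lambda>x. cis (- (x \<bullet> \<xi>)) * fourier ?p x)"
      using moments_integrable[OF schwartz_moments[OF Fp], of \<xi>] by (simp add: inner_commute)
    have "fourier (\<lambda>x. cis (- (x \<bullet> \<xi>)) * fourier ?p x) \<eta> = fourier (fourier ?p) (\<eta> + \<xi>)" for \<eta>
      unfolding fourier_def[of "\<lambda>x. cis (- (x \<bullet> \<xi>)) * fourier ?p x"] fourier_def[of "fourier ?p"]
      by (simp add: inner_add_right cis_mult mult.assoc[symmetric])
    then have f: "fourier (\<lambda>x. cis (- (x \<bullet> \<xi>)) * fourier ?p x) \<eta> = C * ?p (\<eta> + \<xi>)" for \<eta>
      by (simp add: inv[OF p] bump_minus[of _ "\<eta> + \<xi>", simplified])
    have "fourier (\<lambda>x. fourier ?A x * fourier ?p x) \<xi> = (LINT x|lborel. fourier ?A x * (cis (- (x \<bullet> \<xi>)) * fourier ?p x))"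
      unfolding fourier_def[of "\<lambda>x. fourier ?A x * fourier ?p x"] by (simp add: mult.left_commute)
    also have "\<dots> = (LINT \<eta>|lborel. ?A \<eta> * (C * ?p (\<eta> + \<xi>)))"
      unfolding fourier_mult_formula[OF schwartz_integrable[OF A] i] f ..
    also have "\<dots> = (LINT \<eta>|lborel. C * complex_of_real (?a \<eta> * bump (3 * R) (\<eta> + \<xi>)))"
      by (simp add: mult_ac)
    also have "\<dots> = C * complex_of_real (b \<xi>)"
      unfolding b_def integral_mult_right_zero integral_complex_of_real ..
    finally show ?thesis .
  qed
  have "complex_of_real (LINT x|lborel. (wave R T (x, T))\<^sup>2 * \<theta> x) = (LINT x|lborel. complex_of_real ((wave R T (x, T))\<^sup>2 * \<theta> x))"
    by (rule integral_complex_of_real[symmetric])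
  also have "\<dots> = (LINT x|lborel. fourier ?A x * (fourier ?A x * fourier ?p x))"
  proof (rule Bochner_Integration.integral_cong[OF refl])
    fix x :: "real^'n"
    have "complex_of_real (\<theta> x) = fourier ?p x" using fourier_bump_real[of "3 * R" x] R by (simp add: \<theta>_def)
    then show "complex_of_real ((wave R T (x, T))\<^sup>2 * \<theta> x) = fourier ?A x * (fourier ?A x * fourier ?p x)"
      using wave_T[OF R, of T x] by (simp add: power2_eq_square)
  qed
  \<comment> \<open>A second use of the multiplication formula moves the transform from one wave
    factor to the product of the other with the test function, computed in
    \<open>inner\<close>.\<close>
  also have "\<dots> = (LINT \<xi>|lborel. ?A \<xi> * (C * complex_of_real (b \<xi>)))"
    unfolding fourier_mult_formula[OF schwartz_integrable[OF A] schwartz_integrable[OF prod]] inner ..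
  also have "\<dots> = (LINT \<xi>|lborel. C * complex_of_real (?a \<xi> * b \<xi>))" by (simp add: mult_ac)
  also have "\<dots> = C * complex_of_real (LINT \<xi>|lborel. ?a \<xi> * b \<xi>)"
    unfolding integral_mult_right_zero integral_complex_of_real ..
  finally have "complex_of_real (LINT x|lborel. (wave R T (x, T))\<^sup>2 * \<theta> x) = C * complex_of_real (LINT \<xi>|lborel. ?a \<xi> * b \<xi>)" .
  from arg_cong[OF this, of cmod]
  have "\<bar>LINT x|lborel. (wave R T (x, T))\<^sup>2 * \<theta> x\<bar> = cmod C * \<bar>LINT \<xi>|lborel. ?a \<xi> * b \<xi>\<bar>"
    by (simp only: norm_mult norm_of_real)
  moreover have "flat 1 (5 / 9) * (mass TYPE(real^'n) R T)\<^sup>2 \<le> \<bar>LINT \<xi>|lborel. ?a \<xi> * b \<xi>\<bar>"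
  proof -
    have supp: "norm \<xi> \<le> R" if "?a \<xi> \<noteq> 0" for \<xi> :: "real^'n"
      using that R bump_eq_0[of R \<xi>] by (force simp: amp_def cutoff_def)
    have lower: "flat 1 (5 / 9) * mass TYPE(real^'n) R T \<le> b \<xi>" if "?a \<xi> \<noteq> 0" for \<xi>
      unfolding b_def mass_def integral_mult_right_zero[symmetric]
    proof (rule integral_mono)
      show "integrable lborel (\<lambda>\<eta>. flat 1 (5 / 9) * ?a \<eta>)" by (intro integrable_mult_right schwartz_integrable a)
      fix \<eta>
      show "flat 1 (5 / 9) * ?a \<eta> \<le> ?a \<eta> * bump (3 * R) (\<eta> + \<xi>)"
      proof (cases "?a \<eta> = 0")
        case False
        \<comment> \<open>Two frequencies of the support add up to at most 2 R. Since the bump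
          vanishes on the boundary of its ball, its radius is 3 R, and the bound is
          \<open>flat 1\<close> of 1 - (2/3)^2.\<close>
        have "norm (\<eta> + \<xi>) \<le> 2 * R" using norm_triangle_ineq[of \<eta> \<xi>] supp[OF that] supp[OF False] by linarith
        then have "flat 1 (1 - (2 * R)\<^sup>2 * inverse ((3 * R)\<^sup>2)) \<le> bump (3 * R) (\<eta> + \<xi>)" by (rule bump_ge)
        moreover have "1 - (2 * R)\<^sup>2 * inverse ((3 * R)\<^sup>2) = 5 / 9" using R by (simp add: power_mult_distrib field_simps)
        ultimately have "flat 1 (5 / 9) \<le> bump (3 * R) (\<eta> + \<xi>)" by (simp only:)
        from mult_left_mono[OF this sin_amp_nonneg[of T \<eta> R]] show ?thesis
          by (simp only: mult.commute[of "flat 1 (5 / 9)"])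
      next
        case True
        show ?thesis unfolding True by simp
      qed
    qed (rule bi)
    have q: "f * y\<^sup>2 = y * (f * y)" for f y :: real by (simp add: power2_eq_square)
    have "(LINT \<xi>::real^'n|lborel. ?a \<xi> * (flat 1 (5 / 9) * mass TYPE(real^'n) R T))
        = mass TYPE(real^'n) R T * (flat 1 (5 / 9) * mass TYPE(real^'n) R T)"
      unfolding integral_mult_left_zero mass_def ..
    then have "flat 1 (5 / 9) * (mass TYPE(real^'n) R T)\<^sup>2 = (LINT \<xi>::real^'n|lborel. ?a \<xi> * (flat 1 (5 / 9) * mass TYPE(real^'n) R T))"
      by (rule trans[OF q sym])
    also have "\<dots> \<le> (LINT \<xi>|lborel. ?a \<xi> * b \<xi>)"
    proof (rule integral_mono)
      show "integrable lborel (\<lambda>\<xi>::real^'n. ?a \<xi> * (flat 1 (5 / 9) * mass TYPE(real^'n) R T))"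
        by (intro integrable_mult_left schwartz_integrable a)
      have b_meas: "b \<in> borel_measurable borel" unfolding b_def[abs_def] by measurable
      have "\<bar>b \<xi>\<bar> \<le> (LINT \<eta>::real^'n|lborel. ?a \<eta>)" for \<xi>
      proof -
        have "0 \<le> b \<xi>" unfolding b_def
          by (intro integral_nonneg_AE AE_I2) (rule mult_nonneg_nonneg[OF sin_amp_nonneg bump_nonneg])
        moreover have "b \<xi> \<le> (LINT \<eta>::real^'n|lborel. ?a \<eta>)"
          unfolding b_def using sin_amp_nonneg[of T _ R]
          by (intro integral_mono bi schwartz_integrable a mult_left_le bump_le_1)
        ultimately show ?thesis by simp
      qed
      then have "\<bar>?a \<xi>\<bar> * \<bar>b \<xi>\<bar> \<le> \<bar>?a \<xi>\<bar> * (LINT \<eta>::real^'n|lborel. ?a \<eta>)" for \<xi> by (intro mult_left_mono) auto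
      then have le: "norm (?a \<xi> * b \<xi>) \<le> norm (?a \<xi> * (LINT \<eta>::real^'n|lborel. ?a \<eta>))" for \<xi>
        unfolding real_norm_def abs_mult by (rule order_trans) (intro mult_left_mono, auto)
      show "integrable lborel (\<lambda>\<xi>. ?a \<xi> * b \<xi>)"
        by (rule Bochner_Integration.integrable_bound[OF integrable_mult_left[OF schwartz_integrable[OF a]]])
          (use le b_meas in auto)
      show "?a \<xi> * (flat 1 (5 / 9) * mass TYPE(real^'n) R T) \<le> ?a \<xi> * b \<xi>" for \<xi>
        using lower[of \<xi>] sin_amp_nonneg[of T \<xi> R] by (cases "?a \<xi> = 0") (auto intro: mult_left_mono)
    qed
    finally show ?thesis by linarith
  qed
  ultimately show ?thesis
    using mult_left_mono[of "flat 1 (5 / 9) * (mass TYPE(real^'n) R T)\<^sup>2" _ "cmod C"] norm_ge_zero[of C]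
    by (simp only: mult.assoc)
qed

text \<open>The integral is the real part of an \<open>osc\<close> with phase map u and parameter e.
  Each derivative multiplies the density by i u, so the second one at e = 0 is minus the integral of
  u^2 theta. The moments are finite because u is bounded and theta integrable.\<close>

lemma osc_real_derivatives:
  fixes u \<theta> :: "real^'n::finite \<Rightarrow> real"
  assumes u: "u \<in> schwartz" and \<theta>: "\<theta> \<in> schwartz"
  obtains J' where "\<And>e. ((\<lambda>e. LINT x|lborel. \<theta> x * cos (e * u x)) has_real_derivative J' e) (at e)"
    "(J' has_real_derivative - (LINT x|lborel. (u x)\<^sup>2 * \<theta> x)) (at 0)"
proof -
  let ?t = "\<lambda>x. complex_of_real (\<theta> x)"
  have [measurable]: "u \<in> borel_measurable borel" "\<theta> \<in> borel_measurable borel"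
    using assms by (auto intro: schwartz_measurable)
  obtain B where B: "\<And>x. \<bar>u x\<bar> \<le> B"
    using rapid_imp_bdd[OF schwartz_rapid[OF u]] by (auto simp: bdd_def)
  have m: "moments lborel u ?t"
    unfolding moments_def
  proof (intro conjI allI)
    fix j
    show "integrable lborel (\<lambda>x. norm (u x) ^ j * norm (?t x))"
    proof (rule Bochner_Integration.integrable_bound[OF integrable_mult_right[OF schwartz_integrable[OF \<theta>], of "B ^ j"]])
      have "\<bar>u x\<bar> ^ j * \<bar>\<theta> x\<bar> \<le> B ^ j * \<bar>\<theta> x\<bar>" for x using B[of x] by (intro mult_right_mono power_mono) auto
      moreover have "B ^ j \<le> \<bar>B ^ j\<bar>" by simp
      ultimately have "\<bar>u x\<bar> ^ j * \<bar>\<theta> x\<bar> \<le> \<bar>B ^ j\<bar> * \<bar>\<theta> x\<bar>" for x by (meson abs_ge_zero mult_right_mono order_trans)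
      then show "AE x in lborel. norm (norm (u x) ^ j * norm (?t x)) \<le> norm (B ^ j * \<theta> x)" by (simp add: abs_mult power_abs)
    qed simp
  qed auto
  let ?h = "\<lambda>x. \<i> * of_real (1 \<bullet> u x) * ?t x"
  note m1 = moments_dirderiv[OF m, of 1]
  define J' where "J' e = Re (osc lborel u ?h e)" for e
  have D: "((\<lambda>e. Re (osc lborel u h e)) has_real_derivative Re (osc lborel u (\<lambda>x. \<i> * of_real (1 \<bullet> u x) * h x) e)) (at e)"
    if "moments lborel u h" for h and e
  proof -
    have "((\<lambda>e. Re (osc lborel u h e)) has_derivative (\<lambda>d. Re (osc lborel u (\<lambda>x. \<i> * of_real (d \<bullet> u x) * h x) e))) (at e)"
      by (rule bounded_linear.has_derivative[OF bounded_linear_Re osc_has_derivative[OF that]])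
    moreover have "(\<lambda>d. Re (osc lborel u (\<lambda>x. \<i> * of_real (d \<bullet> u x) * h x) e)) = (*) (Re (osc lborel u (\<lambda>x. \<i> * of_real (1 \<bullet> u x) * h x) e))"
    proof
      fix d
      have "osc lborel u (\<lambda>x. \<i> * of_real (d \<bullet> u x) * h x) e = of_real d * osc lborel u (\<lambda>x. \<i> * of_real (1 \<bullet> u x) * h x) e"
        unfolding osc_def by (simp add: mult_ac flip: integral_mult_right_zero)
      moreover have "Re (of_real d * z) = Re z * d" for z by simp
      ultimately show "Re (osc lborel u (\<lambda>x. \<i> * of_real (d \<bullet> u x) * h x) e) = Re (osc lborel u (\<lambda>x. \<i> * of_real (1 \<bullet> u x) * h x) e) * d"
        by (simp only:)
    qed
    ultimately show ?thesis by (simp only: has_field_derivative_def)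
  qed
  have "Re (osc lborel u ?t e) = (LINT x|lborel. \<theta> x * cos (e * u x))" for e
    unfolding osc_def integral_Re[OF moments_integrable[OF m], symmetric] by (simp add: mult.commute)
  with D[OF m] have "((\<lambda>e. LINT x|lborel. \<theta> x * cos (e * u x)) has_real_derivative J' e) (at e)" for e
    by (simp add: J'_def)
  moreover have "Re (osc lborel u (\<lambda>x. \<i> * of_real (1 \<bullet> u x) * ?h x) 0) = - (LINT x|lborel. (u x)\<^sup>2 * \<theta> x)"
    unfolding osc_def integral_Re[OF moments_integrable[OF moments_dirderiv[OF m1]], symmetric]
    by (simp add: power2_eq_square mult_ac)
  with D[OF m1, of 0] have "(J' has_real_derivative - (LINT x|lborel. (u x)\<^sup>2 * \<theta> x)) (at 0)"
    by (simp add: J'_def[abs_def])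
  ultimately show ?thesis by (rule that)
qed

theorem proposition8p3:
  assumes "CARD('m::finite) \<ge> 2"
  shows "\<exists>U \<Psi> (\<Gamma> :: 'm christoffel). sphere_coordinates U \<Psi> \<Gamma> \<and>
    (\<forall>c\<in>\<Psi> ` U. \<forall>T>0. \<forall>(D :: (('n::finite, 'm) dist \<times> ('n, 'm) dist) set) S.
       solution_operator U \<Psi> \<Gamma> c T D S \<longrightarrow>
       \<not> twice_differentiable_within
           (sobolev_pair (real CARD('n) / 2)) (sobolev (real CARD('n) / 2)) S D)"
proof (intro exI conjI ballI allI impI notI)
  show "sphere_coordinates (sphere 0 1 :: (real^'m) set) (\<lambda>x. x) sphere_christoffel"
    by (rule sphere_coordinates_ident)
  fix c :: "real^'m" and T :: real and D :: "(('n, 'm) dist \<times> ('n, 'm) dist) set" and S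
  assume c: "c \<in> (\<lambda>x. x) ` sphere 0 1" and T: "T > 0"
    and sol: "solution_operator (sphere 0 1) (\<lambda>x. x) sphere_christoffel c T D S"
    and "twice_differentiable_within (sobolev_pair (real CARD('n) / 2)) (sobolev (real CARD('n) / 2)) S D"
  define s where "s = real CARD('n) / 2"
  define X where "X = (sobolev_pair s :: (('n, 'm) dist \<times> ('n, 'm) dist) normed_space)"
  define Y where "Y = (sobolev s :: (('n, 'm) dist) normed_space)"
  obtain F' F'' where d: "\<And>p. p \<in> D \<Longrightarrow> frechet_deriv_within X Y S (F' p) p D"
      "\<And>p. p \<in> D \<Longrightarrow> frechet_deriv_within X (bounded_linear_maps X Y) F' (F'' p) p D"
    using \<open>twice_differentiable_within _ _ _ _\<close> unfolding twice_differentiable_within_def X_def Y_def s_def by blast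
  have c1: "norm c = 1" using c by simp
  \<comment> \<open>The hypothesis on the dimension enters here: the sphere needs a tangent
    direction at c.\<close>
  obtain v :: "real^'m" where v: "norm v = 1" "c \<bullet> v = 0"
  proof -
    have "2 \<le> DIM(real^'m)" using assms by simp
    then obtain y where y: "y \<noteq> 0" "orthogonal c y" using orthogonal_to_vector_exists by metis
    have "norm (y /\<^sub>R norm y) = 1" "c \<bullet> (y /\<^sub>R norm y) = 0"
      using y by (auto simp: orthogonal_def)
    then show ?thesis by (rule that)
  qed
  note cv = c1 v
  obtain C :: complex where C: "C \<noteq> 0"
    "\<And>(a :: real^'n \<Rightarrow> complex) y. a \<in> schwartz \<Longrightarrow> fourier (fourier a) y = C * a (- y)"
    by (rule fourier_inversion, rule that)
  \<comment> \<open>The constant position does not lie in H^(n/2), but only differences of data are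
    measured, and along the lines used below their position component is 0.\<close>
  define p0 :: "('n, 'm) dist \<times> ('n, 'm) dist" where "p0 = (dist_of (\<lambda>x. c), 0)"
  define G where "G R = dist_of (\<lambda>x::real^'n. dt (wave R T) (x, 0) *\<^sub>R v)" for R
  have path: "(dist_of (\<lambda>x. c), e *\<^sub>R G R) \<in> D"
    and Sp: "S (dist_of (\<lambda>x. c), e *\<^sub>R G R) = dist_of (\<lambda>x. geodesic_map c v e (wave R T) (x, T))"
    if R: "R > 0" for R e
  proof -
    let ?\<phi> = "geodesic_map c v e (wave R T) :: (real^'n) \<times> real \<Rightarrow> real^'m"
    have 0: "?\<phi> (x, 0) = c" for x by (simp add: geodesic_map_def wave_0[OF R])
    have "dt ?\<phi> (x, 0) = e *\<^sub>R (dt (wave R T) (x, 0) *\<^sub>R v)" for x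
      unfolding geodesic_map_derivatives(1)[OF cv smooth_upto_wave[OF R]] by (simp add: geodesic_map_def wave_0[OF R])
    then have "dist_of (\<lambda>x. dt ?\<phi> (x, 0)) = e *\<^sub>R G R" by (simp only: G_def dist_of_scaleR)
    moreover have "(\<lambda>x. ?\<phi> (x, 0)) = (\<lambda>x. c)" using 0 by (rule ext)
    moreover have "(dist_of (\<lambda>x. ?\<phi> (x, 0)), dist_of (\<lambda>x. dt ?\<phi> (x, 0))) \<in> D \<and>
        S (dist_of (\<lambda>x. ?\<phi> (x, 0)), dist_of (\<lambda>x. dt ?\<phi> (x, 0))) = dist_of (\<lambda>x. ?\<phi> (x, T))"
      using sol classical_geodesic_wave[OF cv R, of T e, where 'n='n] unfolding solution_operator_def by blast
    ultimately have "(dist_of (\<lambda>x. c), e *\<^sub>R G R) \<in> D \<and> S (dist_of (\<lambda>x. c), e *\<^sub>R G R) = dist_of (\<lambda>x. ?\<phi> (x, T))"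
      by (simp only:)
    then show "(dist_of (\<lambda>x. c), e *\<^sub>R G R) \<in> D"
      "S (dist_of (\<lambda>x. c), e *\<^sub>R G R) = dist_of (\<lambda>x. ?\<phi> (x, T))" by (rule conjunct1, rule conjunct2)
  qed
  have p0D: "p0 \<in> D" using path[of 1 0] by (simp add: p0_def)
  \<comment> \<open>All lines, for every R, pass through the same constant data at e = 0. Hence one
    second derivative and one bound \<open>K\<close> serve all R.\<close>
  define F2 where "F2 = F'' p0"
  have F2: "F2 \<in> fst (bounded_linear_maps X (bounded_linear_maps X Y))"
    using d(2)[OF p0D] by (auto simp: frechet_deriv_within_def F2_def)
  obtain K where K: "\<And>w. w \<in> fst X \<Longrightarrow> F2 w w \<in> fst Y" "\<And>w. w \<in> fst X \<Longrightarrow> snd Y (F2 w w) \<le> K * (snd X w)\<^sup>2"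
    using second_derivative_bounded[of F2 s] F2 unfolding X_def Y_def by metis
  define m where "m = real CARD('m)"
  define c0 where "c0 = cmod C * flat 1 (5 / 9)"
  have c0: "c0 > 0" using C(1) by (simp add: c0_def flat_1_pos)
  \<comment> \<open>Chosen so that the inequality \<open>main\<close> below turns into I <= A * dn
    after division by c0 and one factor I; none of its ingredients depends on R.\<close>
  define A where "A = m * \<bar>K\<bar> * ((cmod C)\<^sup>2 * 2 powr (real CARD('n) / 2)) / c0"
  have A0: "A \<ge> 0" using c0 by (simp add: A_def m_def)
  have "mass TYPE(real^'n) R T \<le> A * dual_norm (real CARD('n) / 2) (\<lambda>\<xi>::real^'n. complex_of_real (bump (3 * R) \<xi>))"
    if R: "R > 0" for R
  proof -
    let ?\<psi> = "\<lambda>\<xi>::real^'n. complex_of_real (bump (3 * R) \<xi>)"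
    define \<theta> where "\<theta> = (\<lambda>x. Re (fourier ?\<psi> x))"
    define w where "w = (0 :: ('n, 'm) dist, G R)"
    define p where "p e = (dist_of (\<lambda>x::real^'n. c), e *\<^sub>R G R)" for e
    define dn where "dn = dual_norm s ?\<psi>"
    define I where "I = mass TYPE(real^'n) R T"
    have I0: "0 \<le> I" unfolding I_def mass_def using sin_amp_nonneg[of T _ R] by (intro integral_nonneg_AE) auto
    have \<psi>: "?\<psi> \<in> schwartz" using R by (intro schwartz_of_real schwartz_bump) simp
    have \<theta>: "\<theta> \<in> schwartz" unfolding \<theta>_def by (rule schwartz_Re[OF schwartz_fourier[OF \<psi>]])
    have U: "(\<lambda>x::real^'n. wave R T (x, T)) \<in> schwartz" by (rule schwartz_wave[OF R])
    have GR: "G R \<in> fst (sobolev (s - 1))" unfolding G_def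
      by (rule sobolev_dist_of[OF schwartz_bounded_linear[OF bounded_linear_scaleR_left schwartz_dt_wave[OF R]]])
    then have wX: "w \<in> fst X" by (simp add: w_def X_def sobolev_pair_def sobolev_0)
    have wn: "snd X w = snd (sobolev (s - 1)) (G R)" by (simp add: w_def X_def sobolev_pair_def sobolev_norm_0)
    have pp: "p 0 = p0" by (simp add: p_def p0_def)
    obtain J' where J: "\<And>e. ((\<lambda>e. LINT x|lborel. \<theta> x * cos (e * wave R T (x, T))) has_real_derivative J' e) (at e)"
      "(J' has_real_derivative - (LINT x|lborel. (wave R T (x, T))\<^sup>2 * \<theta> x)) (at 0)"
      by (rule osc_real_derivatives[OF U \<theta>], rule that)
    have "F2 w w (\<lambda>x. Re (fourier ?\<psi> x)) \<bullet> c = - (LINT x|lborel. (wave R T (x, T))\<^sup>2 * \<theta> x)"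
    proof (rule second_derivative_along_line[where ?F2.0=F2 and D=D and s=s and p=p and F=S and F'=F' and w=w and c=c
          and \<psi>="?\<psi>" and J'=J' and J="\<lambda>e. LINT x|lborel. \<theta> x * cos (e * wave R T (x, T))"])
      show "frechet_deriv_within (sobolev_pair s) (sobolev s) S (F' q) q D" if "q \<in> D" for q
        using d(1)[OF that] by (simp add: X_def Y_def)
      show "frechet_deriv_within (sobolev_pair s) (bounded_linear_maps (sobolev_pair s) (sobolev s)) F' F2 (p 0) D"
        using d(2)[OF p0D] by (simp add: X_def Y_def pp F2_def)
      show "p e \<in> D" for e unfolding p_def by (rule path[OF R])
      show "p e - p e' = (e - e') *\<^sub>R w" for e e' by (simp add: p_def w_def scaleR_diff_left)
      show "w \<in> fst (sobolev_pair s)" using wX by (simp add: X_def)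
      show "?\<psi> \<in> schwartz" by (rule \<psi>)
      \<comment> \<open>The c-component of the geodesic map is cos (e u), because c is a unit vector
        orthogonal to v.\<close>
      show "(LINT x|lborel. \<theta> x * cos (e * wave R T (x, T))) = S (p e) (\<lambda>x. Re (fourier ?\<psi> x)) \<bullet> c" for e
      proof -
        have gm: "geodesic_map c v e (\<lambda>x::real^'n. wave R T (x, T)) \<in> borel_measurable borel"
          using target_position_geodesic_map[OF cv U, of e] by (simp add: target_position_def)
        have "integrable lborel (\<lambda>x. \<theta> x *\<^sub>R geodesic_map c v e (wave R T) (x, T))"
        proof (rule Bochner_Integration.integrable_bound[OF schwartz_integrable[OF \<theta>]])
          show "(\<lambda>x. \<theta> x *\<^sub>R geodesic_map c v e (wave R T) (x, T)) \<in> borel_measurable lborel"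
            using borel_measurable_scaleR[OF schwartz_measurable[OF \<theta>] gm] by (simp add: geodesic_map_def)
        qed (simp add: norm_geodesic_map[OF cv])
        from integral_inner_left[OF this, of c]
        have "(LINT x|lborel. \<theta> x *\<^sub>R geodesic_map c v e (wave R T) (x, T)) \<bullet> c
          = (LINT x|lborel. (\<theta> x *\<^sub>R geodesic_map c v e (wave R T) (x, T)) \<bullet> c)" by simp
        also have "\<dots> = (LINT x|lborel. \<theta> x * cos (e * wave R T (x, T)))"
          by (simp add: geodesic_map_def inner_add_left inner_cv[OF cv])
        finally have "(LINT x|lborel. \<theta> x *\<^sub>R geodesic_map c v e (wave R T) (x, T)) \<bullet> c
          = (LINT x|lborel. \<theta> x * cos (e * wave R T (x, T)))" .
        moreover have "S (p e) \<theta> = (LINT x|lborel. \<theta> x *\<^sub>R geodesic_map c v e (wave R T) (x, T))"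
          unfolding p_def Sp[OF R] using \<theta> by (simp add: dist_of_def)
        ultimately show ?thesis unfolding \<theta>_def[symmetric] by (simp only:)
      qed
    qed (rule J)+
    then have "c0 * I\<^sup>2 \<le> \<bar>F2 w w \<theta> \<bullet> c\<bar>"
      using wave_square_test[OF R C(2), of T] by (simp add: \<theta>_def c0_def I_def)
    also have "\<dots> \<le> norm (F2 w w \<theta>)" using Cauchy_Schwarz_ineq2[of "F2 w w \<theta>" c] c1 by simp
    also have "\<dots> \<le> m * dn * snd Y (F2 w w)"
      using sobolev_test_bound[OF _ \<psi>, of "F2 w w" s] K(1)[OF wX] by (simp add: Y_def \<theta>_def m_def dn_def)
    also have "\<dots> \<le> m * dn * (\<bar>K\<bar> * ((cmod C)\<^sup>2 * 2 powr (real CARD('n) / 2) * I))"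
    proof (rule mult_left_mono)
      have "snd Y (F2 w w) \<le> K * (snd X w)\<^sup>2" by (rule K(2)[OF wX])
      also have "\<dots> \<le> \<bar>K\<bar> * (snd X w)\<^sup>2" by (intro mult_right_mono) auto
      also have "(snd X w)\<^sup>2 \<le> (cmod C)\<^sup>2 * 2 powr (real CARD('n) / 2) * I"
        unfolding wn using wave_velocity_norm[OF R v(1) C(2), of T] by (simp add: s_def G_def I_def)
      finally show "snd Y (F2 w w) \<le> \<bar>K\<bar> * ((cmod C)\<^sup>2 * 2 powr (real CARD('n) / 2) * I)"
        by (simp add: mult_left_mono)
    qed (simp add: m_def dn_def dual_norm_nonneg)
    finally have main: "c0 * I\<^sup>2 \<le> m * dn * (\<bar>K\<bar> * ((cmod C)\<^sup>2 * 2 powr (real CARD('n) / 2) * I))" .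
    have "I \<le> A * dn"
    \<comment> \<open>One factor I is cancelled from \<open>main\<close>; positivity of the mass for
      an individual R is not assumed, so the case 0 is separate.\<close>
    proof (cases "I = 0")
      case True
      then show ?thesis using A0 by (simp add: dn_def dual_norm_nonneg)
    next
      case False
      then have "I > 0" using I0 by simp
      have "(c0 * I) * I \<le> (m * dn * (\<bar>K\<bar> * ((cmod C)\<^sup>2 * 2 powr (real CARD('n) / 2)))) * I"
        using main by (simp add: power2_eq_square mult_ac)
      then have "c0 * I \<le> m * dn * (\<bar>K\<bar> * ((cmod C)\<^sup>2 * 2 powr (real CARD('n) / 2)))"
        using \<open>I > 0\<close> by (simp add: mult_le_cancel_right)
      then show ?thesis using c0 by (simp add: A_def pos_le_divide_eq mult_ac)
    qed
    then show ?thesis by (simp add: I_def dn_def s_def)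
  qed
  then show False using mass_not_bounded_by_dual_norm[OF T, where 'n='n] by blast
qed

end
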